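(* Let $n\ge1$, $k\ge0$ be integers, $1\le p,r\le2\le q\le\infty$, $\ell\ge0$ and $s\in\mathbb{R}$. Suppose there are constants $m_1\ge m_0>0$ such that $m_0(1+|\xi|^2)\le m(\xi)\le m_1(1+|\xi|^2)$ for all $\xi\in\mathbb{R}^n$. Then the solution semigroup $e^{\Delta P_st}$ satisfies the following time-decay property: (i) When $s\le 1$, $$\|\nabla^ke^{\Delta P_st}u_0\|_{L^q}\le C(1+t)^{-\frac n2\left(\frac1p-\frac1q\right)-\frac k2}\|u_0\|_{L^p}+Ce^{-\lambda t}\left\|\nabla^{k+[n(\frac1r-\frac1q)]_*}u_0\right\|_{L^r}$$ for any $t\ge0$, where $C=C(n,k,p,r,q,s)$ and $\lambda=\lambda(s)>0$ are constants independent of $u_0$. (ii) When $s>1$, $$\|\nabla^ke^{\Delta P_st}u_0\|_{L^q}\le C(1+t)^{-\frac n2\left(\frac1p-\frac1q\right)-\frac k2}\|u_0\|_{L^p}+C(1+t)^{-\frac{\ell}{2(s-1)}}\left\|\nabla^{k+[\ell+n(\frac1r-\frac1q)]_*}u_0\right\|_{L^r}$$ for any $t\ge0$, where $C=C(n,k,p,r,q,\ell,s)$ is a constant independent of $u_0$.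
   Context: $m:\mathbb{R}^n\to(0,\infty)$ is a strictly positive continuous function. The semigroup is $$e^{\Delta P_st}u_0=\mathcal{F}^{-1}\left\{e^{-\frac{|\xi|^2}{m(\xi)^s}t}\hat u_0(\xi)\right\},$$ i.e. the solution of $\partial_tu-\Delta P_su=0$, $u|_{t=0}=u_0$ on $\mathbb{R}^n$, where $P_su=\mathcal{F}^{-1}\{[m(\xi)]^{-s}\mathcal{F}u\}$. The notation $[\cdot]_*$ is defined by $$\left[\ell+n\left(\tfrac1r-\tfrac1q\right)\right]_*=\begin{cases}\ell,&\text{if }\ell\text{ is an integer and }r=q=2,\\ \left[\ell+n\left(\frac1r-\frac1q\right)\right]+1,&\text{otherwise},\end{cases}$$ where $[\cdot]$ is the integer part; in (i) it is used with $\ell=0$. $\nabla^j$ denotes the collection of all spatial derivatives of order $j$. The estimates are for initial data $u_0$ for which the norms on the right-hand side are finite. *)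

theory Defs
  imports "HOL-Analysis.Analysis" "HOL-Probability.Essential_Supremum"
begin

section \<open>Lebesgue norms\<close>

text \<open>Exponents are extended nonnegative reals. \<open>recip p\<close> is the real number $1/p$,
  with $1/\infty = 0$.\<close>

definition recip :: "ennreal \<Rightarrow> real" where
  "recip p = enn2real (inverse p)"

text \<open>Only meant for $1 \le p \le \infty$ and Borel measurable \<open>f\<close>. Elements of $L^p$ are
  represented by Borel functions; every Lebesgue measurable function agrees almost everywhere
  with one.\<close>

definition Lp_norm :: "ennreal \<Rightarrow> (real^'n \<Rightarrow> complex) \<Rightarrow> ennreal" where
  "Lp_norm p f =
     (if p = \<infinity> then esssup lborel (\<lambda>x. ennreal (norm (f x)))
      else let I = (\<integral>\<^sup>+ x. ennreal (norm (f x) powr enn2real p) \<partial>lborel)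
           in if I = \<infinity> then \<infinity> else ennreal (enn2real I powr recip p))"

definition Lp_space :: "ennreal \<Rightarrow> (real^'n \<Rightarrow> complex) set" where
  "Lp_space p = {f. f \<in> borel_measurable lborel \<and> Lp_norm p f < \<infinity>}"

section \<open>Schwartz functions and the Fourier transform\<close>

definition partial_deriv :: "'n::finite \<Rightarrow> (real^'n \<Rightarrow> complex) \<Rightarrow> real^'n \<Rightarrow> complex" where
  "partial_deriv i f x = frechet_derivative f (at x) (axis i 1)"

text \<open>A list \<open>[i\<^sub>1, \<dots>, i\<^sub>j]\<close> of directions stands for the iterated derivative
  $\partial_{i_1} \cdots \partial_{i_j}$ of order $j$.\<close>

definition iter_deriv :: "'n::finite list \<Rightarrow> (real^'n \<Rightarrow> complex) \<Rightarrow> real^'n \<Rightarrow> complex" where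
  "iter_deriv is f = foldr partial_deriv is f"

definition schwartz :: "(real^'n::finite \<Rightarrow> complex) set" where
  "schwartz = {\<phi>. (\<forall>is x. iter_deriv is \<phi> differentiable (at x)) \<and>
                  (\<forall>is N. bounded (range (\<lambda>x. (1 + norm x) ^ N *\<^sub>R iter_deriv is \<phi> x)))}"

text \<open>The normalisation is the one for which $-\Delta$ has symbol $|\xi|^2$.\<close>

definition fourier :: "(real^'n::finite \<Rightarrow> complex) \<Rightarrow> real^'n \<Rightarrow> complex" where
  "fourier \<phi> \<xi> = (LINT x|lborel. cis (- (x \<bullet> \<xi>)) * \<phi> x)"

definition inv_fourier :: "(real^'n::finite \<Rightarrow> complex) \<Rightarrow> real^'n \<Rightarrow> complex" where
  "inv_fourier \<phi> x = of_real (1 / (2 * pi) ^ CARD('n)) * (LINT \<xi>|lborel. cis (x \<bullet> \<xi>) * \<phi> \<xi>)"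

section \<open>Tempered distributions\<close>

text \<open>Distributions are functionals of which only the values on \<open>schwartz\<close> are meaningful;
  the operations below are the usual ones, defined by duality.\<close>

type_synonym 'n tdistr = "(real^'n \<Rightarrow> complex) \<Rightarrow> complex"

definition regular :: "(real^'n::finite \<Rightarrow> complex) \<Rightarrow> 'n tdistr" where
  "regular f \<phi> = (LINT x|lborel. f x * \<phi> x)"

definition represents :: "(real^'n::finite \<Rightarrow> complex) \<Rightarrow> 'n tdistr \<Rightarrow> bool" where
  "represents f T \<longleftrightarrow> f \<in> borel_measurable lborel \<and>
     (\<forall>\<phi>\<in>schwartz. integrable lborel (\<lambda>x. f x * \<phi> x) \<and> T \<phi> = regular f \<phi>)"

definition distr_fourier :: "'n::finite tdistr \<Rightarrow> 'n tdistr" where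
  "distr_fourier T \<phi> = T (fourier \<phi>)"

definition distr_inv_fourier :: "'n::finite tdistr \<Rightarrow> 'n tdistr" where
  "distr_inv_fourier T \<phi> = T (inv_fourier \<phi>)"

definition distr_partial :: "'n::finite \<Rightarrow> 'n tdistr \<Rightarrow> 'n tdistr" where
  "distr_partial i T \<phi> = - T (partial_deriv i \<phi>)"

definition distr_iter_deriv :: "'n::finite list \<Rightarrow> 'n tdistr \<Rightarrow> 'n tdistr" where
  "distr_iter_deriv is T = foldr distr_partial is T"

text \<open>The $L^q$ norm of a distribution: \<open>\<infinity>\<close> unless \<open>T\<close> is given by a function in $L^q$, which is then
  unique almost everywhere, so that the infimum is over a single value.\<close>

definition distr_norm :: "ennreal \<Rightarrow> 'n::finite tdistr \<Rightarrow> ennreal" where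
  "distr_norm q T = (INF f\<in>{f. represents f T}. Lp_norm q f)"

text \<open>$\|\nabla^j T\|_{L^q}$, as the sum of the norms of all components of the tensor of derivatives
  of order $j$. In particular, it is finite iff every distributional derivative of order $j$ is
  in $L^q$.\<close>

definition grad_norm :: "ennreal \<Rightarrow> nat \<Rightarrow> 'n::finite tdistr \<Rightarrow> ennreal" where
  "grad_norm q j T = (\<Sum>is\<in>{is. length is = j}. distr_norm q (distr_iter_deriv is T))"

section \<open>The semigroup\<close>

text \<open>For \<open>u\<close> in $L^p$ with $1 \le p \le 2$, the distributional Fourier transform of \<open>u\<close> is a
  function (Hausdorff--Young), unique almost everywhere. This is what gives a meaning to its
  product with the merely continuous symbol of the semigroup.\<close>

definition fourier_fun :: "(real^'n::finite \<Rightarrow> complex) \<Rightarrow> real^'n \<Rightarrow> complex" where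
  "fourier_fun u = (SOME g. represents g (distr_fourier (regular u)))"

definition semigroup_P ::
    "(real^'n::finite \<Rightarrow> real) \<Rightarrow> real \<Rightarrow> real \<Rightarrow> (real^'n \<Rightarrow> complex) \<Rightarrow> 'n tdistr" where
  "semigroup_P m s t u =
     distr_inv_fourier (regular
       (\<lambda>\<xi>. of_real (exp (- ((norm \<xi>)\<^sup>2 / m \<xi> powr s) * t)) * fourier_fun u \<xi>))"

text \<open>\<open>star_bracket d l r q\<close> is $[\ell + d(1/r - 1/q)]_*$ in dimension \<open>d\<close>. For $\ell \ge 0$ and
  $r \le q$ the floors are nonnegative, so \<open>nat\<close> does not truncate.\<close>

definition star_bracket :: "nat \<Rightarrow> real \<Rightarrow> ennreal \<Rightarrow> ennreal \<Rightarrow> nat" where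
  "star_bracket d l r q =
     (if l \<in> \<int> \<and> r = 2 \<and> q = 2 then nat \<lfloor>l\<rfloor>
      else nat \<lfloor>l + real d * (recip r - recip q)\<rfloor> + 1)"

end

theory Submission
  imports Defs "HOL-Probability.Characteristic_Functions"
begin

text \<open>By Hausdorff--Young, the \<open>L\<^sup>q\<close> norm of $\nabla^k e^{\Delta P_s t} u_0$ is at most a constant times the
  $L^{q'}$ norm of $|\xi|^k e^{-|\xi|^2 m^{-s} t} |\hat u_0|$. For $|\xi| \le 1$ the symbol is dominated by a
  Gaussian, and Hoelder's inequality against $\hat u_0 \in L^{p'}$ gives the heat decay. For $|\xi| > 1$ one
  has $|\xi|^2 m^{-s} \ge c |\xi|^{2 - 2s}$, so that the exponential is at most $e^{-\lambda t}$ if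
  $s \le 1$ and at most $C (1 + t)^{-\ell / (2(s-1))} |\xi|^\ell$ if $s > 1$; here Hoelder's inequality is
  applied to $|\xi|^{\ell - N}$ and $|\xi|^{k + N} \hat u_0 \in L^{r'}$, where $N$ is the bracket.

  Hausdorff--Young is needed only up to a constant and is obtained from the trivial bound on $L^1$ and
  Plancherel's inequality on $L^2$ by real interpolation.\<close>

section \<open>Integrals over Euclidean space\<close>

text \<open>The semigroup is a distribution and \<open>fourier_fun\<close> an arbitrary choice among
  representing functions, so a norm of either means something only because representing functions
  agree almost everywhere. This uniqueness is tested on Gaussians with a linear term in the
  exponent: they are Schwartz functions, and mollification with them reaches every bounded
  continuous function. The exponents in Hoelder's inequality are dictated by 1/q' = 1/a + 1/p' = 1/b
  + 1/r', that is 1/a = 1/p - 1/q and 1/b = 1/r - 1/q. The bracket is the least N for which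
  |\<xi>|^(l-N) belongs to L^b on |\<xi>| > 1: if b is finite, N - l must exceed n/b strictly, while
  for infinite b it need only be nonnegative. As r \<le> 2 \<le> q, the exponent b is infinite
  exactly when r = q = 2, which is the exceptional case of the bracket. Only the existence of
  constants is claimed, but uniformly in the data and in time. Hence crude forms of the classical
  inequalities suffice, such as a factor 2 in the triangle inequality.\<close>

lemma borel_measurable_cis[measurable]: "cis \<in> borel_measurable borel"
  by (intro borel_measurable_continuous_onI continuous_intros)

section \<open>Changes of variables and integrals of products\<close>

lemma lborel_integral_affine_euclidean:
  fixes f :: "'a::euclidean_space \<Rightarrow> 'b::{banach, second_countable_topology}"
  assumes [measurable]: "f \<in> borel_measurable borel" and c: "c \<noteq> 0"
  shows "integral\<^sup>L lborel f = (\<bar>c\<bar> ^ DIM('a)) *\<^sub>R (LINT x|lborel. f (t + c *\<^sub>R x))"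
  by (subst lborel_affine[OF c, of t])
     (simp add: integral_density integral_distr)

lemma nn_integral_lborel_affine_euclidean:
  fixes f :: "'a::euclidean_space \<Rightarrow> ennreal"
  assumes [measurable]: "f \<in> borel_measurable borel" and c: "c \<noteq> 0"
  shows "integral\<^sup>N lborel f = ennreal (\<bar>c\<bar> ^ DIM('a)) * (\<integral>\<^sup>+x. f (t + c *\<^sub>R x) \<partial>lborel)"
  by (subst lborel_affine[OF c, of t])
     (simp add: nn_integral_density nn_integral_distr nn_integral_cmult)

lemma integrable_lborel_affine_euclidean:
  fixes f :: "'a::euclidean_space \<Rightarrow> 'b::{banach, second_countable_topology}"
  assumes f: "integrable lborel f" and c: "c \<noteq> 0"
  shows "integrable lborel (\<lambda>x. f (t + c *\<^sub>R x))"
proof -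
  have [measurable]: "f \<in> borel_measurable borel" using f by auto
  have "ennreal (\<bar>c\<bar> ^ DIM('a)) * (\<integral>\<^sup>+x. ennreal (norm (f (t + c *\<^sub>R x))) \<partial>lborel) < \<infinity>"
    using f nn_integral_lborel_affine_euclidean[of "\<lambda>x. ennreal (norm (f x))" c t] c
    by (simp add: integrable_iff_bounded)
  hence "(\<integral>\<^sup>+x. ennreal (norm (f (t + c *\<^sub>R x))) \<partial>lborel) < \<infinity>"
    using c by (auto simp: ennreal_mult_less_top)
  thus ?thesis by (simp add: integrable_iff_bounded)
qed

text \<open>\<open>lborel\<close> is the image of a product of one-dimensional Lebesgue measures
  under the map that assembles a vector from its coordinates; after this change of variables, Fubini
  for finite products applies.\<close>

lemma
  fixes f :: "'a::euclidean_space \<Rightarrow> real \<Rightarrow> 'b::{real_normed_field,banach,second_countable_topology}"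
  assumes "\<And>b. b \<in> Basis \<Longrightarrow> integrable lborel (f b)"
  shows integrable_lborel_prod_Basis: "integrable lborel (\<lambda>x. \<Prod>b\<in>Basis. f b (x \<bullet> b))"
    and integral_lborel_prod_Basis:
      "(LINT x|lborel. (\<Prod>b\<in>Basis. f b (x \<bullet> b))) = (\<Prod>b\<in>Basis. integral\<^sup>L lborel (f b))"
proof -
  interpret product_sigma_finite "\<lambda>b::'a. lborel :: real measure" by standard
  have [measurable]: "f b \<in> borel_measurable borel" if "b \<in> Basis" for b
    using assms[OF that] by auto
  have *: "(\<Prod>b\<in>Basis. f b ((\<Sum>b\<in>Basis. g b *\<^sub>R b) \<bullet> b)) = (\<Prod>b\<in>Basis. f b (g b))" for g :: "'a \<Rightarrow> real"
    by (intro prod.cong) simp_all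
  show "integrable lborel (\<lambda>x. \<Prod>b\<in>Basis. f b (x \<bullet> b))"
    apply (subst lborel_eq)
    apply (subst integrable_distr_eq)
    apply measurable
    unfolding * by (intro product_integrable_prod assms) auto
  show "(LINT x|lborel. (\<Prod>b\<in>Basis. f b (x \<bullet> b))) = (\<Prod>b\<in>Basis. integral\<^sup>L lborel (f b))"
    apply (subst lborel_eq)
    apply (subst integral_distr)
    apply measurable
    unfolding * by (intro product_integral_prod assms) auto
qed

section \<open>Gaussian integrals and integrable powers\<close>

lemma
  fixes a t :: real
  assumes "a > 0"
  shows integrable_gaussian_cis_real: "integrable lborel (\<lambda>x. cis (x * t) * of_real (exp (- (a * x\<^sup>2 / 2))))"
    and integral_gaussian_cis_real:
      "(LINT x|lborel. cis (x * t) * of_real (exp (- (a * x\<^sup>2 / 2)))) =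
        of_real (sqrt (2 * pi / a) * exp (- (t\<^sup>2 / (2 * a))))"
proof -
  \<comment> \<open>Up to a factor, the Gaussian is the normal density of standard deviation
    \<open>\<sigma>\<close>. Rescaling by \<open>\<sigma>\<close> reduces the integral to the
    characteristic function of the standard normal distribution.\<close>
  define \<sigma> where "\<sigma> = 1 / sqrt a"
  have s: "\<sigma> > 0" "\<sigma>\<^sup>2 = 1 / a" using assms by (auto simp: \<sigma>_def power_divide)
  have d: "normal_density 0 \<sigma> x * sqrt (2 * pi / a) = exp (- (a * x\<^sup>2 / 2))" for x
    using s assms by (simp add: normal_density_def real_sqrt_divide real_sqrt_mult)
  have int: "integrable lborel (\<lambda>x. exp (- (a * x\<^sup>2 / 2)))"
    unfolding d[symmetric] using s by (intro integrable_mult_left integrable_normal_density)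
  show "integrable lborel (\<lambda>x. cis (x * t) * of_real (exp (- (a * x\<^sup>2 / 2))))"
    by (rule Bochner_Integration.integrable_bound[OF int]) (auto simp: norm_mult)
  have e: "std_normal_density x * sqrt (2 * pi) = exp (- (x\<^sup>2 / 2))" for x
    by (simp add: std_normal_density_def)
  have char: "(LINT x|lborel. std_normal_density x *\<^sub>R cis (u * x)) = of_real (exp (- (u\<^sup>2 / 2)))" for u
    using fun_cong[OF char_std_normal_distribution, of u]
    by (simp add: char_def integral_density cis_conv_exp exp_of_real[symmetric] mult.commute)
  have "(LINT x|lborel. cis (x * t) * of_real (exp (- (a * x\<^sup>2 / 2)))) =
     \<bar>\<sigma>\<bar> *\<^sub>R (LINT x|lborel. cis ((0 + \<sigma> * x) * t) * of_real (exp (- (a * (0 + \<sigma> * x)\<^sup>2 / 2))))"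
    using s by (intro lborel_integral_real_affine) auto
  also have "(\<lambda>x. cis ((0 + \<sigma> * x) * t) * of_real (exp (- (a * (0 + \<sigma> * x)\<^sup>2 / 2)))) =
     (\<lambda>x. sqrt (2 * pi) *\<^sub>R (std_normal_density x *\<^sub>R cis ((\<sigma> * t) * x)))"
    using s assms by (auto simp: power_mult_distrib e[symmetric] scaleR_conv_of_real algebra_simps)
  also have "(LINT x|lborel. sqrt (2 * pi) *\<^sub>R (std_normal_density x *\<^sub>R cis ((\<sigma> * t) * x)))
      = of_real (sqrt (2 * pi) * exp (- ((\<sigma> * t)\<^sup>2 / 2)))"
    by (simp only: integral_scaleR_right char) (simp add: scaleR_conv_of_real)
  also have "\<bar>\<sigma>\<bar> *\<^sub>R of_real (sqrt (2 * pi) * exp (- ((\<sigma> * t)\<^sup>2 / 2))) =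
     complex_of_real (sqrt (2 * pi / a) * exp (- (t\<^sup>2 / (2 * a))))"
    using s assms by (simp add: scaleR_conv_of_real power_mult_distrib power_divide \<sigma>_def real_sqrt_divide)
  finally show "(LINT x|lborel. cis (x * t) * of_real (exp (- (a * x\<^sup>2 / 2)))) =
        of_real (sqrt (2 * pi / a) * exp (- (t\<^sup>2 / (2 * a))))" .
qed

lemma cis_sum: "cis (\<Sum>i\<in>A. f i) = (\<Prod>i\<in>A. cis (f i))"
  by (induction A rule: infinite_finite_induct) (auto simp: cis_mult[symmetric])

lemma
  fixes \<xi> :: "'a::euclidean_space"
  assumes "a > 0"
  shows integrable_gaussian_cis:
      "integrable lborel (\<lambda>x::'a. cis (x \<bullet> \<xi>) * of_real (exp (- (a * (norm x)\<^sup>2 / 2))))"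
    and integral_gaussian_cis:
      "(LINT x|lborel. cis (x \<bullet> \<xi>) * of_real (exp (- (a * (norm x)\<^sup>2 / 2)))) =
        of_real (sqrt (2 * pi / a) ^ DIM('a) * exp (- ((norm \<xi>)\<^sup>2 / (2 * a))))"
proof -
  have n: "(norm x)\<^sup>2 = (\<Sum>b\<in>Basis. (x \<bullet> b)\<^sup>2)" for x :: 'a
    unfolding power2_norm_eq_inner by (subst euclidean_inner) (simp add: power2_eq_square)
  \<comment> \<open>The character and the Gaussian both factor over the coordinates, which leaves
    one-dimensional integrals.\<close>
  have *: "(\<lambda>x::'a. cis (x \<bullet> \<xi>) * of_real (exp (- (a * (norm x)\<^sup>2 / 2)))) =
    (\<lambda>x. \<Prod>b\<in>Basis. cis ((x \<bullet> b) * (\<xi> \<bullet> b)) * of_real (exp (- (a * (x \<bullet> b)\<^sup>2 / 2))))"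
    by (auto simp: n euclidean_inner[of _ \<xi>] cis_sum prod.distrib exp_sum sum_distrib_left
        sum_divide_distrib sum_negf[symmetric] simp del: sum_negf)
  show "integrable lborel (\<lambda>x::'a. cis (x \<bullet> \<xi>) * of_real (exp (- (a * (norm x)\<^sup>2 / 2))))"
    unfolding * by (intro integrable_lborel_prod_Basis integrable_gaussian_cis_real assms)
  have "(LINT x|lborel. cis (x \<bullet> \<xi>) * of_real (exp (- (a * (norm x)\<^sup>2 / 2)))) =
     (\<Prod>b\<in>Basis. complex_of_real (sqrt (2 * pi / a) * exp (- ((\<xi> \<bullet> b)\<^sup>2 / (2 * a)))))"
    unfolding *
    using integral_lborel_prod_Basis[of "\<lambda>b u. cis (u * (\<xi> \<bullet> b)) * of_real (exp (- (a * u\<^sup>2 / 2)))"]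
    by (simp add: integrable_gaussian_cis_real[OF assms] integral_gaussian_cis_real[OF assms] del: of_real_mult)
  also have "\<dots> = of_real (sqrt (2 * pi / a) ^ DIM('a) * exp (- ((norm \<xi>)\<^sup>2 / (2 * a))))"
    by (simp add: n prod.distrib exp_sum sum_divide_distrib sum_negf[symmetric] del: sum_negf)
  finally show "(LINT x|lborel. cis (x \<bullet> \<xi>) * of_real (exp (- (a * (norm x)\<^sup>2 / 2)))) =
        of_real (sqrt (2 * pi / a) ^ DIM('a) * exp (- ((norm \<xi>)\<^sup>2 / (2 * a))))" .
qed

lemma
  assumes "a > 0"
  shows integrable_gaussian: "integrable lborel (\<lambda>x::'a::euclidean_space. exp (- (a * (norm x)\<^sup>2 / 2)))"
    and integral_gaussian: "(LINT x::'a|lborel. exp (- (a * (norm x)\<^sup>2 / 2))) = sqrt (2 * pi / a) ^ DIM('a)"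
proof -
  show "integrable lborel (\<lambda>x::'a::euclidean_space. exp (- (a * (norm x)\<^sup>2 / 2)))"
    using integrable_norm[OF integrable_gaussian_cis[OF assms, of "0::'a"]] by simp
  show "(LINT x::'a|lborel. exp (- (a * (norm x)\<^sup>2 / 2))) = sqrt (2 * pi / a) ^ DIM('a)"
    using integral_gaussian_cis[OF assms, of "0::'a"] 
    by (simp del: of_real_mult of_real_power of_real_divide)
qed

text \<open>Dyadic decomposition: where 1 + |x| lies in [2^j, 2^(j+1)) the function is at most
  2^(-aj), and \<open>B j\<close>, which contains this region, has volume proportional to 2^(nj).
  The resulting series is geometric with ratio 2^(n-a) < 1.\<close>

lemma integrable_powr_decay:
  assumes a: "(a::real) > DIM('a)"
  shows "integrable lborel (\<lambda>x::'a::euclidean_space. (1 + norm x) powr (- a))"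
proof -
  define v where "v = unit_ball_vol (real DIM('a))"
  have v: "v \<ge> 0" by (simp add: v_def)
  define B where "B j = cball (0 :: 'a) (2 ^ Suc j)" for j :: nat
  have [measurable]: "B j \<in> sets borel" for j by (simp add: B_def)
  have bd: "ennreal ((1 + norm x) powr (- a)) \<le>
    (\<Sum>j. ennreal (2 powr (- a * real j)) * indicator (B j) x)" for x :: 'a
  proof -
    define j where "j = nat \<lfloor>log 2 (1 + norm x)\<rfloor>"
    have l0: "log 2 (1 + norm x) \<ge> 0" by (simp add: log_def)
    have j: "real j \<le> log 2 (1 + norm x)" "log 2 (1 + norm x) < real (Suc j)"
      using l0 by (auto simp: j_def) linarith+
    have "2 powr real j \<le> 1 + norm x"
      using j(1) by (subst (asm) le_log_iff) (auto simp: add_pos_nonneg)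
    hence 1: "(1 + norm x) powr (- a) \<le> 2 powr (- a * real j)"
      using a powr_mono2'[of "-a" "2 powr real j" "1 + norm x"] by (simp add: powr_powr mult.commute)
    have "1 + norm x < 2 powr real (Suc j)"
      using j(2) by (subst (asm) log_less_iff) (auto simp: add_pos_nonneg)
    hence 2: "x \<in> B j" unfolding B_def by (subst (asm) powr_realpow) auto
    have "ennreal ((1 + norm x) powr (- a)) \<le>
      ennreal (2 powr (- a * real j)) * indicator (B j) x"
      using 1 2 by (simp add: ennreal_leI)
    also have "\<dots> = (\<Sum>i\<in>{j}. ennreal (2 powr (- a * real i)) * indicator (B i) x)" by (subst sum.insert) auto
    also have "\<dots> \<le> (\<Sum>j. ennreal (2 powr (- a * real j)) * indicator (B j) x)"
      by (intro sum_le_suminf) auto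
    finally show ?thesis .
  qed
  define \<rho> where "\<rho> = 2 powr (real DIM('a) - a)"
  have \<rho>: "0 \<le> \<rho>" "\<rho> < 1" using a by (auto simp: \<rho>_def powr_less_one)
  have "(\<integral>\<^sup>+x. ennreal ((1 + norm (x::'a)) powr (- a)) \<partial>lborel) \<le>
     (\<integral>\<^sup>+x. (\<Sum>j. ennreal (2 powr (- a * real j)) * indicator (B j) (x::'a)) \<partial>lborel)"
    by (rule nn_integral_mono) (rule bd)
  also have "\<dots> = (\<Sum>j. ennreal (2 powr (- a * real j)) * emeasure lborel (B j))"
    by (subst nn_integral_suminf) (simp_all add: nn_integral_cmult_indicator)
  also have "\<dots> = (\<Sum>j. ennreal (v * 2 ^ DIM('a) * \<rho> ^ j))"
  proof (intro suminf_cong)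
    fix j
    have "2 powr (- a * real j) * (v * (2 ^ Suc j) ^ DIM('a)) = v * 2 ^ DIM('a) * \<rho> ^ j"
    proof -
      have "((2::real) ^ Suc j) ^ DIM('a) = 2 ^ DIM('a) * (2 powr real DIM('a)) ^ j"
        by (simp add: power_mult_distrib powr_realpow mult.commute flip: power_mult)
      moreover have "2 powr (- a * real j) = (2 powr (- a)) ^ j"
        by (simp add: powr_powr flip: powr_realpow)
      ultimately show ?thesis
        by (simp add: \<rho>_def diff_conv_add_uminus powr_add power_mult_distrib del: add_uminus_conv_diff)
    qed
    moreover have "ennreal (2 powr (- a * real j)) * emeasure lborel (B j) = ennreal (2 powr (- a * real j) * (v * (2 ^ Suc j) ^ DIM('a)))"
      using v by (simp only: B_def emeasure_cball[OF zero_le_power] zero_le_numeral v_def[symmetric] ennreal_mult' powr_ge_zero)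
    ultimately show "ennreal (2 powr (- a * real j)) * emeasure lborel (B j) = ennreal (v * 2 ^ DIM('a) * \<rho> ^ j)"
      by (simp only:)
  qed
  also have "\<dots> < \<infinity>"
    using \<rho> v by (subst suminf_ennreal2) (auto intro!: summable_mult summable_geometric)
  finally show ?thesis by (simp add: integrable_iff_bounded)
qed

section \<open>Functions determined by their integrals\<close>

lemma AE_zero_if_open_integrals_zero:
  fixes w :: "'a::euclidean_space \<Rightarrow> real"
  assumes w: "integrable lborel w"
    and open0: "\<And>U. open U \<Longrightarrow> (LINT x|lborel. w x * indicator U x) = 0"
  shows "AE x in lborel. w x = 0"
proof -
  have [measurable]: "w \<in> borel_measurable borel" using w by auto
  define P where "P x = max 0 (w x)" for x
  define N where "N x = max 0 (- w x)" for x
  have PN[measurable]: "P \<in> borel_measurable borel" "N \<in> borel_measurable borel"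
    unfolding P_def N_def by measurable
  have iP: "integrable lborel P" and iN: "integrable lborel N"
    unfolding P_def N_def using w by auto
  have pos: "P x \<ge> 0" "N x \<ge> 0" for x by (auto simp: P_def N_def)
  have eP: "emeasure (density lborel (\<lambda>x. ennreal (P x))) A = ennreal (LINT x|lborel. P x * indicator A x)"
    and eN: "emeasure (density lborel (\<lambda>x. ennreal (N x))) A = ennreal (LINT x|lborel. N x * indicator A x)"
    and dif: "(LINT x|lborel. w x * indicator A x) = (LINT x|lborel. P x * indicator A x) - (LINT x|lborel. N x * indicator A x)"
    if [measurable]: "A \<in> sets borel" for A
  proof -
    have i: "integrable lborel (\<lambda>x. P x * indicator A x)" "integrable lborel (\<lambda>x. N x * indicator A x)"
      using integrable_mult_indicator[OF _ iP, of A] integrable_mult_indicator[OF _ iN, of A]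
      by (simp_all add: mult.commute)
    show "emeasure (density lborel (\<lambda>x. ennreal (P x))) A = ennreal (LINT x|lborel. P x * indicator A x)"
      using i pos by (simp add: emeasure_density nn_integral_eq_integral[symmetric] ennreal_mult' ennreal_indicator)
    show "emeasure (density lborel (\<lambda>x. ennreal (N x))) A = ennreal (LINT x|lborel. N x * indicator A x)"
      using i pos by (simp add: emeasure_density nn_integral_eq_integral[symmetric] ennreal_mult' ennreal_indicator)
    have "w x * indicator A x = P x * indicator A x - N x * indicator A x" for x
      by (auto simp: P_def N_def max_def split: split_indicator)
    thus "(LINT x|lborel. w x * indicator A x) = (LINT x|lborel. P x * indicator A x) - (LINT x|lborel. N x * indicator A x)"
      using i by simp
  qed
  \<comment> \<open>The positive and the negative part of \<open>w\<close> are densities of finite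
    measures that agree on open sets. These form a generator of the Borel sets stable under
    intersection, so the measures and hence the densities coincide.\<close>
  have "density lborel (\<lambda>x. ennreal (P x)) = density lborel (\<lambda>x. ennreal (N x))"
  proof (rule measure_eqI_generator_eq[where E="Collect open" and \<Omega>=UNIV and A="\<lambda>_. UNIV"])
    show "Int_stable (Collect (open :: 'a set \<Rightarrow> bool))" by (auto simp: Int_stable_def)
    show "emeasure (density lborel (\<lambda>x. ennreal (P x))) X = emeasure (density lborel (\<lambda>x. ennreal (N x))) X"
      if "X \<in> Collect open" for X
      using that open0[of X] by (simp add: eP eN dif)
    show "sets (density lborel (\<lambda>x. ennreal (P x))) = sigma_sets UNIV (Collect open)"
         "sets (density lborel (\<lambda>x. ennreal (N x))) = sigma_sets UNIV (Collect open)"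
      by (simp_all add: borel_def)
    show "emeasure (density lborel (\<lambda>x. ennreal (P x))) UNIV \<noteq> \<infinity>" by (simp add: eP)
  qed auto
  hence "AE x in lborel. ennreal (P x) = ennreal (N x)"
    by (subst (asm) sigma_finite_measure.density_unique_iff) (auto simp: sigma_finite_lborel)
  thus ?thesis
    by (rule eventually_mono) (auto simp: pos P_def N_def max_def split: if_splits)
qed

text \<open>The indicator of an open set is a pointwise limit of continuous functions between 0 and
  1, namely truncated multiples of the distance to the complement. Dominated convergence reduces the
  claim to open sets, for the real and the imaginary part separately.\<close>

lemma AE_zero_if_bounded_continuous_integrals_zero:
  fixes w :: "'a::euclidean_space \<Rightarrow> complex"
  assumes w: "integrable lborel w"
    and cont0: "\<And>g :: 'a \<Rightarrow> real. continuous_on UNIV g \<Longrightarrow> (\<And>x. 0 \<le> g x \<and> g x \<le> 1) \<Longrightarrow> (LINT x|lborel. w x * of_real (g x)) = 0"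
  shows "AE x in lborel. w x = 0"
proof -
  have [measurable]: "w \<in> borel_measurable borel" using w by auto
  have open0: "(LINT x|lborel. w x * indicator U x) = 0" if U: "open U" for U
  \<comment> \<open>By convention \<open>infdist x {} = 0\<close>, so the approximating functions
    below would all vanish for \<open>U = UNIV\<close>.\<close>
  proof (cases "U = UNIV")
    case True
    thus ?thesis using cont0[of "\<lambda>_. 1"] by simp
  next
    case False
    define g where "g k x = min 1 (real k * infdist x (- U))" for k x
    have cg: "continuous_on UNIV (g k)" for k
      unfolding g_def by (intro continuous_intros)
    have gb: "0 \<le> g k x \<and> g k x \<le> 1" for k x by (auto simp: g_def infdist_nonneg)
    have [measurable]: "g k \<in> borel_measurable borel" for k
      by (intro borel_measurable_continuous_onI cg)
    have [measurable]: "U \<in> sets borel" using U by auto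
    have lim: "(\<lambda>k. g k x) \<longlonglongrightarrow> indicator U x" for x
    proof (cases "x \<in> U")
      case True
      hence "infdist x (- U) > 0"
        using U False infdist_pos_not_in_closed[of "-U" x] by (auto simp: closed_Compl)
      hence "eventually (\<lambda>k. 1 / infdist x (- U) \<le> real k) sequentially"
        using eventually_ge_at_top[of "nat \<lceil>1 / infdist x (- U)\<rceil>"] by (auto elim!: eventually_mono)
      hence "eventually (\<lambda>k. g k x = 1) sequentially"
        by (rule eventually_mono) (use \<open>infdist x (- U) > 0\<close> in \<open>auto simp: g_def field_simps min_def\<close>)
      thus ?thesis using True by (auto intro: tendsto_eventually)
    next
      case False
      thus ?thesis by (simp add: g_def)
    qed
    have "(\<lambda>k. LINT x|lborel. w x * of_real (g k x)) \<longlonglongrightarrow> (LINT x|lborel. w x * indicator U x)"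
    proof (rule integral_dominated_convergence[where w="\<lambda>x. norm (w x)"])
      show "AE x in lborel. (\<lambda>k. w x * of_real (g k x)) \<longlonglongrightarrow> w x * indicator U x"
      proof (rule AE_I2)
        fix x
        have "(\<lambda>k. w x * of_real (g k x)) \<longlonglongrightarrow> w x * of_real (indicator U x)"
          by (intro tendsto_intros lim)
        thus "(\<lambda>k. w x * of_real (g k x)) \<longlonglongrightarrow> w x * indicator U x"
          by (simp only: of_real_indicator)
      qed
      show "AE x in lborel. norm (w x * of_real (g k x)) \<le> norm (w x)" for k
        using gb by (auto intro!: AE_I2 mult_left_le simp: norm_mult)
    qed (use w in auto)
    hence "(\<lambda>k. 0) \<longlonglongrightarrow> (LINT x|lborel. w x * indicator U x)"
      unfolding cont0[OF cg gb] .
    thus ?thesis by (simp add: LIMSEQ_const_iff)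
  qed
  have int: "integrable lborel (\<lambda>x. w x * indicator U x)" if "open U" for U
    using integrable_mult_indicator[OF _ w, of U] that 
    by (simp add: scaleR_conv_of_real mult.commute of_real_indicator)
  have Re0: "AE x in lborel. Re (w x) = 0"
  proof (rule AE_zero_if_open_integrals_zero)
    fix U :: "'a set" assume "open U"
    hence "(LINT x|lborel. Re (w x * indicator U x)) = 0"
      using open0 int by (subst integral_Re) auto
    also have "(\<lambda>x. Re (w x * indicator U x)) = (\<lambda>x. Re (w x) * indicator U x)"
      by (auto split: split_indicator)
    finally show "(LINT x|lborel. Re (w x) * indicator U x) = 0" .
  qed (use w in auto)
  have Im0: "AE x in lborel. Im (w x) = 0"
  proof (rule AE_zero_if_open_integrals_zero)
    fix U :: "'a set" assume "open U"
    hence "(LINT x|lborel. Im (w x * indicator U x)) = 0"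
      using open0 int by (subst integral_Im) auto
    also have "(\<lambda>x. Im (w x * indicator U x)) = (\<lambda>x. Im (w x) * indicator U x)"
      by (auto split: split_indicator)
    finally show "(LINT x|lborel. Im (w x) * indicator U x) = 0" .
  qed (use w in auto)
  show ?thesis using Re0 Im0 by eventually_elim (simp add: complex_eq_iff)
qed

text \<open>Multiplication by a fixed Gaussian makes \<open>f\<close> integrable. The hypothesis
  says that all convolutions of this product \<open>w\<close> with Gaussians vanish. Moving such a
  convolution onto a continuous function \<open>g\<close> and letting the width tend to 0 shows that
  \<open>w\<close> is orthogonal to \<open>g\<close>.\<close>

lemma AE_zero_if_gaussian_integrals_zero:
  fixes f :: "'a::euclidean_space \<Rightarrow> complex"
  assumes [measurable]: "f \<in> borel_measurable borel"
    and int: "\<And>a b. a > 0 \<Longrightarrow> integrable lborel (\<lambda>x. f x * of_real (exp (- (a * (norm x)\<^sup>2) + b \<bullet> x)))"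
    and zero: "\<And>a b. a > 0 \<Longrightarrow> (LINT x|lborel. f x * of_real (exp (- (a * (norm x)\<^sup>2) + b \<bullet> x))) = 0"
  shows "AE x in lborel. f x = 0"
proof -
  define w where "w x = f x * of_real (exp (- (norm x)\<^sup>2))" for x
  have [measurable]: "w \<in> borel_measurable borel" unfolding w_def by measurable
  have w: "integrable lborel w"
    using int[of 1 0] by (simp add: w_def[abs_def])
  define G where "G e z = exp (- ((norm z)\<^sup>2 / (2 * e\<^sup>2)))" for e :: real and z :: 'a
  have [measurable]: "G e \<in> borel_measurable borel" for e unfolding G_def by measurable
  have conv0: "(LINT x|lborel. w x * of_real (G e (y - x))) = 0" if e: "e > 0" for e y
  proof -
    \<comment> \<open>Expanding |y - x|^2 turns the Gaussian centred at \<open>y\<close> into one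
      centred at the origin with a linear term in the exponent, to which the hypothesis
      applies.\<close>
    have "w x * of_real (G e (y - x)) = of_real (exp (- ((norm y)\<^sup>2 / (2 * e\<^sup>2)))) *
        (f x * of_real (exp (- ((1 + 1 / (2 * e\<^sup>2)) * (norm x)\<^sup>2) + ((1 / e\<^sup>2) *\<^sub>R y) \<bullet> x)))" for x
    proof -
      have "- (norm x)\<^sup>2 - (norm (y - x))\<^sup>2 / (2 * e\<^sup>2) = - ((norm y)\<^sup>2 / (2 * e\<^sup>2)) +
         (- ((1 + 1 / (2 * e\<^sup>2)) * (norm x)\<^sup>2) + ((1 / e\<^sup>2) *\<^sub>R y) \<bullet> x)"
        using e by (simp add: power2_norm_eq_inner inner_diff_left inner_diff_right inner_commute field_simps)
      hence h: "exp (- (norm x)\<^sup>2) * exp (- ((norm (y - x))\<^sup>2 / (2 * e\<^sup>2))) =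
         exp (- ((norm y)\<^sup>2 / (2 * e\<^sup>2))) * exp (- ((1 + 1 / (2 * e\<^sup>2)) * (norm x)\<^sup>2) + ((1 / e\<^sup>2) *\<^sub>R y) \<bullet> x)"
        unfolding exp_add[symmetric] by simp
      have "w x * of_real (G e (y - x)) = f x * of_real (exp (- (norm x)\<^sup>2) * exp (- ((norm (y - x))\<^sup>2 / (2 * e\<^sup>2))))"
        by (simp add: w_def G_def)
      thus ?thesis unfolding h by (simp only: of_real_mult mult_ac)
    qed
    moreover have "1 + 1 / (2 * e\<^sup>2) > 0" by (simp add: add_pos_nonneg)
    ultimately show ?thesis using zero[of "1 + 1 / (2 * e\<^sup>2)" "(1 / e\<^sup>2) *\<^sub>R y"]
      by (simp only: integral_mult_right_zero) simp
  qed
  have iG: "integrable lborel (G e)" if "e > 0" for e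
    using integrable_gaussian[of "1 / e\<^sup>2", where 'a='a] that by (simp add: G_def[abs_def] mult.commute)
  show ?thesis
  proof -
    have "AE x in lborel. w x = 0"
    proof (rule AE_zero_if_bounded_continuous_integrals_zero[OF w])
      fix g :: "'a \<Rightarrow> real" assume cg: "continuous_on UNIV g" and gb: "\<And>x. 0 \<le> g x \<and> g x \<le> 1"
      have [measurable]: "g \<in> borel_measurable borel" by (intro borel_measurable_continuous_onI cg)
      \<comment> \<open>Up to the factor e^n, \<open>H e\<close> is the convolution of
        \<open>g\<close> with \<open>G e\<close>. The rescaled form has a dominating function
        independent of \<open>e\<close>, as the limit e \<rightarrow> 0 requires.\<close>
      define H where "H e x = (LINT z|lborel. g (x + e *\<^sub>R z) * G 1 z)" for e x
      have H0: "(LINT x|lborel. w x * of_real (H e x)) = 0" if e: "e > 0" for e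
      proof -
        have 1: "(\<bar>e\<bar> ^ DIM('a)) * H e x = (LINT y|lborel. g y * G e (y - x))" for x
        proof -
          have "(LINT y|lborel. g y * G e (y - x)) =
            (\<bar>e\<bar> ^ DIM('a)) *\<^sub>R (LINT z|lborel. g (x + e *\<^sub>R z) * G e (x + e *\<^sub>R z - x))"
            using e by (intro lborel_integral_affine_euclidean) auto
          also have "(\<lambda>z. g (x + e *\<^sub>R z) * G e (x + e *\<^sub>R z - x)) = (\<lambda>z. g (x + e *\<^sub>R z) * G 1 z)"
            using e by (auto simp: G_def power_mult_distrib)
          finally show ?thesis by (simp add: H_def)
        qed
        have iprod: "integrable (lborel \<Otimes>\<^sub>M lborel) (\<lambda>(x, y). w x * of_real (g y * G e (y - x)))"
        proof (rule lborel_pair.Fubini_integrable)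
          have n: "norm (w x * of_real (g y * G e (y - x))) = norm (w x) * (g y * G e (y - x))" for x y
            using gb[of y] by (simp add: norm_mult G_def abs_mult)
          have i: "integrable lborel (\<lambda>y. g y * G e (y - x))" for x
          proof (rule Bochner_Integration.integrable_bound)
            show "integrable lborel (\<lambda>y. G e (y - x))"
              using integrable_lborel_affine_euclidean[OF iG[OF e], of 1 "-x"] by simp
            show "AE y in lborel. norm (g y * G e (y - x)) \<le> norm (G e (y - x))"
              using gb by (auto simp: abs_mult intro!: AE_I2 mult_left_le_one_le)
          qed measurable
          have bd: "norm (w x) * (LINT y|lborel. g y * G e (y - x)) \<le> norm (w x) * (LINT z|lborel. G e z)" for x
          proof (intro mult_left_mono)
            have "(LINT y|lborel. g y * G e (y - x)) \<le> (LINT y|lborel. G e (y - x))"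
              using integrable_lborel_affine_euclidean[OF iG[OF e], of 1 "-x"] gb
              by (intro integral_mono i) (auto simp: G_def mult_left_le_one_le)
            also have "\<dots> = (LINT z|lborel. G e z)"
              using lborel_integral_affine_euclidean[of "G e" 1 "-x"] by simp
            finally show "(LINT y|lborel. g y * G e (y - x)) \<le> (LINT z|lborel. G e z)" .
          qed simp
          show "integrable lborel (\<lambda>x. LINT y|lborel. norm (case (x, y) of (x, y) \<Rightarrow> w x * of_real (g y * G e (y - x))))"
          proof (rule Bochner_Integration.integrable_bound)
            show "integrable lborel (\<lambda>x. norm (w x) * (LINT z|lborel. G e z))" using w by auto
            show "AE x in lborel. norm (LINT y|lborel. norm (case (x, y) of (x, y) \<Rightarrow> w x * of_real (g y * G e (y - x))))
               \<le> norm (norm (w x) * (LINT z|lborel. G e z))"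
              unfolding prod.case n integral_mult_right_zero
              using bd gb by (auto intro!: AE_I2 simp: abs_mult G_def integral_nonneg)
          qed measurable
          show "AE x in lborel. integrable lborel (\<lambda>y. case (x, y) of (x, y) \<Rightarrow> w x * of_real (g y * G e (y - x)))"
            by (auto intro!: AE_I2 integrable_mult_right integrable_of_real i simp del: of_real_mult)
        qed measurable
        have "of_real (\<bar>e\<bar> ^ DIM('a)) * (LINT x|lborel. w x * of_real (H e x)) =
            (LINT x|lborel. w x * of_real (LINT y|lborel. g y * G e (y - x)))"
          unfolding 1[symmetric] by (subst integral_mult_right_zero[symmetric]) (simp add: mult_ac)
        also have "\<dots> = (LINT x|lborel. LINT y|lborel. w x * of_real (g y * G e (y - x)))"
          by (simp only: integral_mult_right_zero integral_complex_of_real)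
        also have "\<dots> = (LINT y|lborel. LINT x|lborel. w x * of_real (g y * G e (y - x)))"
          by (rule lborel_pair.Fubini_integral[OF iprod, symmetric])
        also have "\<dots> = (LINT y|lborel. of_real (g y) * (LINT x|lborel. w x * of_real (G e (y - x))))"
          by (subst integral_mult_right_zero[symmetric]) (simp add: mult_ac)
        also have "\<dots> = 0" using conv0[OF e] by simp
        finally show ?thesis using e by simp
      qed
      \<comment> \<open>\<open>G\<close> is not normalised, so the mollified functions converge to
        \<open>g x * c\<close>; it matters only that the mass \<open>c\<close> is nonzero.\<close>
      define c where "c = (LINT z|lborel. G 1 z)"
      have c: "c > 0" using integral_gaussian[of 1, where 'a='a] by (simp add: c_def G_def)
      have Hlim: "(\<lambda>k. H (1 / real (Suc k)) x) \<longlonglongrightarrow> g x * c" for x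
      proof -
        have "(\<lambda>k. LINT z|lborel. g (x + (1 / real (Suc k)) *\<^sub>R z) * G 1 z) \<longlonglongrightarrow> (LINT z|lborel. g x * G 1 z)"
        proof (rule integral_dominated_convergence[where w="G 1"])
          show "AE z in lborel. (\<lambda>k. g (x + (1 / real (Suc k)) *\<^sub>R z) * G 1 z) \<longlonglongrightarrow> g x * G 1 z"
          proof (intro AE_I2 tendsto_mult tendsto_const)
            fix z
            have "(\<lambda>k. x + (1 / real (Suc k)) *\<^sub>R z) \<longlonglongrightarrow> x + 0 *\<^sub>R z"
              by (intro tendsto_intros LIMSEQ_Suc lim_1_over_n)
            thus "(\<lambda>k. g (x + (1 / real (Suc k)) *\<^sub>R z)) \<longlonglongrightarrow> g x"
              using cg continuous_on_tendsto_compose[of UNIV g] by simp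
          qed
          show "AE z in lborel. norm (g (x + (1 / real (Suc k)) *\<^sub>R z) * G 1 z) \<le> G 1 z" for k
            using gb by (auto simp: abs_mult G_def intro!: AE_I2 mult_left_le_one_le)
        qed (use iG[of 1] in auto)
        thus ?thesis by (simp add: H_def c_def)
      qed
      have Hb: "\<bar>H e x\<bar> \<le> c" if "e > 0" for e x
      proof -
        have "norm (H e x) \<le> (LINT z|lborel. norm (g (x + e *\<^sub>R z) * G 1 z))" unfolding H_def by (rule integral_norm_bound)
        also have "\<dots> \<le> c" unfolding c_def
          by (rule integral_mono'[OF iG]) (use gb in \<open>auto simp: abs_mult G_def mult_left_le_one_le\<close>)
        finally show ?thesis by simp
      qed
      have [measurable]: "H e \<in> borel_measurable borel" for e unfolding H_def by measurable
      have "(\<lambda>k. LINT x|lborel. w x * of_real (H (1 / real (Suc k)) x)) \<longlonglongrightarrow> (LINT x|lborel. w x * of_real (g x * c))"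
      proof (rule integral_dominated_convergence[where w="\<lambda>x. norm (w x) * c"])
        show "AE x in lborel. (\<lambda>k. w x * of_real (H (1 / real (Suc k)) x)) \<longlonglongrightarrow> w x * of_real (g x * c)"
          by (intro AE_I2 tendsto_mult tendsto_const tendsto_of_real Hlim)
        show "AE x in lborel. norm (w x * of_real (H (1 / real (Suc k)) x)) \<le> norm (w x) * c" for k
          by (intro AE_I2) (auto simp: norm_mult intro!: mult_left_mono Hb)
      qed (use w in auto)
      hence "(\<lambda>k. 0) \<longlonglongrightarrow> (LINT x|lborel. w x * of_real (g x * c))"
        by (subst (asm) H0) simp_all
      hence "(LINT x|lborel. w x * of_real (g x * c)) = 0"
        by (simp add: LIMSEQ_const_iff)
      hence "(LINT x|lborel. w x * of_real (g x)) * of_real c = 0"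
        by (simp flip: integral_mult_left_zero add: mult_ac)
      thus "(LINT x|lborel. w x * of_real (g x)) = 0" using c by simp
    qed
    thus ?thesis by eventually_elim (simp add: w_def)
  qed
qed

section \<open>Schwartz functions\<close>

lemma iter_deriv_Nil [simp]: "iter_deriv [] f = f"
  and iter_deriv_Cons: "iter_deriv (i # is) f = partial_deriv i (iter_deriv is f)"
  and iter_deriv_append: "iter_deriv (is @ js) f = iter_deriv is (iter_deriv js f)"
  by (simp_all add: iter_deriv_def)

lemma partial_derivI:
  "(f has_derivative f') (at x) \<Longrightarrow> partial_deriv i f x = f' (axis i 1)"
  unfolding partial_deriv_def using frechet_derivative_at by metis

definition rapidly_decreasing :: "(real^'n::finite \<Rightarrow> complex) \<Rightarrow> bool" where
  "rapidly_decreasing f \<longleftrightarrow> (\<forall>N. \<exists>C. \<forall>x. (1 + norm x) ^ N * norm (f x) \<le> C)"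

lemma rapidly_decreasingE:
  assumes "rapidly_decreasing f"
  obtains C where "C > 0" "\<And>x. (1 + norm x) ^ N * norm (f x) \<le> C"
proof -
  from assms obtain C where "\<And>x. (1 + norm x) ^ N * norm (f x) \<le> C"
    unfolding rapidly_decreasing_def by blast
  hence "\<And>x. (1 + norm x) ^ N * norm (f x) \<le> max C 1" by (meson max.coboundedI1)
  thus ?thesis using that[of "max C 1"] by simp
qed

lemma schwartz_iff:
  fixes \<phi> :: "real^'n \<Rightarrow> complex"
  shows "\<phi> \<in> schwartz \<longleftrightarrow> (\<forall>is. (\<forall>x. iter_deriv is \<phi> differentiable (at x)) \<and> rapidly_decreasing (iter_deriv is \<phi>))"
proof -
  have "bounded (range (\<lambda>x. (1 + norm x) ^ N *\<^sub>R f x)) \<longleftrightarrow> (\<exists>C. \<forall>x. (1 + norm x) ^ N * norm (f x) \<le> C)"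
    for N and f :: "real^'n \<Rightarrow> complex"
    by (simp add: bounded_iff norm_power)
  thus ?thesis unfolding schwartz_def rapidly_decreasing_def by (simp add: all_conj_distrib)
qed

text \<open>The Schwartz space is the largest set of differentiable, rapidly decreasing functions
  that is stable under partial derivatives. Membership is thus shown by exhibiting an invariant set,
  without a formula for iterated derivatives.\<close>

lemma schwartz_coinduct:
  assumes "f \<in> A"
    and "\<And>f x. f \<in> A \<Longrightarrow> f differentiable (at x)"
    and "\<And>f. f \<in> A \<Longrightarrow> rapidly_decreasing f"
    and "\<And>f i. f \<in> A \<Longrightarrow> partial_deriv i f \<in> A"
  shows "f \<in> schwartz"
proof -
  have "iter_deriv is f \<in> A" for "is"
    by (induction "is") (auto simp: iter_deriv_Cons assms)
  thus ?thesis using assms by (auto simp: schwartz_iff)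
qed

lemma schwartz_differentiable: "\<phi> \<in> schwartz \<Longrightarrow> \<phi> differentiable (at x)"
  unfolding schwartz_iff by (metis iter_deriv_Nil)

lemma schwartz_rapidly_decreasing: "\<phi> \<in> schwartz \<Longrightarrow> rapidly_decreasing \<phi>"
  unfolding schwartz_iff by (metis iter_deriv_Nil)

lemma schwartz_partial: "\<phi> \<in> schwartz \<Longrightarrow> partial_deriv i \<phi> \<in> schwartz"
  unfolding schwartz_iff
  by (metis iter_deriv_append iter_deriv_Cons iter_deriv_Nil)

lemma schwartz_iter_deriv: "\<phi> \<in> schwartz \<Longrightarrow> iter_deriv is \<phi> \<in> schwartz"
  by (induction "is") (auto simp: iter_deriv_Cons schwartz_partial)

lemma partial_deriv_add:
  fixes f g :: "real^'n \<Rightarrow> complex"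
  assumes "f differentiable (at x)" "g differentiable (at x)"
  shows "partial_deriv i (\<lambda>x. f x + g x) x = partial_deriv i f x + partial_deriv i g x"
  using has_derivative_add[OF assms[unfolded frechet_derivative_works]]
  by (subst partial_derivI) (auto simp: partial_deriv_def)

lemma partial_deriv_mult:
  fixes f g :: "real^'n \<Rightarrow> complex"
  assumes "f differentiable (at x)" "g differentiable (at x)"
  shows "partial_deriv i (\<lambda>x. f x * g x) x = f x * partial_deriv i g x + partial_deriv i f x * g x"
  using has_derivative_mult[OF assms[unfolded frechet_derivative_works]]
  by (subst partial_derivI) (auto simp: partial_deriv_def)

lemma has_derivative_coord:
  "((\<lambda>x::real^'n. complex_of_real (x $ j)) has_derivative (\<lambda>h. complex_of_real (h $ j))) (at x)"
  by (intro bounded_linear_imp_has_derivative bounded_linear_compose[OF bounded_linear_of_real bounded_linear_vec_nth])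

lemma partial_deriv_coord:
  "partial_deriv i (\<lambda>x::real^'n. complex_of_real (x $ j)) x = (if i = j then 1 else 0)"
  by (subst partial_derivI[OF has_derivative_coord]) (auto simp: axis_def)

lemma rapidly_decreasing_add:
  assumes "rapidly_decreasing f" "rapidly_decreasing g"
  shows "rapidly_decreasing (\<lambda>x. f x + g x)"
  unfolding rapidly_decreasing_def
proof
  fix N
  obtain C where C: "\<And>x. (1 + norm x) ^ N * norm (f x) \<le> C" using assms(1) rapidly_decreasingE by metis
  obtain D where D: "\<And>x. (1 + norm x) ^ N * norm (g x) \<le> D" using assms(2) rapidly_decreasingE by metis
  have "(1 + norm x) ^ N * norm (f x + g x) \<le> C + D" for x
  proof -
    have "(1 + norm x) ^ N * norm (f x + g x) \<le> (1 + norm x) ^ N * (norm (f x) + norm (g x))"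
      by (intro mult_left_mono norm_triangle_ineq) simp
    thus ?thesis using C[of x] D[of x] by (simp add: distrib_left)
  qed
  thus "\<exists>C. \<forall>x. (1 + norm x) ^ N * norm (f x + g x) \<le> C" by blast
qed

lemma rapidly_decreasing_scale:
  assumes "rapidly_decreasing f"
  shows "rapidly_decreasing (\<lambda>x. c * f x)"
  unfolding rapidly_decreasing_def
proof
  fix N
  obtain C where C: "\<And>x. (1 + norm x) ^ N * norm (f x) \<le> C" using assms rapidly_decreasingE by metis
  have "(1 + norm x) ^ N * norm (c * f x) \<le> norm c * C" for x
    using mult_left_mono[OF C[of x], of "norm c"] by (simp add: norm_mult mult_ac)
  thus "\<exists>C. \<forall>x. (1 + norm x) ^ N * norm (c * f x) \<le> C" by blast
qed

lemma rapidly_decreasing_coord: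
  assumes "rapidly_decreasing f"
  shows "rapidly_decreasing (\<lambda>x. of_real (x $ j) * f x)"
  unfolding rapidly_decreasing_def
proof
  fix N
  obtain C where C: "\<And>x. (1 + norm x) ^ Suc N * norm (f x) \<le> C" using assms rapidly_decreasingE by metis
  have "(1 + norm x) ^ N * norm (of_real (x $ j) * f x) \<le> C" for x
  proof -
    have "(1 + norm x) ^ N * norm (of_real (x $ j) * f x) \<le> (1 + norm x) ^ N * ((1 + norm x) * norm (f x))"
      using component_le_norm_cart[of x j] by (auto simp: norm_mult intro!: mult_left_mono mult_right_mono)
    also have "\<dots> \<le> C" using C[of x] by (simp add: mult_ac)
    finally show ?thesis .
  qed
  thus "\<exists>C. \<forall>x. (1 + norm x) ^ N * norm (of_real (x $ j) * f x) \<le> C" by blast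
qed

text \<open>The module over the polynomials generated by \<open>B\<close>. It is the invariant set
  for \<open>schwartz_coinduct\<close>: by the product rule it is stable under partial derivatives
  as soon as the derivatives of the generators lie in it.\<close>

inductive_set poly_span :: "(real^'n::finite \<Rightarrow> complex) set \<Rightarrow> (real^'n \<Rightarrow> complex) set"
  for B where
  base: "f \<in> B \<Longrightarrow> f \<in> poly_span B"
| add: "f \<in> poly_span B \<Longrightarrow> g \<in> poly_span B \<Longrightarrow> (\<lambda>x. f x + g x) \<in> poly_span B"
| scale: "f \<in> poly_span B \<Longrightarrow> (\<lambda>x. c * f x) \<in> poly_span B"
| coord: "f \<in> poly_span B \<Longrightarrow> (\<lambda>x. of_real (x $ j) * f x) \<in> poly_span B"

lemma poly_span_schwartz:
  assumes diff: "\<And>f x. f \<in> B \<Longrightarrow> f differentiable (at x)"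
    and decr: "\<And>f. f \<in> B \<Longrightarrow> rapidly_decreasing f"
    and part: "\<And>f i. f \<in> B \<Longrightarrow> partial_deriv i f \<in> poly_span B"
  shows "poly_span B \<subseteq> schwartz"
proof
  fix f assume "f \<in> poly_span B"
  thus "f \<in> schwartz"
  proof (rule schwartz_coinduct)
    have coord_diff: "(\<lambda>x::real^'n. complex_of_real (x $ j)) differentiable (at x)" for j x
      using has_derivative_coord differentiable_def by blast
    show d: "f differentiable (at x)" if "f \<in> poly_span B" for f x
      using that
      by induction (simp_all add: diff differentiable_add differentiable_mult coord_diff)
    show "rapidly_decreasing f" if "f \<in> poly_span B" for f
      using that
      by induction (simp_all add: decr rapidly_decreasing_add rapidly_decreasing_scale rapidly_decreasing_coord)
    show "partial_deriv i f \<in> poly_span B" if "f \<in> poly_span B" for f i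
      using that
    proof induction
      case (add f g)
      have "partial_deriv i (\<lambda>x. f x + g x) = (\<lambda>x. partial_deriv i f x + partial_deriv i g x)"
        using d add by (intro ext partial_deriv_add) auto
      thus ?case using add poly_span.add by metis
    next
      case (scale f c)
      have "partial_deriv i (\<lambda>x. c * f x) x = c * partial_deriv i f x" for x
        using partial_deriv_mult[of "\<lambda>_. c" x f i] d[OF scale(1)]
          partial_derivI[OF has_derivative_const[of c], of i x] by simp
      hence "partial_deriv i (\<lambda>x. c * f x) = (\<lambda>x. c * partial_deriv i f x)" by blast
      thus ?case using scale poly_span.scale by metis
    next
      case (coord f j)
      have "partial_deriv i (\<lambda>x. of_real (x $ j) * f x) =
          (\<lambda>x. of_real (x $ j) * partial_deriv i f x + (if i = j then 1 else 0) * f x)"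
        using partial_deriv_mult[OF coord_diff d[OF coord(1)]] by (auto simp: partial_deriv_coord)
      thus ?case using coord by (metis (no_types) poly_span.add poly_span.scale poly_span.coord)
    qed (use part in auto)
  qed
qed

text \<open>Taking all Schwartz functions as generators yields their stability under scalars and
  multiplication by coordinates.\<close>

lemma poly_span_of_schwartz: "poly_span schwartz = schwartz"
  using poly_span_schwartz[of schwartz] poly_span.base[of _ schwartz]
  by (auto simp: schwartz_differentiable schwartz_rapidly_decreasing schwartz_partial)

lemma schwartz_coord: "\<phi> \<in> schwartz \<Longrightarrow> (\<lambda>x. of_real (x $ j) * \<phi> x) \<in> schwartz"
  and schwartz_scale: "\<phi> \<in> schwartz \<Longrightarrow> (\<lambda>x. c * \<phi> x) \<in> schwartz"
  using poly_span.coord[of \<phi> schwartz j] poly_span.scale[of \<phi> schwartz c]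
  by (auto simp: poly_span_of_schwartz)

lemma power_le_fact_exp:
  fixes x :: real
  assumes "x \<ge> 0"
  shows "x ^ N \<le> fact N * exp x"
proof -
  have "(\<Sum>n\<in>{N}. x ^ n /\<^sub>R fact n) \<le> exp x"
    unfolding exp_def using assms by (intro sum_le_suminf summable_exp_generic) auto
  thus ?thesis by (simp add: field_simps)
qed

text \<open>Each partial derivative of the Gaussian is a polynomial of degree at most one times the
  Gaussian, so the polynomial multiples of this single function are an invariant set.\<close>

lemma gaussian_schwartz:
  fixes b :: "real^'n"
  assumes a: "a > 0"
  shows "(\<lambda>x. of_real (exp (- (a * (norm x)\<^sup>2) + b \<bullet> x))) \<in> (schwartz :: (real^'n \<Rightarrow> complex) set)"
proof -
  define \<gamma> :: "real^'n \<Rightarrow> complex" where "\<gamma> = (\<lambda>x. of_real (exp (- (a * (x \<bullet> x)) + b \<bullet> x)))"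
  have der: "(\<gamma> has_derivative (\<lambda>h. of_real (exp (- (a * (x \<bullet> x)) + b \<bullet> x) * (- (2 * a * (x \<bullet> h)) + b \<bullet> h)))) (at x)" for x
    unfolding \<gamma>_def
    by (rule has_derivative_of_real)
       (auto intro!: derivative_eq_intros simp: inner_commute algebra_simps)
  have "poly_span {\<gamma>} \<subseteq> schwartz"
  proof (rule poly_span_schwartz)
    show "f differentiable (at x)" if "f \<in> {\<gamma>}" for f x
      using that der differentiable_def by blast
    show "rapidly_decreasing f" if "f \<in> {\<gamma>}" for f
      unfolding rapidly_decreasing_def
    proof
      fix N
      \<comment> \<open>The power costs N! e^(1+|x|), and the exponent is then at most 1 + (|b| + 1)
        |x| - a |x|^2. Completing the square gives the constant.\<close>
      have "(1 + norm x) ^ N * norm (f x) \<le> fact N * exp (1 + (norm b + 1)\<^sup>2 / (4 * a))" for x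
      proof -
        have 1: "(1 + norm x) ^ N \<le> fact N * exp (1 + norm x)"
          by (rule power_le_fact_exp) simp
        have "0 \<le> (2 * a * norm x - (norm b + 1))\<^sup>2 / (4 * a)" using a by simp
        also have "\<dots> = a * (norm x)\<^sup>2 - (norm b + 1) * norm x + (norm b + 1)\<^sup>2 / (4 * a)"
          using a by (simp add: power2_eq_square field_simps)
        finally have 2: "1 + norm x + (- (a * (x \<bullet> x)) + b \<bullet> x) \<le> 1 + (norm b + 1)\<^sup>2 / (4 * a)"
          using norm_cauchy_schwarz[of b x] by (simp add: power2_norm_eq_inner algebra_simps)
        have "(1 + norm x) ^ N * norm (f x) \<le> fact N * exp (1 + norm x) * exp (- (a * (x \<bullet> x)) + b \<bullet> x)"
          using that 1 by (auto simp: \<gamma>_def intro!: mult_right_mono)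
        also have "\<dots> = fact N * exp (1 + norm x + (- (a * (x \<bullet> x)) + b \<bullet> x))"
          by (simp add: exp_add)
        also have "\<dots> \<le> fact N * exp (1 + (norm b + 1)\<^sup>2 / (4 * a))"
          using 2 by simp
        finally show ?thesis .
      qed
      thus "\<exists>C. \<forall>x. (1 + norm x) ^ N * norm (f x) \<le> C" by blast
    qed
    show "partial_deriv i f \<in> poly_span {\<gamma>}" if "f \<in> {\<gamma>}" for f i
    proof -
      have "partial_deriv i \<gamma> x = of_real (- 2 * a) * (of_real (x $ i) * \<gamma> x) + of_real (b $ i) * \<gamma> x" for x
        by (subst partial_derivI[OF der]) (simp add: \<gamma>_def inner_axis algebra_simps)
      hence "partial_deriv i f = (\<lambda>x. of_real (- 2 * a) * (of_real (x $ i) * \<gamma> x) + of_real (b $ i) * \<gamma> x)"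
        using that by auto
      thus ?thesis
        by (simp only:) (intro poly_span.add poly_span.scale poly_span.coord poly_span.base singletonI)
    qed
  qed
  moreover have "\<gamma> \<in> poly_span {\<gamma>}" by (intro poly_span.base) simp
  ultimately show ?thesis by (auto simp: \<gamma>_def power2_norm_eq_inner)
qed

section \<open>Integration and Fourier transform of Schwartz functions\<close>

lemma integrable_inverse_power_decay:
  "integrable lborel (\<lambda>x::real^'n. C * inverse ((1 + norm x) ^ (CARD('n) + 1)))"
proof -
  have "integrable lborel (\<lambda>x::real^'n. (1 + norm x) powr (- real (CARD('n) + 1)))"
    by (intro integrable_powr_decay) simp
  also have "(\<lambda>x::real^'n. (1 + norm x) powr (- real (CARD('n) + 1))) = (\<lambda>x. inverse ((1 + norm x) ^ (CARD('n) + 1)))"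
    by (intro ext, subst powr_minus, subst powr_realpow) (auto simp: add_pos_nonneg)
  finally show ?thesis by simp
qed

lemma integrable_if_decreasing:
  fixes f :: "real^'n \<Rightarrow> complex"
  assumes [measurable]: "f \<in> borel_measurable borel" and "rapidly_decreasing f"
  shows "integrable lborel f"
proof -
  obtain C where C: "C > 0" "\<And>x. (1 + norm x) ^ (CARD('n) + 1) * norm (f x) \<le> C"
    using assms(2) rapidly_decreasingE by metis
  show ?thesis
  proof (rule Bochner_Integration.integrable_bound[OF integrable_inverse_power_decay[of C]])
    show "AE x in lborel. norm (f x) \<le> norm (C * inverse ((1 + norm x) ^ (CARD('n) + 1)))"
    proof (intro AE_I2)
      fix x :: "real^'n"
      have "0 < (1 + norm x) ^ (CARD('n) + 1)" by (simp add: add_pos_nonneg)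
      thus "norm (f x) \<le> norm (C * inverse ((1 + norm x) ^ (CARD('n) + 1)))"
        using C(1) C(2)[of x] by (simp add: abs_mult field_simps del: power_Suc)
    qed
  qed simp
qed

lemma schwartz_continuous: "\<phi> \<in> schwartz \<Longrightarrow> continuous_on UNIV \<phi>"
  by (intro differentiable_imp_continuous_on) (auto simp: differentiable_on_def schwartz_differentiable differentiable_at_withinI)

lemma schwartz_measurable: "\<phi> \<in> schwartz \<Longrightarrow> \<phi> \<in> borel_measurable borel"
  by (intro borel_measurable_continuous_onI schwartz_continuous)

lemma schwartz_integrable: "\<phi> \<in> schwartz \<Longrightarrow> integrable lborel \<phi>"
  by (intro integrable_if_decreasing schwartz_measurable schwartz_rapidly_decreasing)

text \<open>By translation invariance every difference quotient has integral 0. The mean value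
  theorem bounds the quotients by the decay of the derivative, uniformly for steps of length at most
  1, so that dominated convergence passes to the limit.\<close>

lemma integral_partial_deriv_zero:
  fixes \<psi> :: "real^'n \<Rightarrow> complex"
  assumes diff: "\<And>x. \<psi> differentiable (at x)" and int: "integrable lborel \<psi>"
    and dec: "rapidly_decreasing (partial_deriv i \<psi>)"
  shows "(LINT x|lborel. partial_deriv i \<psi> x) = 0"
proof -
  define e :: "real^'n" where "e = axis i 1"
  define h where "h k = 1 / real (Suc k)" for k
  have h: "0 < h k" "h k \<le> 1" for k by (auto simp: h_def)
  have hlim: "h \<longlonglongrightarrow> 0" unfolding h_def by (rule LIMSEQ_Suc[OF lim_1_over_n])
  have [measurable]: "\<psi> \<in> borel_measurable borel" using int by auto
  obtain C where C: "C > 0" "\<And>x. (1 + norm x) ^ (CARD('n) + 1) * norm (partial_deriv i \<psi> x) \<le> C"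
    using dec rapidly_decreasingE by metis
  define D where "D k x = (\<psi> (x + h k *\<^sub>R e) - \<psi> x) /\<^sub>R h k" for k x
  have [measurable]: "D k \<in> borel_measurable borel" for k unfolding D_def by measurable
  have vd: "((\<lambda>t. \<psi> (x + t *\<^sub>R e)) has_vector_derivative partial_deriv i \<psi> (x + t *\<^sub>R e)) (at t)" for x t
  proof -
    have "(\<psi> has_derivative frechet_derivative \<psi> (at (x + t *\<^sub>R e))) (at (x + t *\<^sub>R e))"
      using diff frechet_derivative_works by blast
    hence "((\<psi> \<circ> (\<lambda>t. x + t *\<^sub>R e)) has_derivative
       (frechet_derivative \<psi> (at (x + t *\<^sub>R e)) \<circ> (\<lambda>s. s *\<^sub>R e))) (at t)"
      by (intro diff_chain_at) (auto intro!: derivative_eq_intros)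
    moreover have "linear (frechet_derivative \<psi> (at (x + t *\<^sub>R e)))"
      using diff linear_frechet_derivative by blast
    ultimately show ?thesis
      by (simp add: has_vector_derivative_def o_def partial_deriv_def e_def linear_cmul)
  qed
  have lim: "(\<lambda>k. D k x) \<longlonglongrightarrow> partial_deriv i \<psi> x" for x
  proof -
    have "((\<lambda>t. (\<psi> (x + (0 + t) *\<^sub>R e) - \<psi> (x + 0 *\<^sub>R e)) /\<^sub>R t) \<longlongrightarrow> partial_deriv i \<psi> (x + 0 *\<^sub>R e)) (at 0)"
    proof -
      define p where "p = partial_deriv i \<psi> x"
      have "((\<lambda>t. norm (\<psi> (x + t *\<^sub>R e) - \<psi> x - t *\<^sub>R p) / \<bar>t\<bar>) \<longlongrightarrow> 0) (at 0)"
        using vd[of x 0] by (simp add: has_vector_derivative_def has_derivative_at p_def)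
      moreover have eq: "norm (\<psi> (x + t *\<^sub>R e) - \<psi> x - t *\<^sub>R p) / \<bar>t\<bar> = norm ((\<psi> (x + t *\<^sub>R e) - \<psi> x) /\<^sub>R t - p)"
        if "t \<noteq> 0" for t
      proof -
        have "\<psi> (x + t *\<^sub>R e) - \<psi> x - t *\<^sub>R p = t *\<^sub>R ((\<psi> (x + t *\<^sub>R e) - \<psi> x) /\<^sub>R t - p)"
          using that by (simp add: scaleR_diff_right)
        thus ?thesis using that by (simp del: scaleR_diff_right)
      qed
      ultimately have "((\<lambda>t. norm ((\<psi> (x + t *\<^sub>R e) - \<psi> x) /\<^sub>R t - p)) \<longlongrightarrow> 0) (at 0)"
        by (elim Lim_transform_eventually) (simp add: eventually_at_filter eq)
      thus ?thesis unfolding p_def using Lim_null tendsto_norm_zero_iff by fastforce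
    qed
    moreover have "filterlim h (at 0) sequentially"
      using hlim h by (auto simp: filterlim_at intro!: always_eventually) (metis less_irrefl)
    ultimately have "((\<lambda>k. (\<psi> (x + (0 + h k) *\<^sub>R e) - \<psi> (x + 0 *\<^sub>R e)) /\<^sub>R h k) \<longlongrightarrow> partial_deriv i \<psi> (x + 0 *\<^sub>R e)) sequentially"
      by (rule filterlim_compose)
    thus ?thesis by (simp add: D_def)
  qed
  have bd: "norm (D k x) \<le> (C * 2 ^ (CARD('n) + 1)) * inverse ((1 + norm x) ^ (CARD('n) + 1))" for k x
  proof -
    have cont: "continuous_on {0..h k} (\<lambda>t. \<psi> (x + t *\<^sub>R e))"
      using has_vector_derivative_continuous[OF vd] by (intro continuous_at_imp_continuous_on) blast
    have "\<exists>t\<in>{0<..<h k}. norm (\<psi> (x + h k *\<^sub>R e) - \<psi> (x + 0 *\<^sub>R e)) \<le> norm ((h k - 0) *\<^sub>R partial_deriv i \<psi> (x + t *\<^sub>R e))"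
      by (rule mvt_general[where f'="\<lambda>t s. s *\<^sub>R partial_deriv i \<psi> (x + t *\<^sub>R e)" and f="\<lambda>t. \<psi> (x + t *\<^sub>R e)",
            OF h(1) cont vd[unfolded has_vector_derivative_def]])
    then obtain t where t: "0 < t" "t < h k" and
      "norm (\<psi> (x + h k *\<^sub>R e) - \<psi> x) \<le> h k * norm (partial_deriv i \<psi> (x + t *\<^sub>R e))"
      using h[of k] by auto
    hence 1: "norm (D k x) \<le> norm (partial_deriv i \<psi> (x + t *\<^sub>R e))"
      using h[of k] by (simp add: D_def divide_le_eq mult.commute inverse_eq_divide del: scaleR_diff_right)
    \<comment> \<open>A shift by at most 1 changes 1 + |x| by at most a factor 2; this is the origin
      of \<open>2 ^ (CARD('n) + 1)\<close> in the dominating function.\<close>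
    define y where "y = norm (x + t *\<^sub>R e)"
    have "norm x \<le> y + norm (t *\<^sub>R e)"
      unfolding y_def using norm_triangle_ineq4[of "x + t *\<^sub>R e" "t *\<^sub>R e"] by simp
    moreover have "norm (t *\<^sub>R e) \<le> 1" using t h(2)[of k] by (simp add: e_def)
    moreover have "y \<ge> 0" by (simp add: y_def)
    ultimately have "1 + norm x \<le> 2 * (1 + y)" by argo
    hence "1 + norm x \<le> 2 * (1 + norm (x + t *\<^sub>R e))" unfolding y_def .
    hence "(1 + norm x) ^ (CARD('n) + 1) \<le> 2 ^ (CARD('n) + 1) * (1 + norm (x + t *\<^sub>R e)) ^ (CARD('n) + 1)"
      unfolding power_mult_distrib[symmetric] by (intro power_mono) auto
    hence "(1 + norm x) ^ (CARD('n) + 1) * norm (D k x) \<le>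
        2 ^ (CARD('n) + 1) * (1 + norm (x + t *\<^sub>R e)) ^ (CARD('n) + 1) * norm (partial_deriv i \<psi> (x + t *\<^sub>R e))"
      using 1 by (intro mult_mono) auto
    also have "\<dots> \<le> 2 ^ (CARD('n) + 1) * C"
      using C(2)[of "x + t *\<^sub>R e"] by (simp add: mult.assoc del: power_Suc)
    finally have "(1 + norm x) ^ (CARD('n) + 1) * norm (D k x) \<le> C * 2 ^ (CARD('n) + 1)" by (simp add: mult.commute)
    moreover have "0 < (1 + norm x) ^ (CARD('n) + 1)" by (simp add: add_pos_nonneg)
    ultimately show ?thesis by (simp add: field_simps del: power_Suc)
  qed
  have "(\<lambda>k. integral\<^sup>L lborel (D k)) \<longlonglongrightarrow> (LINT x|lborel. partial_deriv i \<psi> x)"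
  proof (rule integral_dominated_convergence)
    show "(\<lambda>x. partial_deriv i \<psi> x) \<in> borel_measurable lborel"
      by (rule borel_measurable_LIMSEQ_metric[of D]) (auto simp: lim)
    show "integrable lborel (\<lambda>x::real^'n. (C * 2 ^ (CARD('n) + 1)) * inverse ((1 + norm x) ^ (CARD('n) + 1)))"
      by (rule integrable_inverse_power_decay)
    show "AE x in lborel. (\<lambda>k. D k x) \<longlonglongrightarrow> partial_deriv i \<psi> x" using lim by simp
    show "AE x in lborel. norm (D k x) \<le> (C * 2 ^ (CARD('n) + 1)) * inverse ((1 + norm x) ^ (CARD('n) + 1))" for k
      using bd by blast
  qed measurable
  moreover have "integral\<^sup>L lborel (D k) = 0" for k
  proof -
    have i: "integrable lborel (\<lambda>x. \<psi> (x + h k *\<^sub>R e))"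
      using integrable_lborel_affine_euclidean[OF int, of 1 "h k *\<^sub>R e"] by (simp add: add.commute)
    have "(LINT x|lborel. \<psi> (x + h k *\<^sub>R e)) = integral\<^sup>L lborel \<psi>"
      using lborel_integral_affine_euclidean[of \<psi> 1 "h k *\<^sub>R e"] by (simp add: add.commute)
    thus ?thesis unfolding D_def using i int by simp
  qed
  ultimately show ?thesis by (simp add: LIMSEQ_const_iff)
qed

lemma has_derivative_cis_inner:
  "((\<lambda>x. cis (- (x \<bullet> \<xi>))) has_derivative (\<lambda>h. of_real (- (h \<bullet> \<xi>)) * (\<i> * cis (- (x \<bullet> \<xi>))))) (at x)"
proof -
  have "((\<lambda>t. cis t) has_derivative (\<lambda>s. s *\<^sub>R (\<i> * cis u))) (at u)" for u
    using has_vector_derivative_iexp[of u UNIV]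
    by (simp add: cis_conv_exp[abs_def] has_vector_derivative_def)
  from has_derivative_compose[OF _ this, of "\<lambda>x. - (x \<bullet> \<xi>)" "\<lambda>h. - (h \<bullet> \<xi>)" x]
  show ?thesis by (auto simp: scaleR_conv_of_real intro!: derivative_eq_intros)
qed

text \<open>Integration by parts: the derivative of the character times \<phi> has integral 0, and
  the product rule splits it into the two sides.\<close>

lemma fourier_partial_deriv:
  assumes \<phi>: "\<phi> \<in> schwartz"
  shows "fourier (partial_deriv i \<phi>) \<xi> = \<i> * of_real (\<xi> $ i) * fourier \<phi> \<xi>"
proof -
  define E where "E x = cis (- (x \<bullet> \<xi>))" for x
  have [measurable]: "E \<in> borel_measurable borel" unfolding E_def by measurable
  define \<psi> where "\<psi> x = E x * \<phi> x" for x
  have dE: "E differentiable (at x)" for x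
    unfolding E_def using has_derivative_cis_inner differentiable_def by blast
  have pE: "partial_deriv i E x = - (\<i> * of_real (\<xi> $ i)) * E x" for x
    unfolding E_def by (subst partial_derivI[OF has_derivative_cis_inner]) (simp add: inner_axis' )
  have p: "partial_deriv i \<psi> x = E x * (partial_deriv i \<phi> x + (- (\<i> * of_real (\<xi> $ i))) * \<phi> x)" for x
    using partial_deriv_mult[OF dE schwartz_differentiable[OF \<phi>]] unfolding \<psi>_def
    by (simp add: pE algebra_simps)
  have iE: "integrable lborel (\<lambda>x. E x * g x)" if "g \<in> schwartz" for g
    using schwartz_measurable[OF that]
    by (intro Bochner_Integration.integrable_bound[OF schwartz_integrable[OF that]]) (auto simp: norm_mult E_def)
  have "(LINT x|lborel. partial_deriv i \<psi> x) = 0"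
  proof (rule integral_partial_deriv_zero)
    show "\<psi> differentiable (at x)" for x
      unfolding \<psi>_def by (intro differentiable_mult dE schwartz_differentiable \<phi>)
    show "integrable lborel \<psi>" unfolding \<psi>_def by (rule iE[OF \<phi>])
    have "rapidly_decreasing (\<lambda>x. partial_deriv i \<phi> x + (- (\<i> * of_real (\<xi> $ i))) * \<phi> x)"
      by (intro rapidly_decreasing_add rapidly_decreasing_scale schwartz_rapidly_decreasing schwartz_partial \<phi>)
    thus "rapidly_decreasing (partial_deriv i \<psi>)"
      unfolding rapidly_decreasing_def p by (simp add: norm_mult E_def)
  qed
  also have "(LINT x|lborel. partial_deriv i \<psi> x) =
      (LINT x|lborel. E x * partial_deriv i \<phi> x + (- (\<i> * of_real (\<xi> $ i))) * (E x * \<phi> x))"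
    unfolding p by (simp add: algebra_simps)
  also have "\<dots> = fourier (partial_deriv i \<phi>) \<xi> + (- (\<i> * of_real (\<xi> $ i))) * fourier \<phi> \<xi>"
    using iE[OF \<phi>] iE[OF schwartz_partial[OF \<phi>]]
    by (subst Bochner_Integration.integral_add) (auto simp: fourier_def E_def)
  finally show ?thesis by (simp add: eq_neg_iff_add_eq_0 algebra_simps)
qed

lemma integrable_fourier_kernel:
  "integrable lborel f \<Longrightarrow> integrable lborel (\<lambda>x. cis (- (x \<bullet> \<xi>)) * f x)"
  by (rule Bochner_Integration.integrable_bound[of lborel f]) (auto simp: norm_mult)

lemma norm_fourier_le: "integrable lborel f \<Longrightarrow> norm (fourier f \<xi>) \<le> (LINT x|lborel. norm (f x))"
  unfolding fourier_def
  by (rule order_trans[OF integral_norm_bound]) (simp add: norm_mult)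

text \<open>The candidate derivative comes from differentiating under the integral sign. The Taylor
  estimate |e^(iu) - 1 - iu| \<le> u^2/2 makes the error at most |h|^2 times the second moment of
  |\<phi>|, which is finite for a Schwartz function.\<close>

lemma fourier_has_derivative:
  fixes \<phi> :: "real^'n \<Rightarrow> complex"
  assumes \<phi>: "\<phi> \<in> schwartz"
  shows "(fourier \<phi> has_derivative (\<lambda>h. \<Sum>j\<in>UNIV. of_real (h $ j) * fourier (\<lambda>x. - \<i> * (of_real (x $ j) * \<phi> x)) \<xi>)) (at \<xi>)"
    (is "(_ has_derivative ?D) _")
proof -
  have [measurable]: "\<phi> \<in> borel_measurable borel" using \<phi> by (rule schwartz_measurable)
  have xs: "(\<lambda>x. - \<i> * (of_real (x $ j) * \<phi> x)) \<in> schwartz" for j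
    by (intro schwartz_scale schwartz_coord \<phi>)
  define M where "M = (LINT x|lborel. norm x ^ 2 * norm (\<phi> x))"
  have iM: "integrable lborel (\<lambda>x. norm x ^ 2 * norm (\<phi> x))"
  proof -
    have "integrable lborel (\<lambda>x. \<Sum>j\<in>UNIV. norm (of_real (x $ j) * (of_real (x $ j) * \<phi> x)))"
      by (intro Bochner_Integration.integrable_sum integrable_norm schwartz_integrable schwartz_coord \<phi>)
    also have "(\<lambda>x. \<Sum>j\<in>UNIV. norm (of_real (x $ j) * (of_real (x $ j) * \<phi> x))) = (\<lambda>x. norm x ^ 2 * norm (\<phi> x))"
      by (auto simp: norm_mult sum_distrib_right power2_norm_eq_inner inner_vec_def abs_mult_self_eq mult.assoc[symmetric])
    finally show ?thesis .
  qed
  have D: "?D h = (LINT x|lborel. - \<i> * of_real (x \<bullet> h) * cis (- (x \<bullet> \<xi>)) * \<phi> x)" for h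
  proof -
    have "?D h = (\<Sum>j\<in>UNIV. LINT x|lborel. of_real (h $ j) * (cis (- (x \<bullet> \<xi>)) * (- \<i> * (of_real (x $ j) * \<phi> x))))"
      by (simp add: fourier_def)
    also have "\<dots> = (LINT x|lborel. (\<Sum>j\<in>UNIV. of_real (h $ j) * (cis (- (x \<bullet> \<xi>)) * (- \<i> * (of_real (x $ j) * \<phi> x)))))"
      by (intro Bochner_Integration.integral_sum[symmetric] integrable_mult_right integrable_fourier_kernel schwartz_integrable xs)
    also have "(\<lambda>x. \<Sum>j\<in>UNIV. of_real (h $ j) * (cis (- (x \<bullet> \<xi>)) * (- \<i> * (of_real (x $ j) * \<phi> x)))) =
      (\<lambda>x. - \<i> * of_real (x \<bullet> h) * cis (- (x \<bullet> \<xi>)) * \<phi> x)"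
      by (auto simp: inner_vec_def sum_distrib_left sum_distrib_right sum_distrib_left mult_ac)
    finally show ?thesis .
  qed
  have iD: "integrable lborel (\<lambda>x. - \<i> * of_real (x \<bullet> h) * cis (- (x \<bullet> \<xi>)) * \<phi> x)" for h
  proof -
    have "integrable lborel (\<lambda>x. \<Sum>j\<in>UNIV. of_real (h $ j) * (cis (- (x \<bullet> \<xi>)) * (- \<i> * (of_real (x $ j) * \<phi> x))))"
      by (intro Bochner_Integration.integrable_sum integrable_mult_right integrable_fourier_kernel schwartz_integrable xs)
    also have "(\<lambda>x. \<Sum>j\<in>UNIV. of_real (h $ j) * (cis (- (x \<bullet> \<xi>)) * (- \<i> * (of_real (x $ j) * \<phi> x)))) =
      (\<lambda>x. - \<i> * of_real (x \<bullet> h) * cis (- (x \<bullet> \<xi>)) * \<phi> x)"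
      by (auto simp: inner_vec_def sum_distrib_left sum_distrib_right mult_ac)
    finally show ?thesis .
  qed
  have bl: "bounded_linear ?D"
    by (intro bounded_linear_sum bounded_linear_mult_const bounded_linear_compose[OF bounded_linear_of_real bounded_linear_vec_nth])
  have err: "norm (fourier \<phi> (\<xi> + h) - fourier \<phi> \<xi> - ?D h) \<le> M * norm h ^ 2" for h
  proof -
    have "fourier \<phi> (\<xi> + h) - fourier \<phi> \<xi> - ?D h =
      (LINT x|lborel. cis (- (x \<bullet> (\<xi> + h))) * \<phi> x - cis (- (x \<bullet> \<xi>)) * \<phi> x - (- \<i> * of_real (x \<bullet> h) * cis (- (x \<bullet> \<xi>)) * \<phi> x))"
      unfolding D unfolding fourier_def
      by (simp only: Bochner_Integration.integral_diff Bochner_Integration.integrable_diff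
          integrable_fourier_kernel schwartz_integrable \<phi> iD)
    also have "norm \<dots> \<le> (LINT x|lborel. norm h ^ 2 * (norm x ^ 2 * norm (\<phi> x)))"
    proof (rule Bochner_Integration.integral_norm_bound_integral)
      fix x
      have "cis (- (x \<bullet> (\<xi> + h))) * \<phi> x - cis (- (x \<bullet> \<xi>)) * \<phi> x - (- \<i> * of_real (x \<bullet> h) * cis (- (x \<bullet> \<xi>)) * \<phi> x) =
        cis (- (x \<bullet> \<xi>)) * (cis (- (x \<bullet> h)) - (1 + \<i> * of_real (- (x \<bullet> h)))) * \<phi> x"
      proof -
        have "cis (- (x \<bullet> (\<xi> + h))) = cis (- (x \<bullet> \<xi>)) * cis (- (x \<bullet> h))"
          by (simp add: cis_mult inner_add_right)
        thus ?thesis by (simp add: algebra_simps)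
      qed
      hence eq: "norm (cis (- (x \<bullet> (\<xi> + h))) * \<phi> x - cis (- (x \<bullet> \<xi>)) * \<phi> x - (- \<i> * of_real (x \<bullet> h) * cis (- (x \<bullet> \<xi>)) * \<phi> x)) =
          norm (cis (- (x \<bullet> h)) - (1 + \<i> * of_real (- (x \<bullet> h)))) * norm (\<phi> x)"
        by (simp only: norm_mult norm_cis mult_1_left)
      have "norm (cis u - (1 + \<i> * of_real u)) \<le> u\<^sup>2 / 2" for u
        using iexp_approx1[of u 1] by (simp add: cis_conv_exp power2_eq_square)
      from this[of "- (x \<bullet> h)"] have "norm (cis (- (x \<bullet> h)) - (1 + \<i> * of_real (- (x \<bullet> h)))) \<le> (x \<bullet> h)\<^sup>2"
        by (rule order_trans) simp
      also have "(x \<bullet> h)\<^sup>2 \<le> (norm x * norm h)\<^sup>2"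
        by (rule abs_le_square_iff[THEN iffD1]) (simp add: Cauchy_Schwarz_ineq2)
      finally have "norm (cis (- (x \<bullet> h)) - (1 + \<i> * of_real (- (x \<bullet> h)))) * norm (\<phi> x) \<le> (norm x * norm h)\<^sup>2 * norm (\<phi> x)"
        by (rule mult_right_mono) simp
      thus "norm (cis (- (x \<bullet> (\<xi> + h))) * \<phi> x - cis (- (x \<bullet> \<xi>)) * \<phi> x - (- \<i> * of_real (x \<bullet> h) * cis (- (x \<bullet> \<xi>)) * \<phi> x))
          \<le> norm h ^ 2 * (norm x ^ 2 * norm (\<phi> x))"
        unfolding eq by (simp only: power_mult_distrib mult_ac)
    next
      show "integrable lborel (\<lambda>x. cis (- (x \<bullet> (\<xi> + h))) * \<phi> x - cis (- (x \<bullet> \<xi>)) * \<phi> x - (- \<i> * of_real (x \<bullet> h) * cis (- (x \<bullet> \<xi>)) * \<phi> x))"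
        by (intro Bochner_Integration.integrable_diff integrable_fourier_kernel schwartz_integrable \<phi> iD)
    qed (use iM in auto)
    also have "\<dots> = M * norm h ^ 2" by (simp add: M_def)
    finally show ?thesis .
  qed
  show ?thesis
  proof (rule has_derivativeI_sandwich[of 1])
    show "norm (fourier \<phi> y - fourier \<phi> \<xi> - ?D (y - \<xi>)) / norm (y - \<xi>) \<le> M * norm (y - \<xi>)" if "y \<noteq> \<xi>" for y
      using err[of "y - \<xi>"] that by (simp add: divide_simps power2_eq_square mult_ac)
    show "((\<lambda>y. M * norm (y - \<xi>)) \<longlongrightarrow> 0) (at \<xi>)"
      by (rule tendsto_eq_intros | simp)+
  qed (use bl in auto)
qed

lemma partial_deriv_fourier:
  assumes "\<phi> \<in> schwartz"
  shows "partial_deriv i (fourier \<phi>) = fourier (\<lambda>x. - \<i> * (of_real (x $ i) * \<phi> x))"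
proof
  fix \<xi>
  show "partial_deriv i (fourier \<phi>) \<xi> = fourier (\<lambda>x. - \<i> * (of_real (x $ i) * \<phi> x)) \<xi>"
  proof -
    have "(\<Sum>j\<in>UNIV. of_real (axis i 1 $ j) * fourier (\<lambda>x. - \<i> * (of_real (x $ j) * \<phi> x)) \<xi>) =
      (\<Sum>j\<in>UNIV. if j = i then fourier (\<lambda>x. - \<i> * (of_real (x $ j) * \<phi> x)) \<xi> else 0)"
      by (intro sum.cong) (auto simp: axis_def)
    thus ?thesis
      by (subst partial_derivI[OF fourier_has_derivative[OF assms]]) simp
  qed
qed

text \<open>Each further power of 1 + |\<xi>| costs one derivative of \<phi>: the norm is at most
  the sum of the |\<xi>_j|, and \<xi>_j times the transform is, up to a unit, the transform of the
  j-th partial derivative.\<close>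

lemma rapidly_decreasing_fourier:
  fixes \<phi> :: "real^'n \<Rightarrow> complex"
  assumes "\<phi> \<in> schwartz"
  shows "rapidly_decreasing (fourier \<phi>)"
  unfolding rapidly_decreasing_def
proof
  fix N
  show "\<exists>C. \<forall>\<xi>. (1 + norm \<xi>) ^ N * norm (fourier \<phi> \<xi>) \<le> C"
    using assms
  proof (induction N arbitrary: \<phi>)
    case 0
    thus ?case using norm_fourier_le[OF schwartz_integrable] by auto
  next
    case (Suc N)
    obtain C where C: "\<And>\<xi>. (1 + norm \<xi>) ^ N * norm (fourier \<phi> \<xi>) \<le> C"
      using Suc.IH[OF Suc.prems] by blast
    have "\<exists>C. \<forall>\<xi>. (1 + norm \<xi>) ^ N * norm (fourier (partial_deriv j \<phi>) \<xi>) \<le> C" for j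
      by (rule Suc.IH[OF schwartz_partial[OF Suc.prems]])
    then obtain B where B: "\<And>j \<xi>. (1 + norm \<xi>) ^ N * norm (fourier (partial_deriv j \<phi>) \<xi>) \<le> B j"
      by metis
    have "(1 + norm \<xi>) ^ Suc N * norm (fourier \<phi> \<xi>) \<le> C + (\<Sum>j\<in>UNIV. B j)" for \<xi>
    proof -
      have "(1 + norm \<xi>) ^ Suc N * norm (fourier \<phi> \<xi>) =
          (1 + norm \<xi>) * ((1 + norm \<xi>) ^ N * norm (fourier \<phi> \<xi>))" by simp
      also have "\<dots> \<le> (1 + (\<Sum>j\<in>UNIV. \<bar>\<xi> $ j\<bar>)) * ((1 + norm \<xi>) ^ N * norm (fourier \<phi> \<xi>))"
        using norm_le_l1_cart[of \<xi>] by (intro mult_right_mono) auto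
      also have "\<dots> = (1 + norm \<xi>) ^ N * norm (fourier \<phi> \<xi>) +
          (\<Sum>j\<in>UNIV. \<bar>\<xi> $ j\<bar> * ((1 + norm \<xi>) ^ N * norm (fourier \<phi> \<xi>)))"
        by (simp only: distrib_right sum_distrib_right mult_1)
      also have "(\<lambda>j. \<bar>\<xi> $ j\<bar> * ((1 + norm \<xi>) ^ N * norm (fourier \<phi> \<xi>))) =
          (\<lambda>j. (1 + norm \<xi>) ^ N * norm (fourier (partial_deriv j \<phi>) \<xi>))"
        by (simp add: fourier_partial_deriv[OF Suc.prems] norm_mult mult_ac)
      also have "(1 + norm \<xi>) ^ N * norm (fourier \<phi> \<xi>) +
          (\<Sum>j\<in>UNIV. (1 + norm \<xi>) ^ N * norm (fourier (partial_deriv j \<phi>) \<xi>)) \<le> C + (\<Sum>j\<in>UNIV. B j)"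
        by (intro add_mono sum_mono C B)
      finally show ?thesis .
    qed
    thus ?case by blast
  qed
qed

text \<open>Derivatives of a transform are transforms of coordinate multiples, so the set of all
  transforms of Schwartz functions is itself invariant.\<close>

lemma schwartz_fourier:
  assumes "\<phi> \<in> schwartz"
  shows "fourier \<phi> \<in> schwartz"
proof (rule schwartz_coinduct[of _ "fourier ` schwartz"])
  show "f differentiable (at x)" if "f \<in> fourier ` schwartz" for f and x :: "real^'b"
    using that fourier_has_derivative differentiable_def by blast
  show "partial_deriv i f \<in> fourier ` schwartz" if f: "f \<in> fourier ` schwartz" for f :: "real^'b \<Rightarrow> complex" and i
  proof -
    from f obtain \<psi> where \<psi>: "\<psi> \<in> schwartz" "f = fourier \<psi>" by blast
    show ?thesis
      unfolding \<psi>(2) partial_deriv_fourier[OF \<psi>(1)]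
      by (intro imageI schwartz_scale schwartz_coord \<psi>(1))
  qed
  show "rapidly_decreasing f" if "f \<in> fourier ` schwartz" for f :: "real^'b \<Rightarrow> complex"
    using that rapidly_decreasing_fourier by blast
  show "fourier \<phi> \<in> fourier ` schwartz" using assms by blast
qed

section \<open>Uniqueness of representing functions and Plancherel's inequality\<close>

lemma fourier_iter_deriv:
  "\<phi> \<in> schwartz \<Longrightarrow> fourier (iter_deriv is \<phi>) \<xi> = (\<Prod>j\<leftarrow>is. \<i> * of_real (\<xi> $ j)) * fourier \<phi> \<xi>"
  by (induction "is") (simp_all add: iter_deriv_Cons fourier_partial_deriv schwartz_iter_deriv)

lemma schwartz_monomial_mult:
  "\<phi> \<in> schwartz \<Longrightarrow> (\<lambda>x. (\<Prod>j\<leftarrow>is. c * of_real (x $ j)) * \<phi> x) \<in> schwartz"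
proof (induction "is")
  case (Cons i "is")
  from schwartz_scale[OF schwartz_coord[OF Cons.IH[OF Cons.prems]], of c i]
  show ?case by (simp add: mult_ac)
qed simp

lemma iter_deriv_fourier:
  "\<phi> \<in> schwartz \<Longrightarrow> iter_deriv is (fourier \<phi>) = fourier (\<lambda>x. (\<Prod>j\<leftarrow>is. - \<i> * of_real (x $ j)) * \<phi> x)"
proof (induction "is")
  case (Cons i "is")
  show ?case
    using partial_deriv_fourier[OF schwartz_monomial_mult[OF Cons.prems, of "-\<i>" "is"], of i]
    by (simp add: iter_deriv_Cons Cons mult_ac)
qed simp

lemma prod_list_rev: "prod_list (rev xs) = prod_list (xs :: 'a::comm_monoid_mult list)"
  by (induction xs) (simp_all add: mult.commute)

lemma prod_list_map_uminus:
  "(\<Prod>j\<leftarrow>is. - f j) = (-1) ^ length is * (\<Prod>j\<leftarrow>is. f j :: 'a::comm_ring_1)"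
  by (induction "is") simp_all

text \<open>Moving the derivatives one at a time onto the test function reverses their order. The
  reversal disappears on the Fourier side, where the symbol is a commutative product.\<close>

lemma distr_iter_deriv_eq:
  "distr_iter_deriv is T \<phi> = (-1) ^ length is * T (iter_deriv (rev is) \<phi>)"
proof (induction "is" arbitrary: \<phi>)
  case (Cons i "is")
  have "distr_iter_deriv (i # is) T \<phi> = - distr_iter_deriv is T (partial_deriv i \<phi>)"
    by (simp add: distr_iter_deriv_def distr_partial_def)
  also have "\<dots> = - ((-1) ^ length is * T (iter_deriv (rev is) (partial_deriv i \<phi>)))"
    by (simp add: Cons.IH)
  also have "\<dots> = (-1) ^ length (i # is) * T (iter_deriv (rev (i # is)) \<phi>)"
    by (simp add: iter_deriv_append iter_deriv_Cons)
  finally show ?case .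
qed (simp add: distr_iter_deriv_def)

lemma inv_fourier_eq: "inv_fourier \<phi> x = of_real (1 / (2 * pi) ^ CARD('n)) * fourier \<phi> (- x :: real^'n::finite)"
  by (simp add: inv_fourier_def fourier_def inner_commute)

lemma represents_measurable: "represents f T \<Longrightarrow> f \<in> borel_measurable borel"
  and represents_integrable: "represents f T \<Longrightarrow> \<phi> \<in> schwartz \<Longrightarrow> integrable lborel (\<lambda>x. f x * \<phi> x)"
  and represents_eq: "represents f T \<Longrightarrow> \<phi> \<in> schwartz \<Longrightarrow> T \<phi> = (LINT x|lborel. f x * \<phi> x)"
  by (auto simp: represents_def regular_def)

text \<open>Gaussians with a linear term are test functions, and they already determine a function
  almost everywhere. This is what allows bounds on one representing function to be transferred to
  the choice \<open>fourier_fun\<close>.\<close>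

lemma represents_unique:
  fixes f g :: "real^'n \<Rightarrow> complex"
  assumes f: "represents f T" and g: "represents g T"
  shows "AE x in lborel. f x = g x"
proof -
  have [measurable]: "f \<in> borel_measurable borel" "g \<in> borel_measurable borel"
    using f g by (auto dest: represents_measurable)
  have "AE x in lborel. f x - g x = 0"
  proof (rule AE_zero_if_gaussian_integrals_zero)
    fix a :: real and b :: "real^'n" assume a: "a > 0"
    define \<phi> :: "real^'n \<Rightarrow> complex" where "\<phi> x = of_real (exp (- (a * (norm x)\<^sup>2) + b \<bullet> x))" for x
    have \<phi>: "\<phi> \<in> schwartz" unfolding \<phi>_def[abs_def] by (rule gaussian_schwartz[OF a])
    note i = represents_integrable[OF f \<phi>] represents_integrable[OF g \<phi>]
    show "integrable lborel (\<lambda>x. (f x - g x) * of_real (exp (- (a * (norm x)\<^sup>2) + b \<bullet> x)))"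
      using Bochner_Integration.integrable_diff[OF i] by (simp add: \<phi>_def left_diff_distrib)
    show "(LINT x|lborel. (f x - g x) * of_real (exp (- (a * (norm x)\<^sup>2) + b \<bullet> x))) = 0"
      using Bochner_Integration.integral_diff[OF i] represents_eq[OF f \<phi>] represents_eq[OF g \<phi>]
      by (simp add: \<phi>_def left_diff_distrib)
  qed simp
  thus ?thesis by simp
qed

lemma fourier_measurable [measurable]:
  assumes [measurable]: "f \<in> borel_measurable borel"
  shows "fourier f \<in> borel_measurable borel"
  unfolding fourier_def by measurable

text \<open>Fubini for the absolutely integrable product of \<open>f\<close>, \<open>g\<close> and
  the symmetric kernel. It makes the distributional transform agree with the pointwise one, and it
  drives the proof of Plancherel's inequality.\<close>

lemma fourier_multiplication_formula:
  fixes f g :: "real^'n \<Rightarrow> complex"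
  assumes f: "integrable lborel f" and g: "integrable lborel g"
  shows "(LINT \<xi>|lborel. fourier f \<xi> * g \<xi>) = (LINT x|lborel. f x * fourier g x)"
proof -
  have [measurable]: "f \<in> borel_measurable borel" "g \<in> borel_measurable borel" using f g by auto
  have ip: "integrable (lborel \<Otimes>\<^sub>M lborel) (\<lambda>(x, \<xi>). f x * (cis (- (x \<bullet> \<xi>)) * g \<xi>))"
  proof (rule lborel_pair.Fubini_integrable)
    show "integrable lborel (\<lambda>x. LINT \<xi>|lborel. norm (case (x, \<xi>) of (x, \<xi>) \<Rightarrow> f x * (cis (- (x \<bullet> \<xi>)) * g \<xi>)))"
      using f by (simp add: norm_mult)
    show "AE x in lborel. integrable lborel (\<lambda>\<xi>. case (x, \<xi>) of (x, \<xi>) \<Rightarrow> f x * (cis (- (x \<bullet> \<xi>)) * g \<xi>))"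
      using integrable_fourier_kernel[OF g] by (auto simp: inner_commute)
  qed measurable
  have "(LINT \<xi>|lborel. fourier f \<xi> * g \<xi>) = (LINT \<xi>|lborel. LINT x|lborel. f x * (cis (- (x \<bullet> \<xi>)) * g \<xi>))"
    unfolding fourier_def by (subst integral_mult_left_zero[symmetric]) (simp add: mult_ac)
  also have "\<dots> = (LINT x|lborel. LINT \<xi>|lborel. f x * (cis (- (x \<bullet> \<xi>)) * g \<xi>))"
    by (rule lborel_pair.Fubini_integral[OF ip])
  also have "\<dots> = (LINT x|lborel. f x * fourier g x)"
    by (simp add: fourier_def inner_commute)
  finally show ?thesis .
qed

text \<open>The bound 2 f(x) f(y) \<le> f(x)^2 + f(y)^2 decouples the variables; in each half,
  translation and reflection invariance integrate the kernel to its full mass.\<close>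

lemma nn_integral_convolution_quadratic_le:
  fixes f :: "'a::euclidean_space \<Rightarrow> real" and K :: "'a \<Rightarrow> real"
  assumes [measurable]: "f \<in> borel_measurable borel" "K \<in> borel_measurable borel"
    and f: "\<And>x. 0 \<le> f x" and K: "\<And>x. 0 \<le> K x"
  shows "(\<integral>\<^sup>+x. \<integral>\<^sup>+y. ennreal (f x * f y * K (x - y)) \<partial>lborel \<partial>lborel)
    \<le> (\<integral>\<^sup>+x. ennreal ((f x)\<^sup>2) \<partial>lborel) * (\<integral>\<^sup>+x. ennreal (K x) \<partial>lborel)"
proof -
  define A where "A = (\<integral>\<^sup>+x. ennreal ((f x)\<^sup>2) \<partial>lborel) * (\<integral>\<^sup>+x. ennreal (K x) \<partial>lborel)"
  have t1: "(\<integral>\<^sup>+y. ennreal (K (x - y)) \<partial>lborel) = (\<integral>\<^sup>+x. ennreal (K x) \<partial>lborel)" for x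
    using nn_integral_lborel_affine_euclidean[of "\<lambda>x. ennreal (K x)" "-1" x] by simp
  have t2: "(\<integral>\<^sup>+x. ennreal (K (x - y)) \<partial>lborel) = (\<integral>\<^sup>+x. ennreal (K x) \<partial>lborel)" for y
    using nn_integral_lborel_affine_euclidean[of "\<lambda>x. ennreal (K x)" "1" "-y"] by simp
  have 1: "(\<integral>\<^sup>+x. \<integral>\<^sup>+y. ennreal ((f x)\<^sup>2) * ennreal (K (x - y)) \<partial>lborel \<partial>lborel) = A"
    by (simp add: nn_integral_cmult t1 nn_integral_multc A_def)
  have "(\<integral>\<^sup>+x. \<integral>\<^sup>+y. ennreal ((f y)\<^sup>2) * ennreal (K (x - y)) \<partial>lborel \<partial>lborel) =
     (\<integral>\<^sup>+y. \<integral>\<^sup>+x. ennreal ((f y)\<^sup>2) * ennreal (K (x - y)) \<partial>lborel \<partial>lborel)"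
    by (rule lborel_pair.Fubini'[symmetric]) measurable
  also have "\<dots> = A" by (simp add: nn_integral_cmult t2 nn_integral_multc A_def)
  finally have 2: "(\<integral>\<^sup>+x. \<integral>\<^sup>+y. ennreal ((f y)\<^sup>2) * ennreal (K (x - y)) \<partial>lborel \<partial>lborel) = A" .
  have "2 * (\<integral>\<^sup>+x. \<integral>\<^sup>+y. ennreal (f x * f y * K (x - y)) \<partial>lborel \<partial>lborel) =
    (\<integral>\<^sup>+x. \<integral>\<^sup>+y. 2 * ennreal (f x * f y * K (x - y)) \<partial>lborel \<partial>lborel)"
    by (simp add: nn_integral_cmult)
  also have "\<dots> \<le> (\<integral>\<^sup>+x. \<integral>\<^sup>+y. (ennreal ((f x)\<^sup>2) * ennreal (K (x - y)) + ennreal ((f y)\<^sup>2) * ennreal (K (x - y))) \<partial>lborel \<partial>lborel)"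
  proof (intro nn_integral_mono)
    fix x y :: 'a
    have "0 \<le> (f x - f y)\<^sup>2" by simp
    hence "2 * (f x * f y) \<le> (f x)\<^sup>2 + (f y)\<^sup>2" by (simp add: power2_diff)
    hence "2 * (f x * f y) * K (x - y) \<le> ((f x)\<^sup>2 + (f y)\<^sup>2) * K (x - y)" by (intro mult_right_mono K)
    hence "ennreal (2 * (f x * f y) * K (x - y)) \<le> ennreal (((f x)\<^sup>2 + (f y)\<^sup>2) * K (x - y))" by (rule ennreal_leI)
    moreover have "ennreal (2 * (f x * f y) * K (x - y)) = 2 * ennreal (f x * f y * K (x - y))"
      using f K by (subst mult.assoc, subst ennreal_mult) auto
    moreover have "ennreal (((f x)\<^sup>2 + (f y)\<^sup>2) * K (x - y)) = ennreal ((f x)\<^sup>2) * ennreal (K (x - y)) + ennreal ((f y)\<^sup>2) * ennreal (K (x - y))"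
      using f K by (simp add: ennreal_mult[symmetric] ennreal_plus[symmetric] distrib_right del: ennreal_plus)
    ultimately show "2 * ennreal (f x * f y * K (x - y)) \<le> ennreal ((f x)\<^sup>2) * ennreal (K (x - y)) + ennreal ((f y)\<^sup>2) * ennreal (K (x - y))"
      by simp
  qed
  also have "\<dots> = 2 * A"
    by (simp add: nn_integral_add 1 2 mult_2)
  finally show ?thesis
    unfolding A_def[symmetric] by (subst (asm) ennreal_mult_le_mult_iff) simp_all
qed

abbreviation sq_integral :: "('a::euclidean_space \<Rightarrow> complex) \<Rightarrow> ennreal" where
  "sq_integral f \<equiv> \<integral>\<^sup>+x. ennreal ((norm (f x))\<^sup>2) \<partial>lborel"

abbreviation powr_integral :: "real \<Rightarrow> ('a::euclidean_space \<Rightarrow> complex) \<Rightarrow> ennreal" where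
  "powr_integral p f \<equiv> \<integral>\<^sup>+x. ennreal (norm (f x) powr p) \<partial>lborel"

abbreviation is_fourier :: "(real^'n::finite \<Rightarrow> complex) \<Rightarrow> (real^'n \<Rightarrow> complex) \<Rightarrow> bool" where
  "is_fourier f h \<equiv> represents h (distr_fourier (regular f))"

lemma ennreal_norm_integral_le:
  fixes f :: "_ \<Rightarrow> 'b::{banach, second_countable_topology}"
  shows "ennreal (norm (integral\<^sup>L M f)) \<le> (\<integral>\<^sup>+x. ennreal (norm (f x)) \<partial>M)"
  by (cases "integrable M f") (simp_all add: integral_norm_bound_ennreal not_integrable_integral_eq)

text \<open>The Gaussian weight makes Fubini applicable; its transform is a positive kernel of mass
  $(2\pi)^n$, independently of the width, and the weight is removed by Fatou's lemma.\<close>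

lemma plancherel_bound:
  fixes f :: "real^'n \<Rightarrow> complex"
  assumes f: "integrable lborel f"
  shows "sq_integral (fourier f) \<le>
    ennreal ((2 * pi) ^ CARD('n)) * sq_integral f"
proof -
  have [measurable]: "f \<in> borel_measurable borel" using f by auto
  define B where "B = (LINT x|lborel. norm (f x))"
  have B: "norm (fourier f \<xi>) \<le> B" for \<xi> unfolding B_def by (rule norm_fourier_le[OF f])
  define g where "g a \<xi> = exp (- (a * (norm \<xi>)\<^sup>2 / 2))" for a :: real and \<xi> :: "real^'n"
  have [measurable]: "g a \<in> borel_measurable borel" for a unfolding g_def by measurable
  have reg: "(\<integral>\<^sup>+\<xi>. ennreal ((norm (fourier f \<xi>))\<^sup>2 * g a \<xi>) \<partial>lborel) \<le>
    ennreal ((2 * pi) ^ CARD('n)) * sq_integral f" if a: "a > 0" for a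
  proof -
    have ig: "integrable lborel (g a)" unfolding g_def by (rule integrable_gaussian[OF a])
    \<comment> \<open>\<open>K\<close> is the transform of the weight \<open>g a\<close>, and its
      prefactor is the mass of \<open>g a\<close>. The mass of \<open>K\<close> is therefore the
      product of the masses of the Gaussians with parameters \<open>a\<close> and
      \<open>1 / a\<close>, in which \<open>a\<close> cancels.\<close>
    define K :: "real^'n \<Rightarrow> real" where "K z = sqrt (2 * pi / a) ^ CARD('n) * exp (- ((norm z)\<^sup>2 / (2 * a)))" for z
    have [measurable]: "K \<in> borel_measurable borel" unfolding K_def by measurable
    have Kpos: "K z \<ge> 0" for z using a by (simp add: K_def)
    have eK: "exp (- ((norm z)\<^sup>2 / (2 * a))) = exp (- ((1/a) * (norm z)\<^sup>2 / 2))" for z :: "real^'n" by simp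
    have iK: "integrable lborel K"
      unfolding K_def eK using integrable_gaussian[of "1/a", where 'a="real^'n"] a by simp
    have sq: "sqrt (2 * pi / a) * sqrt (2 * pi / (1 / a)) = 2 * pi"
    proof -
      have "(2 * pi / a) * (2 * pi / (1 / a)) = (2 * pi)\<^sup>2"
        using a by (simp add: power2_eq_square)
      thus ?thesis by (metis real_sqrt_mult real_sqrt_abs abs_of_pos pi_gt_zero zero_less_mult_iff zero_less_numeral)
    qed
    have "integral\<^sup>L lborel K = sqrt (2 * pi / a) ^ CARD('n) * sqrt (2 * pi / (1 / a)) ^ CARD('n)"
      unfolding K_def eK integral_mult_right_zero using integral_gaussian[of "1/a", where 'a="real^'n"] a
      by simp
    also have "\<dots> = (2 * pi) ^ CARD('n)"
      unfolding power_mult_distrib[symmetric] sq ..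
    finally have "integral\<^sup>L lborel K = (2 * pi) ^ CARD('n)" .
    hence nK: "(\<integral>\<^sup>+x. ennreal (K x) \<partial>lborel) = ennreal ((2 * pi) ^ CARD('n))"
      using nn_integral_eq_integral[OF iK] Kpos by simp
    have ihat: "integrable lborel (\<lambda>\<xi>. fourier f \<xi> * of_real (g a \<xi>))"
    proof (rule Bochner_Integration.integrable_bound)
      show "integrable lborel (\<lambda>\<xi>. B * g a \<xi>)" using ig by simp
      show "AE \<xi> in lborel. norm (fourier f \<xi> * of_real (g a \<xi>)) \<le> norm (B * g a \<xi>)"
        using B by (intro AE_I2) (auto simp: norm_mult abs_mult g_def intro: order_trans[OF B abs_ge_self])
    qed measurable
    have fK: "fourier (\<lambda>\<xi>. cis (x \<bullet> \<xi>) * of_real (g a \<xi>)) y = of_real (K (x - y))" for x y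
    proof -
      have "fourier (\<lambda>\<xi>. cis (x \<bullet> \<xi>) * of_real (g a \<xi>)) y =
        (LINT \<xi>|lborel. cis (\<xi> \<bullet> (x - y)) * of_real (g a \<xi>))"
        unfolding fourier_def by (simp add: inner_diff_right cis_mult mult.assoc[symmetric] inner_commute)
      thus ?thesis using integral_gaussian_cis[OF a, of "x - y"] by (simp add: g_def K_def)
    qed
    \<comment> \<open>Pairing the transform of \<open>f\<close> with \<open>G\<close> gives the
      weighted square integral. The multiplication formula moves the transform onto
      \<open>G\<close>, where it becomes the conjugate of the convolution of \<open>f\<close> with
      \<open>K\<close>; what remains is a quadratic form in |f| with kernel
      \<open>K\<close>.\<close>
    define G where "G \<xi> = cnj (fourier f \<xi> * of_real (g a \<xi>))" for \<xi>
    have iG: "integrable lborel G" unfolding G_def complex_integrable_cnj by (rule ihat)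
    have FG: "fourier G x = cnj (LINT y|lborel. f y * of_real (K (x - y)))" for x
    proof -
      have ic: "integrable lborel (\<lambda>\<xi>. cis (x \<bullet> \<xi>) * complex_of_real (g a \<xi>))"
        using integrable_gaussian_cis[OF a, of x] by (simp add: g_def inner_commute)
      have "fourier G x = (LINT \<xi>|lborel. cnj (fourier f \<xi> * (cis (x \<bullet> \<xi>) * of_real (g a \<xi>))))"
        unfolding fourier_def G_def by (simp add: cis_cnj inner_commute mult_ac)
      also have "\<dots> = cnj (LINT \<xi>|lborel. fourier f \<xi> * (cis (x \<bullet> \<xi>) * of_real (g a \<xi>)))"
        by (rule Bochner_Integration.integral_cnj)
      also have "(LINT \<xi>|lborel. fourier f \<xi> * (cis (x \<bullet> \<xi>) * of_real (g a \<xi>))) = (LINT y|lborel. f y * of_real (K (x - y)))"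
        by (subst fourier_multiplication_formula[OF f ic]) (simp add: fK)
      finally show ?thesis .
    qed
    have "(\<integral>\<^sup>+\<xi>. ennreal ((norm (fourier f \<xi>))\<^sup>2 * g a \<xi>) \<partial>lborel) = ennreal (LINT \<xi>|lborel. (norm (fourier f \<xi>))\<^sup>2 * g a \<xi>)"
    proof (rule nn_integral_eq_integral)
      show "integrable lborel (\<lambda>\<xi>. (norm (fourier f \<xi>))\<^sup>2 * g a \<xi>)"
      proof (rule Bochner_Integration.integrable_bound)
        show "integrable lborel (\<lambda>\<xi>. B\<^sup>2 * g a \<xi>)" using ig by simp
        show "AE \<xi> in lborel. norm ((norm (fourier f \<xi>))\<^sup>2 * g a \<xi>) \<le> norm (B\<^sup>2 * g a \<xi>)"
          by (intro AE_I2) (auto simp: abs_mult g_def intro!: power_mono B)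
      qed measurable
    qed (simp add: g_def)
    also have "(LINT \<xi>|lborel. (norm (fourier f \<xi>))\<^sup>2 * g a \<xi>) = norm (LINT \<xi>|lborel. fourier f \<xi> * G \<xi>)"
    proof -
      have "(LINT \<xi>|lborel. fourier f \<xi> * G \<xi>) = (LINT \<xi>|lborel. of_real ((norm (fourier f \<xi>))\<^sup>2 * g a \<xi>))"
        unfolding G_def by (intro Bochner_Integration.integral_cong) (simp_all only: of_real_mult complex_norm_square complex_cnj_mult complex_cnj_complex_of_real mult.assoc)
      also have "\<dots> = of_real (LINT \<xi>|lborel. (norm (fourier f \<xi>))\<^sup>2 * g a \<xi>)" by (rule integral_complex_of_real)
      finally show ?thesis by (simp add: g_def integral_nonneg)
    qed
    also have "(LINT \<xi>|lborel. fourier f \<xi> * G \<xi>) = (LINT x|lborel. f x * fourier G x)"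
      by (rule fourier_multiplication_formula[OF f iG])
    also have "ennreal (norm \<dots>) \<le> (\<integral>\<^sup>+x. ennreal (norm (f x * fourier G x)) \<partial>lborel)"
      by (rule ennreal_norm_integral_le)
    also have "\<dots> \<le> (\<integral>\<^sup>+x. \<integral>\<^sup>+y. ennreal (norm (f x) * norm (f y) * K (x - y)) \<partial>lborel \<partial>lborel)"
    proof (rule nn_integral_mono)
      fix x
      have "ennreal (norm (f x * fourier G x)) = ennreal (norm (f x)) * ennreal (norm (LINT y|lborel. f y * of_real (K (x - y))))"
        by (simp add: norm_mult FG ennreal_mult)
      also have "\<dots> \<le> ennreal (norm (f x)) * (\<integral>\<^sup>+y. ennreal (norm (f y * of_real (K (x - y)))) \<partial>lborel)"
        by (intro mult_left_mono ennreal_norm_integral_le) simp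
      also have "\<dots> = (\<integral>\<^sup>+y. ennreal (norm (f x) * norm (f y) * K (x - y)) \<partial>lborel)"
        using Kpos by (subst nn_integral_cmult[symmetric]) (auto simp: norm_mult ennreal_mult mult_ac)
      finally show "ennreal (norm (f x * fourier G x)) \<le> (\<integral>\<^sup>+y. ennreal (norm (f x) * norm (f y) * K (x - y)) \<partial>lborel)" .
    qed
    also have "\<dots> \<le> sq_integral f * (\<integral>\<^sup>+x. ennreal (K x) \<partial>lborel)"
      by (rule nn_integral_convolution_quadratic_le) (auto simp: Kpos)
    also have "\<dots> = ennreal ((2 * pi) ^ CARD('n)) * sq_integral f"
      by (simp add: nK mult.commute)
    finally show ?thesis .
  qed
  have "sq_integral (fourier f) =
    (\<integral>\<^sup>+\<xi>. liminf (\<lambda>k. ennreal ((norm (fourier f \<xi>))\<^sup>2 * g (1 / real (Suc k)) \<xi>)) \<partial>lborel)"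
  proof (rule nn_integral_cong)
    fix \<xi>
    have "(\<lambda>k. g (1 / real (Suc k)) \<xi>) \<longlonglongrightarrow> exp (- (0 * (norm \<xi>)\<^sup>2 / 2))"
      unfolding g_def by (intro tendsto_intros LIMSEQ_Suc[OF lim_1_over_n]) simp
    from tendsto_mult[OF tendsto_const this]
    have "(\<lambda>k. ennreal ((norm (fourier f \<xi>))\<^sup>2 * g (1 / real (Suc k)) \<xi>)) \<longlonglongrightarrow> ennreal ((norm (fourier f \<xi>))\<^sup>2)"
      by (intro tendsto_ennrealI) simp
    thus "ennreal ((norm (fourier f \<xi>))\<^sup>2) = liminf (\<lambda>k. ennreal ((norm (fourier f \<xi>))\<^sup>2 * g (1 / real (Suc k)) \<xi>))"
      by (intro lim_imp_Liminf[symmetric]) simp_all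
  qed
  also have "\<dots> \<le> liminf (\<lambda>k. \<integral>\<^sup>+\<xi>. ennreal ((norm (fourier f \<xi>))\<^sup>2 * g (1 / real (Suc k)) \<xi>) \<partial>lborel)"
    by (rule nn_integral_liminf) measurable
  also have "\<dots> \<le> ennreal ((2 * pi) ^ CARD('n)) * sq_integral f"
    by (rule Liminf_le, simp) (intro always_eventually allI reg, simp)
  finally show ?thesis .
qed

section \<open>The Fourier transform on square integrable functions\<close>

lemma represents_fourier_L1:
  fixes f :: "real^'n \<Rightarrow> complex"
  assumes f: "integrable lborel f"
  shows "is_fourier f (fourier f)"
  unfolding represents_def
proof (intro conjI ballI)
  have [measurable]: "f \<in> borel_measurable borel" using f by auto
  show "fourier f \<in> borel_measurable lborel" by simp
  fix \<phi> :: "real^'n \<Rightarrow> complex" assume \<phi>: "\<phi> \<in> schwartz"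
  have [measurable]: "\<phi> \<in> borel_measurable borel" by (rule schwartz_measurable[OF \<phi>])
  show "integrable lborel (\<lambda>x. fourier f x * \<phi> x)"
  proof (rule Bochner_Integration.integrable_bound)
    show "integrable lborel (\<lambda>x. (LINT y|lborel. norm (f y)) * norm (\<phi> x))"
      using schwartz_integrable[OF \<phi>] by simp
    show "AE x in lborel. norm (fourier f x * \<phi> x) \<le> norm ((LINT y|lborel. norm (f y)) * norm (\<phi> x))"
      using norm_fourier_le[OF f]
      by (intro AE_I2) (auto simp: norm_mult abs_mult intro!: mult_right_mono order_trans[OF _ abs_ge_self])
  qed measurable
  show "distr_fourier (regular f) \<phi> = regular (fourier f) \<phi>"
    using fourier_multiplication_formula[OF f schwartz_integrable[OF \<phi>]]
    by (simp add: distr_fourier_def regular_def)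
qed

lemma integrable_mult_square_integrable:
  fixes f g :: "'a \<Rightarrow> complex"
  assumes [measurable]: "f \<in> borel_measurable M" "g \<in> borel_measurable M"
    and f: "(\<integral>\<^sup>+x. ennreal ((norm (f x))\<^sup>2) \<partial>M) < \<infinity>" and g: "(\<integral>\<^sup>+x. ennreal ((norm (g x))\<^sup>2) \<partial>M) < \<infinity>"
  shows "integrable M (\<lambda>x. f x * g x)"
proof (rule Bochner_Integration.integrable_bound)
  show "integrable M (\<lambda>x. (norm (f x))\<^sup>2 + (norm (g x))\<^sup>2)"
    using f g by (intro Bochner_Integration.integrable_add) (auto simp: integrable_iff_bounded)
  show "AE x in M. norm (f x * g x) \<le> norm ((norm (f x))\<^sup>2 + (norm (g x))\<^sup>2)"
  proof (rule AE_I2)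
    fix x
    have "2 * norm (f x) * norm (g x) \<le> (norm (f x))\<^sup>2 + (norm (g x))\<^sup>2" by (rule sum_squares_bound)
    moreover have "0 \<le> norm (f x) * norm (g x)" by simp
    ultimately have "norm (f x) * norm (g x) \<le> (norm (f x))\<^sup>2 + (norm (g x))\<^sup>2" by linarith
    thus "norm (f x * g x) \<le> norm ((norm (f x))\<^sup>2 + (norm (g x))\<^sup>2)" by (simp add: norm_mult)
  qed
qed measurable

lemma schwartz_square_integrable:
  assumes \<phi>: "\<phi> \<in> schwartz"
  shows "sq_integral \<phi> < \<infinity>"
proof -
  obtain C where C: "C > 0" "\<And>x. (1 + norm x) ^ 0 * norm (\<phi> x) \<le> C"
    using schwartz_rapidly_decreasing[OF \<phi>] rapidly_decreasingE by metis
  have "sq_integral \<phi> \<le> (\<integral>\<^sup>+x. ennreal (norm (C * norm (\<phi> x))) \<partial>lborel)"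
    using C by (intro nn_integral_mono ennreal_leI) (simp add: power2_eq_square abs_mult mult_right_mono)
  also have "\<dots> < \<infinity>"
    using integrable_norm[OF schwartz_integrable[OF \<phi>]] integrable_mult_right[of C lborel "\<lambda>x. norm (\<phi> x)"]
    unfolding integrable_iff_bounded by blast
  finally show ?thesis .
qed

text \<open>Either |a_j| \<le> 2^(-j), or else |a_j| < 2^j |a_j|^2. In this way square-integral
  bounds on successive differences give absolute convergence at almost every point.\<close>

lemma summable_if_weighted_squares_finite:
  fixes a :: "nat \<Rightarrow> complex"
  assumes "(\<Sum>j. ennreal (2 ^ j * (norm (a j))\<^sup>2)) < \<infinity>"
  shows "summable a"
proof (rule summable_comparison_test')
  have s: "summable (\<lambda>j. 2 ^ j * (norm (a j))\<^sup>2)"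
    using assms by (intro summable_suminf_not_top) auto
  show "summable (\<lambda>j. (1 / 2) ^ j + 2 ^ j * (norm (a j))\<^sup>2)"
    using s by (intro summable_add summable_geometric) auto
  show "norm (a j) \<le> (1 / 2) ^ j + 2 ^ j * (norm (a j))\<^sup>2" if "j \<ge> 0" for j
  proof (cases "norm (a j) \<le> (1 / 2) ^ j")
    case True
    thus ?thesis by (simp add: add_increasing2)
  next
    case False
    hence "(1/2) ^ j * norm (a j) \<le> norm (a j) * norm (a j)" by (intro mult_right_mono) auto
    hence "2 ^ j * ((1/2) ^ j * norm (a j)) \<le> 2 ^ j * (norm (a j))\<^sup>2"
      by (intro mult_left_mono) (auto simp: power2_eq_square)
    moreover have "2 ^ j * ((1/2) ^ j * norm (a j)) = norm (a j)"
      by (simp add: power_one_over)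
    ultimately show ?thesis by (simp add: add_increasing)
  qed
qed

text \<open>The cutoff radii \<open>K j\<close> are chosen such that the transforms of the truncations of \<open>f\<close> converge
  almost everywhere, which replaces completeness of $L^2$.\<close>

lemma represents_fourier_L2:
  fixes f :: "real^'n \<Rightarrow> complex"
  assumes [measurable]: "f \<in> borel_measurable borel"
    and f: "sq_integral f < \<infinity>"
  shows "\<exists>h. is_fourier f h \<and>
    (sq_integral h) \<le> ennreal ((2 * pi) ^ CARD('n)) * sq_integral f"
proof -
  define I where "I = sq_integral f"
  define P where "P = (2 * pi) ^ CARD('n)"
  have P: "P > 0" by (simp add: P_def)
  have if2: "integrable lborel (\<lambda>x. (norm (f x))\<^sup>2)" using f by (auto simp: integrable_iff_bounded)
  define tail where "tail k = (LINT x|lborel. (norm (f x))\<^sup>2 * indicator {x. real k < norm x} x)" for k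
  have itail: "integrable lborel (\<lambda>x. (norm (f x))\<^sup>2 * indicator {x. real k < norm x} x)" for k
    by (rule Bochner_Integration.integrable_bound[OF if2]) (auto split: split_indicator)
  have tail0: "tail \<longlonglongrightarrow> 0"
  proof -
    have "(\<lambda>k. LINT x|lborel. (norm (f x))\<^sup>2 * indicator {x. real k < norm x} x) \<longlonglongrightarrow> (LINT x|(lborel :: (real^'n) measure). 0)"
    proof (rule integral_dominated_convergence[OF _ _ if2])
      show "AE x in lborel. (\<lambda>k. (norm (f x))\<^sup>2 * indicator {x. real k < norm x} x) \<longlonglongrightarrow> 0"
      proof (intro AE_I2 tendsto_eventually)
        fix x :: "real^'n"
        show "\<forall>\<^sub>F k in sequentially. (norm (f x))\<^sup>2 * indicator {x. real k < norm x} x = 0"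
          using eventually_ge_at_top[of "nat \<lceil>norm x\<rceil>"]
          by eventually_elim (auto split: split_indicator simp: nat_ceiling_le_eq)
      qed
    qed (auto split: split_indicator)
    thus ?thesis by (simp add: tail_def[abs_def])
  qed
  \<comment> \<open>The rate 8^(-j) leaves room for the weight 2^j, both in the almost everywhere
    convergence and in the pairing with test functions. The condition k \<ge> j makes the
    truncations exhaust the space.\<close>
  have "\<exists>k\<ge>j. tail k < (1/8) ^ j" for j
  proof -
    have "eventually (\<lambda>k. tail k < (1/8) ^ j) sequentially"
      using tail0 by (rule order_tendstoD) simp
    thus ?thesis by (auto simp: eventually_sequentially dest: spec[of _ "max _ j"])
       (metis max.cobounded1 max.cobounded2)
  qed
  then obtain K where K: "\<And>j. K j \<ge> j" "\<And>j. tail (K j) < (1/8) ^ j" by metis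
  define F where "F j x = (if norm x \<le> real (K j) then f x else 0)" for j x
  have [measurable]: "F j \<in> borel_measurable borel" for j unfolding F_def by measurable
  have Fle: "norm (F j x) \<le> norm (f x)" for j x by (simp add: F_def)
  have iF: "integrable lborel (F j)" for j
  proof (rule Bochner_Integration.integrable_bound)
    show "integrable lborel (\<lambda>x. (norm (f x))\<^sup>2 + indicator (cball 0 (real (K j))) x :: real)"
      using if2 emeasure_bounded_finite[of "cball (0 :: real^'n) (real (K j))"]
      by (intro Bochner_Integration.integrable_add integrable_real_indicator) auto
    show "AE x in lborel. norm (F j x) \<le> norm ((norm (f x))\<^sup>2 + indicator (cball 0 (real (K j))) x :: real)"
    proof (rule AE_I2)
      fix x
      have "norm (f x) \<le> (norm (f x))\<^sup>2 + 1"
        using sum_squares_bound[of "norm (f x)" 1] norm_ge_zero[of "f x"] by (simp only: mult_1_right one_power2)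
      thus "norm (F j x) \<le> norm ((norm (f x))\<^sup>2 + indicator (cball 0 (real (K j))) x :: real)"
        by (auto simp: F_def)
    qed
  qed measurable
  define g where "g j = fourier (F j)" for j
  have [measurable]: "g j \<in> borel_measurable borel" for j unfolding g_def by measurable
  \<comment> \<open>\<open>K\<close> is not known to be monotone, so the difference of two
    truncations is bounded by the sum of both tails.\<close>
  have gd: "sq_integral (\<lambda>\<xi>. g i \<xi> - g j \<xi>) \<le> ennreal (2 * P * (1/8) ^ j)" if ij: "j \<le> i" for i j
  proof -
    have "g i \<xi> - g j \<xi> = fourier (\<lambda>x. F i x - F j x) \<xi>" for \<xi>
      unfolding g_def fourier_def right_diff_distrib
      by (rule Bochner_Integration.integral_diff[symmetric]; rule integrable_fourier_kernel[OF iF])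
    hence "sq_integral (\<lambda>\<xi>. g i \<xi> - g j \<xi>) \<le>
        ennreal P * sq_integral (\<lambda>x. F i x - F j x)"
      using plancherel_bound[of "\<lambda>x. F i x - F j x"] iF by (simp add: P_def)
    also have "\<dots> \<le> ennreal P * (\<integral>\<^sup>+x. ennreal ((norm (f x))\<^sup>2 * indicator {x. real (K i) < norm x} x + (norm (f x))\<^sup>2 * indicator {x. real (K j) < norm x} x) \<partial>lborel)"
      by (intro mult_left_mono nn_integral_mono ennreal_leI) (auto simp: F_def split: split_indicator)
    also have "\<dots> = ennreal P * ennreal (tail (K i) + tail (K j))"
      unfolding tail_def
      by (subst nn_integral_eq_integral) (auto intro!: Bochner_Integration.integrable_add itail simp: Bochner_Integration.integral_add[OF itail itail])
    also have "\<dots> = ennreal (P * (tail (K i) + tail (K j)))"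
      using P by (simp add: ennreal_mult')
    also have "\<dots> \<le> ennreal (2 * P * (1/8) ^ j)"
    proof (rule ennreal_leI)
      have "tail (K i) \<le> (1/8) ^ i" using K(2)[of i] by simp
      also have "\<dots> \<le> (1/8) ^ j" using ij by (intro power_decreasing) auto
      finally have "tail (K i) + tail (K j) \<le> 2 * (1/8) ^ j" using K(2)[of j] by simp
      hence "P * (tail (K i) + tail (K j)) \<le> P * (2 * (1/8) ^ j)" using P by (intro mult_left_mono) auto
      thus "P * (tail (K i) + tail (K j)) \<le> 2 * P * (1/8) ^ j" by (simp add: mult_ac)
    qed
    finally show ?thesis .
  qed
  \<comment> \<open>\<open>lim\<close> is unspecified where the sequence diverges. It is measurable
    all the same, and divergence is confined to a null set by \<open>conv\<close>.\<close>
  define h where "h \<xi> = lim (\<lambda>j. g j \<xi>)" for \<xi>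
  have [measurable]: "h \<in> borel_measurable borel" unfolding h_def by (rule borel_measurable_lim_metric) measurable
  have conv: "AE \<xi> in lborel. (\<lambda>j. g j \<xi>) \<longlonglongrightarrow> h \<xi>"
  proof -
    have "(\<integral>\<^sup>+\<xi>. (\<Sum>j. ennreal (2 ^ j * (norm (g (Suc j) \<xi> - g j \<xi>))\<^sup>2)) \<partial>lborel) =
      (\<Sum>j. ennreal (2 ^ j) * sq_integral (\<lambda>\<xi>. g (Suc j) \<xi> - g j \<xi>))"
      by (subst nn_integral_suminf) (simp_all add: ennreal_mult nn_integral_cmult)
    also have "\<dots> \<le> (\<Sum>j. ennreal (2 * P * (1/4) ^ j))"
    proof (intro suminf_le)
      fix j
      have "ennreal (2 ^ j) * sq_integral (\<lambda>\<xi>. g (Suc j) \<xi> - g j \<xi>) \<le> ennreal (2 ^ j) * ennreal (2 * P * (1/8) ^ j)"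
        by (intro mult_left_mono gd) auto
      also have "\<dots> = ennreal (2 * P * (2 ^ j * (1/8) ^ j))"
        using P by (simp add: ennreal_mult[symmetric] mult_ac)
      also have "(2::real) ^ j * (1/8) ^ j = (1/4) ^ j" by (simp flip: power_mult_distrib)
      finally show "ennreal (2 ^ j) * sq_integral (\<lambda>\<xi>. g (Suc j) \<xi> - g j \<xi>) \<le> ennreal (2 * P * (1/4) ^ j)" .
    qed auto
    also have "\<dots> < \<infinity>"
      using P by (subst suminf_ennreal2) (auto intro!: summable_mult summable_geometric)
    finally have "AE \<xi> in lborel. (\<Sum>j. ennreal (2 ^ j * (norm (g (Suc j) \<xi> - g j \<xi>))\<^sup>2)) \<noteq> \<infinity>"
      by (intro nn_integral_PInf_AE) auto
    thus ?thesis
    proof eventually_elim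
      case (elim \<xi>)
      hence "summable (\<lambda>j. g (Suc j) \<xi> - g j \<xi>)"
        by (intro summable_if_weighted_squares_finite) (simp add: less_top)
      hence "convergent (\<lambda>n. \<Sum>j<n. (g (Suc j) \<xi> - g j \<xi>))"
        by (simp only: summable_iff_convergent)
      hence "convergent (\<lambda>n. g n \<xi> - g 0 \<xi>)"
        by (simp only: sum_lessThan_telescope[of "\<lambda>j. g j \<xi>"])
      hence "convergent (\<lambda>j. g j \<xi>)"
        using convergent_diff_const_right_iff by blast
      thus ?case by (simp add: h_def convergent_LIMSEQ_iff)
    qed
  qed
  \<comment> \<open>Fatou's lemma in \<open>i\<close> for fixed \<open>j\<close> carries the Cauchy
    rate over to the limit.\<close>
  have hg: "sq_integral (\<lambda>\<xi>. h \<xi> - g j \<xi>) \<le> ennreal (2 * P * (1/8) ^ j)" for j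
  proof -
    have "sq_integral (\<lambda>\<xi>. h \<xi> - g j \<xi>) =
      (\<integral>\<^sup>+\<xi>. liminf (\<lambda>i. ennreal ((norm (g i \<xi> - g j \<xi>))\<^sup>2)) \<partial>lborel)"
      using conv
      by (intro nn_integral_cong_AE, eventually_elim)
         (auto intro!: lim_imp_Liminf[symmetric] tendsto_ennrealI tendsto_intros)
    also have "\<dots> \<le> liminf (\<lambda>i. \<integral>\<^sup>+\<xi>. ennreal ((norm (g i \<xi> - g j \<xi>))\<^sup>2) \<partial>lborel)"
      by (rule nn_integral_liminf) measurable
    also have "\<dots> \<le> ennreal (2 * P * (1/8) ^ j)"
    proof (rule Liminf_le)
      show "\<forall>\<^sub>F i in sequentially. (sq_integral (\<lambda>\<xi>. g i \<xi> - g j \<xi>)) \<le> ennreal (2 * P * (1/8) ^ j)"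
        using eventually_ge_at_top[of j] by eventually_elim (rule gd)
    qed simp
    finally show ?thesis .
  qed
  have hI: "sq_integral h \<le> ennreal P * I"
  proof -
    have "sq_integral h =
      (\<integral>\<^sup>+\<xi>. liminf (\<lambda>i. ennreal ((norm (g i \<xi>))\<^sup>2)) \<partial>lborel)"
      using conv
      by (intro nn_integral_cong_AE, eventually_elim)
         (auto intro!: lim_imp_Liminf[symmetric] tendsto_ennrealI tendsto_intros)
    also have "\<dots> \<le> liminf (\<lambda>i. \<integral>\<^sup>+\<xi>. ennreal ((norm (g i \<xi>))\<^sup>2) \<partial>lborel)"
      by (rule nn_integral_liminf) measurable
    also have "\<dots> \<le> ennreal P * I"
    proof (rule Liminf_le, simp, intro always_eventually allI)
      fix i
      have "sq_integral (g i) \<le> ennreal P * sq_integral (F i)"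
        unfolding g_def P_def by (rule plancherel_bound[OF iF])
      also have "\<dots> \<le> ennreal P * I"
        unfolding I_def by (intro mult_left_mono nn_integral_mono ennreal_leI power_mono Fle) auto
      finally show "sq_integral (g i) \<le> ennreal P * I" .
    qed
    finally show ?thesis .
  qed
  have h2: "sq_integral h < \<infinity>"
    using hI f by (auto simp: I_def ennreal_mult_less_top intro: le_less_trans)
  have "is_fourier f h"
    unfolding represents_def
  proof (intro conjI ballI)
    fix \<phi> :: "real^'n \<Rightarrow> complex" assume \<phi>: "\<phi> \<in> schwartz"
    have [measurable]: "\<phi> \<in> borel_measurable borel" by (rule schwartz_measurable[OF \<phi>])
    have F\<phi>: "fourier \<phi> \<in> schwartz" by (rule schwartz_fourier[OF \<phi>])
    have ih: "integrable lborel (\<lambda>x. h x * \<phi> x)"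
      by (rule integrable_mult_square_integrable) (use h2 schwartz_square_integrable[OF \<phi>] in auto)
    thus "integrable lborel (\<lambda>x. h x * \<phi> x)" .
    have ig: "integrable lborel (\<lambda>x. g j x * \<phi> x)" for j
      using represents_integrable[OF represents_fourier_L1[OF iF] \<phi>] by (simp add: g_def)
    define M where "M = enn2real (sq_integral \<phi>)"
    have M: "sq_integral \<phi> = ennreal M" "M \<ge> 0"
      using schwartz_square_integrable[OF \<phi>] by (auto simp: M_def)
    have bd: "norm ((LINT x|lborel. g j x * \<phi> x) - (LINT x|lborel. h x * \<phi> x)) \<le> (2 * P + M) * (1/2) ^ j" for j
    proof -
      have "ennreal (norm ((LINT x|lborel. g j x * \<phi> x) - (LINT x|lborel. h x * \<phi> x))) =
        ennreal (norm (LINT x|lborel. (g j x * \<phi> x - h x * \<phi> x)))"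
        by (simp add: Bochner_Integration.integral_diff[OF ig ih])
      also have "\<dots> \<le> (\<integral>\<^sup>+x. ennreal (norm (g j x * \<phi> x - h x * \<phi> x)) \<partial>lborel)"
        by (rule ennreal_norm_integral_le)
      also have "\<dots> \<le> (\<integral>\<^sup>+x. (ennreal (2 ^ j) * ennreal ((norm (h x - g j x))\<^sup>2) + ennreal ((1/2) ^ j) * ennreal ((norm (\<phi> x))\<^sup>2)) \<partial>lborel)"
      proof (rule nn_integral_mono)
        fix x
        define a where "a = norm (h x - g j x)"
        define b where "b = norm (\<phi> x)"
        \<comment> \<open>A weighted arithmetic-geometric mean inequality stands in for
          Cauchy-Schwarz. With the weight 2^j, the squared distance of order 8^(-j) still tends to
          0, and so does the term with the test function.\<close>
        have "a * b \<le> 2 ^ j * a\<^sup>2 + (1/2) ^ j * b\<^sup>2"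
        proof -
          have "0 \<le> (2 ^ j * a - b)\<^sup>2 * (1/2) ^ j" by simp
          also have "\<dots> = 2 ^ j * a\<^sup>2 + (1/2) ^ j * b\<^sup>2 - 2 * (a * b)"
            by (simp add: power2_diff power_one_over field_simps power2_eq_square)
          finally have "2 * (a * b) \<le> 2 ^ j * a\<^sup>2 + (1/2) ^ j * b\<^sup>2" by simp
          moreover have "0 \<le> a * b" by (simp add: a_def b_def)
          ultimately show ?thesis by linarith
        qed
        moreover have "norm (g j x * \<phi> x - h x * \<phi> x) = a * b"
          by (simp add: a_def b_def norm_minus_commute norm_mult flip: left_diff_distrib)
        ultimately have "ennreal (norm (g j x * \<phi> x - h x * \<phi> x)) \<le> ennreal (2 ^ j * a\<^sup>2 + (1/2) ^ j * b\<^sup>2)"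
          by (intro ennreal_leI) simp
        thus "ennreal (norm (g j x * \<phi> x - h x * \<phi> x)) \<le>
          ennreal (2 ^ j) * ennreal ((norm (h x - g j x))\<^sup>2) + ennreal ((1/2) ^ j) * ennreal ((norm (\<phi> x))\<^sup>2)"
          by (simp add: a_def b_def ennreal_mult)
      qed
      also have "\<dots> = ennreal (2 ^ j) * sq_integral (\<lambda>x. h x - g j x) + ennreal ((1/2) ^ j) * ennreal M"
        by (simp add: nn_integral_add nn_integral_cmult M)
      also have "\<dots> \<le> ennreal (2 ^ j) * ennreal (2 * P * (1/8) ^ j) + ennreal ((1/2) ^ j) * ennreal M"
        by (intro add_right_mono mult_left_mono hg) auto
      also have "\<dots> = ennreal (2 ^ j * (2 * P * (1/8) ^ j) + (1/2) ^ j * M)"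
        using P M by (simp add: ennreal_mult)
      finally have "norm ((LINT x|lborel. g j x * \<phi> x) - (LINT x|lborel. h x * \<phi> x)) \<le> 2 ^ j * (2 * P * (1/8) ^ j) + (1/2) ^ j * M"
        using P M by (subst (asm) ennreal_le_iff) auto
      also have "2 ^ j * (2 * P * (1/8) ^ j) = 2 * P * (1/4) ^ j"
      proof -
        have "(2::real) ^ j * (1/8) ^ j = (1/4) ^ j" by (simp flip: power_mult_distrib)
        thus ?thesis by (simp add: mult_ac)
      qed
      also have "2 * P * (1/4) ^ j \<le> 2 * P * (1/2) ^ j"
        using P by (intro mult_left_mono power_mono) auto
      finally show ?thesis by (simp add: algebra_simps)
    qed
    have l1: "(\<lambda>j. LINT x|lborel. g j x * \<phi> x) \<longlonglongrightarrow> (LINT x|lborel. h x * \<phi> x)"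
    proof (rule LIM_zero_cancel, rule Lim_null_comparison)
      show "\<forall>\<^sub>F j in sequentially. norm ((LINT x|lborel. g j x * \<phi> x) - (LINT x|lborel. h x * \<phi> x)) \<le> (2 * P + M) * (1/2) ^ j"
        using bd by (intro always_eventually) auto
      show "(\<lambda>j. (2 * P + M) * (1/2) ^ j) \<longlonglongrightarrow> 0"
        by (intro tendsto_mult_right_zero LIMSEQ_power_zero) simp
    qed
    \<comment> \<open>The same pairings have a second limit: with the transform on \<phi>, they
      converge because the truncations are dominated by \<open>f\<close>. Equating the two limits
      identifies \<open>h\<close>.\<close>
    have gF: "(LINT x|lborel. g j x * \<phi> x) = (LINT x|lborel. F j x * fourier \<phi> x)" for j
      unfolding g_def by (rule fourier_multiplication_formula[OF iF schwartz_integrable[OF \<phi>]])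
    have l2: "(\<lambda>j. LINT x|lborel. F j x * fourier \<phi> x) \<longlonglongrightarrow> (LINT x|lborel. f x * fourier \<phi> x)"
    proof (rule integral_dominated_convergence)
      show "integrable lborel (\<lambda>x. norm (f x * fourier \<phi> x))"
        by (intro integrable_norm integrable_mult_square_integrable) (use f schwartz_square_integrable[OF F\<phi>] in auto)
      show "AE x in lborel. (\<lambda>j. F j x * fourier \<phi> x) \<longlonglongrightarrow> f x * fourier \<phi> x"
      proof (intro AE_I2 tendsto_eventually)
        fix x
        show "\<forall>\<^sub>F j in sequentially. F j x * fourier \<phi> x = f x * fourier \<phi> x"
          using eventually_ge_at_top[of "nat \<lceil>norm x\<rceil>"]
        proof eventually_elim
          case (elim j)
          hence "norm x \<le> real j" by (simp add: nat_ceiling_le_eq)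
          also have "\<dots> \<le> real (K j)" using K(1) by simp
          finally show ?case by (simp add: F_def)
        qed
      qed
      show "AE x in lborel. norm (F j x * fourier \<phi> x) \<le> norm (f x * fourier \<phi> x)" for j
        using Fle by (intro AE_I2) (auto simp: norm_mult intro!: mult_right_mono)
    qed measurable
    have "(LINT x|lborel. h x * \<phi> x) = (LINT x|lborel. f x * fourier \<phi> x)"
      using LIMSEQ_unique[OF l1[unfolded gF] l2] .
    thus "distr_fourier (regular f) \<phi> = regular h \<phi>"
      by (simp add: distr_fourier_def regular_def)
  qed simp
  thus ?thesis using hI unfolding P_def I_def by blast
qed

text \<open>A non-integrable product has integral 0 by convention, so \<open>regular\<close> is
  additive only where both products are integrable; hence the two integrability hypotheses.\<close>

lemma represents_fourier_add:
  fixes f1 f2 :: "real^'n \<Rightarrow> complex"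
  assumes "is_fourier f1 h1" "is_fourier f2 h2"
    and "\<And>\<phi>. \<phi> \<in> schwartz \<Longrightarrow> integrable lborel (\<lambda>x. f1 x * fourier \<phi> x)"
    and "\<And>\<phi>. \<phi> \<in> schwartz \<Longrightarrow> integrable lborel (\<lambda>x. f2 x * fourier \<phi> x)"
  shows "is_fourier (\<lambda>x. f1 x + f2 x) (\<lambda>x. h1 x + h2 x)"
  unfolding represents_def
proof (intro conjI ballI)
  have [measurable]: "h1 \<in> borel_measurable borel" "h2 \<in> borel_measurable borel"
    using assms by (auto dest: represents_measurable)
  show "(\<lambda>x. h1 x + h2 x) \<in> borel_measurable lborel" by simp
  fix \<phi> :: "real^'n \<Rightarrow> complex" assume \<phi>: "\<phi> \<in> schwartz"
  note i = represents_integrable[OF assms(1) \<phi>] represents_integrable[OF assms(2) \<phi>]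
  show "integrable lborel (\<lambda>x. (h1 x + h2 x) * \<phi> x)"
    unfolding distrib_right by (intro Bochner_Integration.integrable_add i)
  show "distr_fourier (regular (\<lambda>x. f1 x + f2 x)) \<phi> = regular (\<lambda>x. h1 x + h2 x) \<phi>"
    using represents_eq[OF assms(1) \<phi>] represents_eq[OF assms(2) \<phi>]
    unfolding distr_fourier_def regular_def distrib_right
    by (simp add: Bochner_Integration.integral_add i assms(3,4) \<phi>)
qed

section \<open>Interpolation\<close>

lemma nn_integral_powr_Icc:
  fixes a b :: real
  assumes "a > -1" "b \<ge> 0"
  shows "(\<integral>\<^sup>+x. ennreal (x powr a) * indicator {0..b} x \<partial>lborel) = ennreal (b powr (a + 1) / (a + 1))"
  using assms by (intro nn_integral_has_integral_lebesgue' has_integral_powr_from_0) auto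

lemma emeasure_level_set_le:
  fixes g :: "'a::euclidean_space \<Rightarrow> real" and \<alpha> c :: real
  assumes [measurable]: "g \<in> borel_measurable borel" and g: "\<And>x. g x \<ge> 0" and "\<alpha> > 0"
  shows "emeasure lborel {x. \<alpha> \<le> g x} \<le> ennreal (1 / \<alpha>\<^sup>2) * (\<integral>\<^sup>+x. ennreal ((g x)\<^sup>2) \<partial>lborel)"
proof -
  have "emeasure lborel {x. \<alpha> \<le> g x} = (\<integral>\<^sup>+x. indicator {x. \<alpha> \<le> g x} x \<partial>lborel)"
    by (subst nn_integral_indicator) auto
  also have "\<dots> \<le> (\<integral>\<^sup>+x. ennreal (1 / \<alpha>\<^sup>2) * ennreal ((g x)\<^sup>2) \<partial>lborel)"
  proof (rule nn_integral_mono)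
    fix x
    have "1 \<le> (g x)\<^sup>2 / \<alpha>\<^sup>2" if "\<alpha> \<le> g x"
      using that \<open>\<alpha> > 0\<close> by (simp add: power_mono)
    thus "indicator {x. \<alpha> \<le> g x} x \<le> ennreal (1 / \<alpha>\<^sup>2) * ennreal ((g x)\<^sup>2)"
      by (auto simp: ennreal_mult[symmetric] split: split_indicator)
  qed
  also have "\<dots> = ennreal (1 / \<alpha>\<^sup>2) * (\<integral>\<^sup>+x. ennreal ((g x)\<^sup>2) \<partial>lborel)"
    by (rule nn_integral_cmult) measurable
  finally show ?thesis .
qed

text \<open>Split off y^p: the remaining power has exponent 1 - p \<le> 0 in the first bound and 2 -
  p \<ge> 0 in the second, hence is monotone in the direction required.\<close>

lemma powr_bounds_by_truncation:
  fixes y \<kappa> p :: real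
  assumes "y \<ge> 0" "\<kappa> > 0" "1 \<le> p" "p \<le> 2"
  shows "\<kappa> < y \<Longrightarrow> y \<le> \<kappa> powr (1 - p) * y powr p"
    and "y \<le> \<kappa> \<Longrightarrow> y\<^sup>2 \<le> \<kappa> powr (2 - p) * y powr p"
proof -
  show "y \<le> \<kappa> powr (1 - p) * y powr p" if "\<kappa> < y"
  proof -
    have "y = y powr (1 - p) * y powr p" using that assms by (simp flip: powr_add)
    also have "\<dots> \<le> \<kappa> powr (1 - p) * y powr p"
      using that assms by (intro mult_right_mono powr_mono2') auto
    finally show ?thesis .
  qed
  show "y\<^sup>2 \<le> \<kappa> powr (2 - p) * y powr p" if "y \<le> \<kappa>"
  proof (cases "y = 0")
    case False
    have "y\<^sup>2 = y powr (2 - p) * y powr p" using False assms by (simp flip: powr_add powr_numeral)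
    also have "\<dots> \<le> \<kappa> powr (2 - p) * y powr p"
      using that assms by (intro mult_right_mono powr_mono2) auto
    finally show ?thesis .
  qed simp
qed

text \<open>Above the height \<kappa> the function is integrable, below it square integrable, so
  both parts have transforms. The square integral of the lower part is kept as an integral of the
  truncated \<open>f\<close>, because the interpolation argument integrates it over all heights. The
  lemma also shows that the transform of a function in L^p is a function.\<close>

lemma represents_fourier_truncation:
  fixes f :: "real^'n \<Rightarrow> complex"
  assumes [measurable]: "f \<in> borel_measurable borel"
    and p: "1 \<le> p" "p \<le> 2" and \<kappa>: "\<kappa> > 0" and A: "A \<ge> 0"
    and f: "powr_integral p f \<le> ennreal A"
  obtains h1 h2 where
    "is_fourier f (\<lambda>\<xi>. h1 \<xi> + h2 \<xi>)"
    "h1 \<in> borel_measurable borel" "h2 \<in> borel_measurable borel"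
    "\<And>\<xi>. norm (h1 \<xi>) \<le> \<kappa> powr (1 - p) * A"
    "sq_integral h2 \<le>
      ennreal ((2 * pi) ^ CARD('n)) * (\<integral>\<^sup>+x. ennreal ((norm (f x))\<^sup>2 * indicator {x. norm (f x) \<le> \<kappa>} x) \<partial>lborel)"
proof -
  define f1 where "f1 x = (if norm (f x) \<le> \<kappa> then 0 else f x)" for x
  define f2 where "f2 x = (if norm (f x) \<le> \<kappa> then f x else 0)" for x
  have [measurable]: "f1 \<in> borel_measurable borel" "f2 \<in> borel_measurable borel"
    unfolding f1_def f2_def by measurable
  have b1: "(\<integral>\<^sup>+x. ennreal (norm (f1 x)) \<partial>lborel) \<le> ennreal (\<kappa> powr (1 - p) * A)"
  proof -
    have "(\<integral>\<^sup>+x. ennreal (norm (f1 x)) \<partial>lborel) \<le> (\<integral>\<^sup>+x. ennreal (\<kappa> powr (1 - p)) * ennreal (norm (f x) powr p) \<partial>lborel)"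
      using powr_bounds_by_truncation(1)[where \<kappa>=\<kappa> and p=p, OF norm_ge_zero[of "f _"] \<kappa> p]
      by (intro nn_integral_mono) (auto simp: f1_def ennreal_mult[symmetric] intro!: ennreal_leI)
    also have "\<dots> = ennreal (\<kappa> powr (1 - p)) * powr_integral p f"
      by (rule nn_integral_cmult) measurable
    also have "\<dots> \<le> ennreal (\<kappa> powr (1 - p)) * ennreal A" by (intro mult_left_mono f) simp
    finally show ?thesis using A by (simp add: ennreal_mult)
  qed
  have b2: "sq_integral f2 \<le> ennreal (\<kappa> powr (2 - p) * A)"
  proof -
    have "sq_integral f2 \<le> (\<integral>\<^sup>+x. ennreal (\<kappa> powr (2 - p)) * ennreal (norm (f x) powr p) \<partial>lborel)"
      using powr_bounds_by_truncation(2)[where \<kappa>=\<kappa> and p=p, OF norm_ge_zero[of "f _"] \<kappa> p]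
      by (intro nn_integral_mono) (auto simp: f2_def ennreal_mult[symmetric] intro!: ennreal_leI)
    also have "\<dots> = ennreal (\<kappa> powr (2 - p)) * powr_integral p f"
      by (rule nn_integral_cmult) measurable
    also have "\<dots> \<le> ennreal (\<kappa> powr (2 - p)) * ennreal A" by (intro mult_left_mono f) simp
    finally show ?thesis using A by (simp add: ennreal_mult)
  qed
  have i1: "integrable lborel f1"
    using b1 by (auto simp: integrable_iff_bounded intro: le_less_trans)
  have s2: "sq_integral f2 < \<infinity>"
    using b2 by (auto intro: le_less_trans)
  obtain h2 where h2: "is_fourier f2 h2"
    "sq_integral h2 \<le> ennreal ((2 * pi) ^ CARD('n)) * sq_integral f2"
    using represents_fourier_L2[OF _ s2] by auto
  have "is_fourier (\<lambda>x. f1 x + f2 x) (\<lambda>\<xi>. fourier f1 \<xi> + h2 \<xi>)"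
  proof (rule represents_fourier_add[OF represents_fourier_L1[OF i1] h2(1)])
    fix \<phi> :: "real^'n \<Rightarrow> complex" assume \<phi>: "\<phi> \<in> schwartz"
    note F\<phi> = schwartz_fourier[OF \<phi>]
    have [measurable]: "fourier \<phi> \<in> borel_measurable borel" by (rule schwartz_measurable[OF F\<phi>])
    show "integrable lborel (\<lambda>x. f2 x * fourier \<phi> x)"
      by (rule integrable_mult_square_integrable[OF _ _ s2 schwartz_square_integrable[OF F\<phi>]]) auto
    show "integrable lborel (\<lambda>x. f1 x * fourier \<phi> x)"
    proof (rule Bochner_Integration.integrable_bound)
      show "integrable lborel (\<lambda>x. norm (f1 x) * (LINT x|lborel. norm (\<phi> x)))" using i1 by simp
      show "AE x in lborel. norm (f1 x * fourier \<phi> x) \<le> norm (norm (f1 x) * (LINT x|lborel. norm (\<phi> x)))"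
        using norm_fourier_le[OF schwartz_integrable[OF \<phi>]]
        by (intro AE_I2) (auto simp: norm_mult abs_mult intro!: mult_left_mono order_trans[OF _ abs_ge_self])
    qed measurable
  qed
  also have "(\<lambda>x. f1 x + f2 x) = f" by (auto simp: f1_def f2_def)
  finally have 1: "is_fourier f (\<lambda>\<xi>. fourier f1 \<xi> + h2 \<xi>)" .
  have 2: "norm (fourier f1 \<xi>) \<le> \<kappa> powr (1 - p) * A" for \<xi>
  proof -
    have "ennreal (LINT x|lborel. norm (f1 x)) = (\<integral>\<^sup>+x. ennreal (norm (f1 x)) \<partial>lborel)"
      by (rule nn_integral_eq_integral[symmetric]) (use i1 in auto)
    also note b1
    finally have "(LINT x|lborel. norm (f1 x)) \<le> \<kappa> powr (1 - p) * A"
      using A by (subst (asm) ennreal_le_iff) auto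
    thus ?thesis using norm_fourier_le[OF i1, of \<xi>] by linarith
  qed
  have 3: "sq_integral f2 = (\<integral>\<^sup>+x. ennreal ((norm (f x))\<^sup>2 * indicator {x. norm (f x) \<le> \<kappa>} x) \<partial>lborel)"
    by (intro nn_integral_cong) (auto simp: f2_def split: split_indicator)
  show ?thesis
    by (rule that[OF 1 _ _ 2 h2(2)[unfolded 3]]) (use represents_measurable[OF h2(1)] in auto)
qed

text \<open>Marcinkiewicz interpolation between the endpoints \<open>p = 1\<close> and \<open>p = 2\<close>: at each level \<open>\<alpha>\<close>
  the function is split at the height \<open>\<kappa>\<close> for which the integrable part contributes at most
  \<open>\<alpha> / 2\<close> to the transform.\<close>

lemma hausdorff_young_normalized:
  fixes f h :: "real^'n \<Rightarrow> complex" and p :: real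
  assumes [measurable]: "f \<in> borel_measurable borel"
    and p: "1 < p" "p < 2"
    and f: "powr_integral p f \<le> 1"
    and h: "is_fourier f h"
    and p': "p' = p / (p - 1)"
  shows "powr_integral p' h
    \<le> ennreal (4 * (2 * pi) ^ CARD('n) * p' * 2 powr (p' - 2) / (p' - 2))"
proof -
  define P where "P = (2 * pi) ^ CARD('n)"
  have P: "P > 0" by (simp add: P_def)
  have p'2: "p' > 2" using p unfolding p' by (simp add: field_simps)
  have [measurable]: "h \<in> borel_measurable borel" by (rule represents_measurable[OF h])
  define \<kappa> where "\<kappa> \<alpha> = (\<alpha> / 2) powr (- (1 / (p - 1)))" for \<alpha>
  have level: "emeasure lborel {\<xi>. \<alpha> < norm (h \<xi>)} \<le>
      ennreal (4 * P / \<alpha>\<^sup>2) * (\<integral>\<^sup>+x. ennreal ((norm (f x))\<^sup>2 * indicator {x. norm (f x) \<le> \<kappa> \<alpha>} x) \<partial>lborel)"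
    if \<alpha>: "\<alpha> > 0" for \<alpha>
  proof -
    have \<kappa>0: "\<kappa> \<alpha> > 0" using \<alpha> by (simp add: \<kappa>_def)
    have \<kappa>p: "\<kappa> \<alpha> powr (1 - p) = \<alpha> / 2"
    proof -
      have "- (1 / (p - 1)) * (1 - p) = 1" using p by (simp add: field_simps)
      thus ?thesis using \<alpha> unfolding \<kappa>_def powr_powr by simp
    qed
    obtain h1 h2 where H: "is_fourier f (\<lambda>\<xi>. h1 \<xi> + h2 \<xi>)"
      "h1 \<in> borel_measurable borel" "h2 \<in> borel_measurable borel"
      "\<And>\<xi>. norm (h1 \<xi>) \<le> \<kappa> \<alpha> powr (1 - p) * 1"
      "sq_integral h2 \<le>
        ennreal P * (\<integral>\<^sup>+x. ennreal ((norm (f x))\<^sup>2 * indicator {x. norm (f x) \<le> \<kappa> \<alpha>} x) \<partial>lborel)"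
      unfolding P_def
      by (rule represents_fourier_truncation[of f p "\<kappa> \<alpha>" 1]) (use p f \<kappa>0 in auto)
    note [measurable] = H(2,3)
    \<comment> \<open>If |h| > \<alpha> and |h1| \<le> \<alpha>/2, then |h2| \<ge> \<alpha>/2. The
      splitting depends on \<alpha> and gives \<open>h\<close> only almost everywhere, by
      uniqueness.\<close>
    have "emeasure lborel {\<xi>. \<alpha> < norm (h \<xi>)} \<le> emeasure lborel {\<xi>. \<alpha> / 2 \<le> norm (h2 \<xi>)}"
    proof (rule emeasure_mono_AE)
      show "AE \<xi> in lborel. \<xi> \<in> {\<xi>. \<alpha> < norm (h \<xi>)} \<longrightarrow> \<xi> \<in> {\<xi>. \<alpha> / 2 \<le> norm (h2 \<xi>)}"
        using represents_unique[OF h H(1)]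
      proof eventually_elim
        case (elim \<xi>)
        thus ?case using norm_triangle_ineq[of "h1 \<xi>" "h2 \<xi>"] H(4)[of \<xi>] by (auto simp: \<kappa>p)
      qed
    qed simp
    also have "\<dots> \<le> ennreal (1 / (\<alpha> / 2)\<^sup>2) * sq_integral h2"
      using \<alpha> by (intro emeasure_level_set_le) auto
    also have "\<dots> \<le> ennreal (1 / (\<alpha> / 2)\<^sup>2) *
       (ennreal P * (\<integral>\<^sup>+x. ennreal ((norm (f x))\<^sup>2 * indicator {x. norm (f x) \<le> \<kappa> \<alpha>} x) \<partial>lborel))"
      by (intro mult_left_mono H(5)) simp
    also have "\<dots> = ennreal (4 * P / \<alpha>\<^sup>2) * (\<integral>\<^sup>+x. ennreal ((norm (f x))\<^sup>2 * indicator {x. norm (f x) \<le> \<kappa> \<alpha>} x) \<partial>lborel)"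
      using P by (simp add: mult.assoc[symmetric] ennreal_mult[symmetric] power_divide)
    finally show ?thesis .
  qed
  \<comment> \<open>Layer cake formula: |h|^p' is the integral of p' \<alpha>^(p'-1) over 0 <
    \<alpha> < |h|. The level estimate contributes \<alpha>^(-2), hence the exponent p' - 3
    below.\<close>
  have "powr_integral p' h =
    (\<integral>\<^sup>+\<xi>. \<integral>\<^sup>+\<alpha>. ennreal (p' * \<alpha> powr (p' - 1)) * indicator {0<..} \<alpha> * indicator {\<xi>. \<alpha> < norm (h \<xi>)} \<xi> \<partial>lborel \<partial>lborel)"
  proof (rule nn_integral_cong)
    fix \<xi>
    have "(\<integral>\<^sup>+\<alpha>. ennreal (p' * \<alpha> powr (p' - 1)) * indicator {0<..} \<alpha> * indicator {\<xi>. \<alpha> < norm (h \<xi>)} \<xi> \<partial>lborel) =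
      (\<integral>\<^sup>+\<alpha>. ennreal p' * (ennreal (\<alpha> powr (p' - 1)) * indicator {0..norm (h \<xi>)} \<alpha>) \<partial>lborel)"
    proof (rule nn_integral_cong_AE)
      have "AE \<alpha> in lborel. \<alpha> \<noteq> norm (h \<xi>)" by (rule AE_lborel_singleton)
      thus "AE \<alpha> in lborel. ennreal (p' * \<alpha> powr (p' - 1)) * indicator {0<..} \<alpha> * indicator {\<xi>. \<alpha> < norm (h \<xi>)} \<xi> =
         ennreal p' * (ennreal (\<alpha> powr (p' - 1)) * indicator {0..norm (h \<xi>)} \<alpha>)"
        by eventually_elim (use p'2 in \<open>auto simp: ennreal_mult split: split_indicator\<close>)
    qed
    also have "\<dots> = ennreal p' * ennreal (norm (h \<xi>) powr p' / p')"
      using p'2 nn_integral_powr_Icc[of "p' - 1" "norm (h \<xi>)"] by (simp add: nn_integral_cmult)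
    also have "\<dots> = ennreal (norm (h \<xi>) powr p')" using p'2 by (simp add: ennreal_mult[symmetric])
    finally show "ennreal (norm (h \<xi>) powr p') =
      (\<integral>\<^sup>+\<alpha>. ennreal (p' * \<alpha> powr (p' - 1)) * indicator {0<..} \<alpha> * indicator {\<xi>. \<alpha> < norm (h \<xi>)} \<xi> \<partial>lborel)" by simp
  qed
  also have "\<dots> = (\<integral>\<^sup>+\<alpha>. \<integral>\<^sup>+\<xi>. ennreal (p' * \<alpha> powr (p' - 1)) * indicator {0<..} \<alpha> * indicator {\<xi>. \<alpha> < norm (h \<xi>)} \<xi> \<partial>lborel \<partial>lborel)"
    by (rule lborel_pair.Fubini'[symmetric]) measurable
  also have "\<dots> \<le> (\<integral>\<^sup>+\<alpha>. \<integral>\<^sup>+x. ennreal (4 * P * p' * (norm (f x))\<^sup>2) * (ennreal (\<alpha> powr (p' - 3)) * indicator {0<..} \<alpha> * indicator {x. norm (f x) \<le> \<kappa> \<alpha>} x) \<partial>lborel \<partial>lborel)"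
  proof (rule nn_integral_mono)
    fix \<alpha> :: real
    show "(\<integral>\<^sup>+\<xi>. ennreal (p' * \<alpha> powr (p' - 1)) * indicator {0<..} \<alpha> * indicator {\<xi>. \<alpha> < norm (h \<xi>)} \<xi> \<partial>lborel) \<le>
      (\<integral>\<^sup>+x. ennreal (4 * P * p' * (norm (f x))\<^sup>2) * (ennreal (\<alpha> powr (p' - 3)) * indicator {0<..} \<alpha> * indicator {x. norm (f x) \<le> \<kappa> \<alpha>} x) \<partial>lborel)"
    proof (cases "\<alpha> > 0")
      case True
      have "(\<integral>\<^sup>+\<xi>. ennreal (p' * \<alpha> powr (p' - 1)) * indicator {0<..} \<alpha> * indicator {\<xi>. \<alpha> < norm (h \<xi>)} \<xi> \<partial>lborel) =
         (\<integral>\<^sup>+\<xi>. ennreal (p' * \<alpha> powr (p' - 1)) * indicator {\<xi>. \<alpha> < norm (h \<xi>)} \<xi> \<partial>lborel)"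
        using True by (intro nn_integral_cong) (auto split: split_indicator)
      also have "\<dots> = ennreal (p' * \<alpha> powr (p' - 1)) * emeasure lborel {\<xi>. \<alpha> < norm (h \<xi>)}"
        by (subst nn_integral_cmult_indicator) auto
      also have "\<dots> \<le> ennreal (p' * \<alpha> powr (p' - 1)) * (ennreal (4 * P / \<alpha>\<^sup>2) *
         (\<integral>\<^sup>+x. ennreal ((norm (f x))\<^sup>2 * indicator {x. norm (f x) \<le> \<kappa> \<alpha>} x) \<partial>lborel))"
        by (intro mult_left_mono level True) simp
      also have "\<dots> = ennreal (4 * P * p' * \<alpha> powr (p' - 3)) * (\<integral>\<^sup>+x. ennreal ((norm (f x))\<^sup>2 * indicator {x. norm (f x) \<le> \<kappa> \<alpha>} x) \<partial>lborel)"
      proof -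
        have "\<alpha> powr (p' - 1) = \<alpha> powr (p' - 3) * \<alpha>\<^sup>2"
          using True by (simp flip: powr_add powr_numeral)
        hence "p' * \<alpha> powr (p' - 1) * (4 * P / \<alpha>\<^sup>2) = 4 * P * p' * \<alpha> powr (p' - 3)"
          using True by (simp add: field_simps)
        thus ?thesis
          using p'2 P by (simp add: mult.assoc[symmetric] ennreal_mult[symmetric])
      qed
      also have "\<dots> = (\<integral>\<^sup>+x. ennreal (4 * P * p' * \<alpha> powr (p' - 3)) * ennreal ((norm (f x))\<^sup>2 * indicator {x. norm (f x) \<le> \<kappa> \<alpha>} x) \<partial>lborel)"
        by (rule nn_integral_cmult[symmetric]) measurable
      also have "\<dots> = (\<integral>\<^sup>+x. ennreal (4 * P * p' * (norm (f x))\<^sup>2) * (ennreal (\<alpha> powr (p' - 3)) * indicator {0<..} \<alpha> * indicator {x. norm (f x) \<le> \<kappa> \<alpha>} x) \<partial>lborel)"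
        using True p'2 P by (intro nn_integral_cong) (auto simp: ennreal_mult[symmetric] mult_ac split: split_indicator)
      finally show ?thesis by simp
    qed (auto split: split_indicator)
  qed
  also have "\<dots> = (\<integral>\<^sup>+x. \<integral>\<^sup>+\<alpha>. ennreal (4 * P * p' * (norm (f x))\<^sup>2) * (ennreal (\<alpha> powr (p' - 3)) * indicator {0<..} \<alpha> * indicator {x. norm (f x) \<le> \<kappa> \<alpha>} x) \<partial>lborel \<partial>lborel)"
    unfolding \<kappa>_def by (rule lborel_pair.Fubini'[symmetric]) measurable
  also have "\<dots> \<le> (\<integral>\<^sup>+x. ennreal (4 * P * p' * 2 powr (p' - 2) / (p' - 2)) * ennreal (norm (f x) powr p) \<partial>lborel)"
  proof (rule nn_integral_mono)
    fix x
    define y where "y = norm (f x)"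
    show "(\<integral>\<^sup>+\<alpha>. ennreal (4 * P * p' * (norm (f x))\<^sup>2) * (ennreal (\<alpha> powr (p' - 3)) * indicator {0<..} \<alpha> * indicator {x. norm (f x) \<le> \<kappa> \<alpha>} x) \<partial>lborel)
      \<le> ennreal (4 * P * p' * 2 powr (p' - 2) / (p' - 2)) * ennreal (norm (f x) powr p)"
    proof (cases "f x = 0")
      case True
      thus ?thesis by simp
    next
      case False
      hence y: "y > 0" by (simp add: y_def)
      \<comment> \<open>For fixed \<open>x\<close>, the condition y \<le> \<kappa>(\<alpha>) says
        that \<alpha> \<le> 2 y^(1-p) = b. The integral of \<alpha>^(p'-3) over [0, b] converges
        because p' > 2.\<close>
      define b where "b = 2 * y powr (1 - p)"
      have b: "\<alpha> \<le> b" if "\<alpha> > 0" "y \<le> \<kappa> \<alpha>" for \<alpha>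
      proof -
        have "\<kappa> \<alpha> powr (1 - p) \<le> y powr (1 - p)" using that y p by (intro powr_mono2') auto
        moreover have "- (1 / (p - 1)) * (1 - p) = 1" using p by (simp add: field_simps)
        ultimately show ?thesis using that unfolding \<kappa>_def powr_powr b_def by simp
      qed
      have "(\<integral>\<^sup>+\<alpha>. ennreal (4 * P * p' * (norm (f x))\<^sup>2) * (ennreal (\<alpha> powr (p' - 3)) * indicator {0<..} \<alpha> * indicator {x. norm (f x) \<le> \<kappa> \<alpha>} x) \<partial>lborel)
        \<le> (\<integral>\<^sup>+\<alpha>. ennreal (4 * P * p' * y\<^sup>2) * (ennreal (\<alpha> powr (p' - 3)) * indicator {0..b} \<alpha>) \<partial>lborel)"
        using b by (intro nn_integral_mono mult_left_mono) (auto simp: y_def split: split_indicator)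
      also have "\<dots> = ennreal (4 * P * p' * y\<^sup>2) * ennreal (b powr (p' - 2) / (p' - 2))"
        using nn_integral_powr_Icc[of "p' - 3" b] p'2 by (simp add: nn_integral_cmult b_def)
      also have "\<dots> = ennreal (4 * P * p' * y\<^sup>2 * (b powr (p' - 2) / (p' - 2)))"
        using P p'2 by (simp add: ennreal_mult[symmetric])
      also have "4 * P * p' * y\<^sup>2 * (b powr (p' - 2) / (p' - 2)) = 4 * P * p' * 2 powr (p' - 2) / (p' - 2) * y powr p"
      proof -
        \<comment> \<open>Conjugacy gives p' - 2 = (2 - p)/(p - 1). The powers of \<open>y\<close>
          thus combine to exactly y^p, whose integral is at most 1.\<close>
        have "2 + (1 - p) * (p' - 2) = p" using p unfolding p' by (simp add: field_simps power2_eq_square)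
        hence "y\<^sup>2 * y powr ((1 - p) * (p' - 2)) = y powr p"
          using y by (simp flip: powr_add powr_numeral)
        moreover have "b powr (p' - 2) = 2 powr (p' - 2) * y powr ((1 - p) * (p' - 2))"
          using y by (simp add: b_def powr_mult powr_powr)
        ultimately show ?thesis by (simp add: mult_ac)
      qed
      also have "ennreal (4 * P * p' * 2 powr (p' - 2) / (p' - 2) * y powr p) =
          ennreal (4 * P * p' * 2 powr (p' - 2) / (p' - 2)) * ennreal (norm (f x) powr p)"
        using P p'2 by (subst ennreal_mult) (auto simp: y_def)
      finally show ?thesis .
    qed
  qed
  also have "\<dots> = ennreal (4 * P * p' * 2 powr (p' - 2) / (p' - 2)) * powr_integral p f"
    by (rule nn_integral_cmult) measurable
  also have "\<dots> \<le> ennreal (4 * P * p' * 2 powr (p' - 2) / (p' - 2)) * 1"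
    by (intro mult_left_mono f) simp
  finally show ?thesis by (simp add: P_def)
qed

section \<open>Lebesgue norms\<close>

lemma exponent_finite:
  assumes "1 \<le> p" "p \<noteq> \<infinity>"
  shows "p = ennreal (enn2real p)" "1 \<le> enn2real p" "recip p = 1 / enn2real p" "0 < recip p" "recip p \<le> 1"
proof -
  show p: "p = ennreal (enn2real p)" using assms by (simp add: less_top)
  show 1: "1 \<le> enn2real p" using assms(1) by (subst (asm) p) simp
  show 2: "recip p = 1 / enn2real p"
    unfolding recip_def by (subst p, subst inverse_ennreal) (use 1 in \<open>auto simp: inverse_eq_divide\<close>)
  show "0 < recip p" "recip p \<le> 1" using 1 unfolding 2 by auto
qed

lemma recip_infinity [simp]: "recip \<infinity> = 0" "recip top = 0"
  by (simp_all add: recip_def)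

lemma recip_one [simp]: "recip 1 = 1"
  and recip_two [simp]: "recip 2 = 1 / 2"
  using exponent_finite(3)[of 1] exponent_finite(3)[of 2] by (auto simp: one_le_numeral)

lemma recip_bounds: "1 \<le> p \<Longrightarrow> 0 \<le> recip p \<and> recip p \<le> 1"
  using exponent_finite[of p] by (cases "p = \<infinity>") auto

lemma recip_eq_0_iff: "1 \<le> p \<Longrightarrow> recip p = 0 \<longleftrightarrow> p = \<infinity>"
  using exponent_finite(4)[of p] by (cases "p = \<infinity>") (auto simp del: infinity_ennreal_def)

lemma recip_inj: "1 \<le> p \<Longrightarrow> 1 \<le> q \<Longrightarrow> recip p = recip q \<Longrightarrow> p = q"
proof (cases "p = \<infinity>")
  case True
  assume "1 \<le> p" "1 \<le> q" "recip p = recip q"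
  thus ?thesis using True recip_eq_0_iff[of q] by simp
next
  case False
  assume *: "1 \<le> p" "1 \<le> q" "recip p = recip q"
  hence q: "q \<noteq> \<infinity>" using False recip_eq_0_iff[of p] by auto
  have "enn2real p = enn2real q"
    using *(3) exponent_finite(2,3)[OF *(1) False] exponent_finite(2,3)[OF *(2) q] by simp
  thus ?thesis using exponent_finite(1)[OF *(1) False] exponent_finite(1)[OF *(2) q] by simp
qed

lemma recip_antimono:
  assumes "1 \<le> p" "p \<le> q"
  shows "recip q \<le> recip p"
proof (cases "q = \<infinity>")
  case False
  hence "p \<noteq> \<infinity>" using assms by (auto simp: top_unique)
  have "enn2real p \<le> enn2real q" using assms False by (intro enn2real_mono) (auto simp: less_top)
  thus ?thesis
    using exponent_finite[of p] exponent_finite[of q] assms False \<open>p \<noteq> \<infinity>\<close> by (auto simp: frac_le)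
qed (use recip_bounds assms in auto)

text \<open>Conjugate exponents and the auxiliary exponents in Hoelder's inequality are prescribed
  by linear relations between reciprocals; this supplies them, with infinity as the exponent of
  reciprocal 0.\<close>

lemma exponent_of_recip:
  assumes "0 \<le> x" "x \<le> 1"
  obtains p where "1 \<le> p" "recip p = x"
proof (cases "x = 0")
  case True
  thus ?thesis using that[of \<infinity>] by simp
next
  case False
  have "1 \<le> ennreal (1 / x)" using assms False by (simp add: one_ennreal_def[symmetric] del: one_ennreal_def)
  moreover from this have "recip (ennreal (1 / x)) = x"
    using assms exponent_finite(3)[of "ennreal (1 / x)"] by simp
  ultimately show ?thesis using that by blast
qed

section \<open>Norm estimates and Hoelder's inequality\<close>

lemma Lp_norm_infinity_le_iff:
  assumes [measurable]: "f \<in> borel_measurable borel" and "c \<ge> 0"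
  shows "Lp_norm \<infinity> f \<le> ennreal c \<longleftrightarrow> (AE x in lborel. norm (f x) \<le> c)"
proof
  assume *: "Lp_norm \<infinity> f \<le> ennreal c"
  have "AE x in lborel. ennreal (norm (f x)) \<le> Lp_norm \<infinity> f"
    using esssup_AE[of "\<lambda>x. ennreal (norm (f x))" lborel] by (simp add: Lp_norm_def)
  thus "AE x in lborel. norm (f x) \<le> c"
  proof eventually_elim
    case (elim x)
    from order_trans[OF this *] show ?case using \<open>c \<ge> 0\<close> by simp
  qed
next
  assume "AE x in lborel. norm (f x) \<le> c"
  thus "Lp_norm \<infinity> f \<le> ennreal c"
    unfolding Lp_norm_def by (auto intro!: esssup_I elim!: eventually_mono ennreal_leI)
qed

text \<open>Comparison with a finite bound removes the case distinction from the definition and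
  turns norm estimates into estimates of integrals of powers.\<close>

lemma Lp_norm_finite_le_iff:
  assumes p: "1 \<le> p" "p \<noteq> \<infinity>" and "c \<ge> 0"
  shows "Lp_norm p f \<le> ennreal c \<longleftrightarrow>
    (powr_integral (enn2real p) f) \<le> ennreal (c powr enn2real p)"
proof -
  define P where "P = enn2real p"
  define I where "I = powr_integral P f"
  have P: "P \<ge> 1" "recip p = 1 / P" using exponent_finite[OF p] by (auto simp: P_def)
  have N: "Lp_norm p f = (if I = \<infinity> then \<infinity> else ennreal (enn2real I powr (1 / P)))"
    using p by (simp add: Lp_norm_def P_def[symmetric] I_def[symmetric] P(2) Let_def)
  show ?thesis
  proof (cases "I = \<infinity>")
    case True
    thus ?thesis unfolding N P_def[symmetric] I_def[symmetric] by (simp add: top_unique)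
  next
    case False
    define J where "J = enn2real I"
    have J: "I = ennreal J" "J \<ge> 0" using False by (auto simp: J_def less_top)
    have "J powr (1 / P) \<le> c \<longleftrightarrow> J \<le> c powr P"
    proof
      assume "J powr (1 / P) \<le> c"
      hence "(J powr (1 / P)) powr P \<le> c powr P" using P by (intro powr_mono2) auto
      thus "J \<le> c powr P" using P J by (simp add: powr_powr)
    next
      assume "J \<le> c powr P"
      hence "J powr (1 / P) \<le> (c powr P) powr (1 / P)" using P J by (intro powr_mono2) auto
      thus "J powr (1 / P) \<le> c" using P \<open>c \<ge> 0\<close> by (simp add: powr_powr)
    qed
    moreover have "Lp_norm p f = ennreal (J powr (1 / P))" using False unfolding N J_def by simp
    ultimately show ?thesis
      unfolding P_def[symmetric] I_def[symmetric] using J \<open>c \<ge> 0\<close> by simp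
  qed
qed

lemma Lp_norm_mono_AE:
  assumes [measurable]: "f \<in> borel_measurable borel" "g \<in> borel_measurable borel" and "1 \<le> p"
    and le: "AE x in lborel. norm (f x) \<le> norm (g x)"
  shows "Lp_norm p f \<le> Lp_norm p g"
proof (cases "Lp_norm p g")
  case (real c)
  show ?thesis
  proof (cases "p = \<infinity>")
    case True
    have "AE x in lborel. norm (g x) \<le> c" using real True Lp_norm_infinity_le_iff[of g c] by simp
    hence "AE x in lborel. norm (f x) \<le> c" using le by eventually_elim linarith
    thus ?thesis using real True Lp_norm_infinity_le_iff[of f c] by simp
  next
    case False
    have "powr_integral (enn2real p) f \<le> powr_integral (enn2real p) g"
      using le by (intro nn_integral_mono_AE) (auto elim!: eventually_mono intro!: ennreal_leI powr_mono2)
    thus ?thesis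
      using real Lp_norm_finite_le_iff[OF \<open>1 \<le> p\<close> False, of c f] Lp_norm_finite_le_iff[OF \<open>1 \<le> p\<close> False, of c g]
      by simp
  qed
qed simp

lemma Lp_norm_cong_AE:
  assumes "f \<in> borel_measurable borel" "g \<in> borel_measurable borel" "1 \<le> p"
    and "AE x in lborel. f x = g x"
  shows "Lp_norm p f = Lp_norm p g"
  using assms by (intro antisym Lp_norm_mono_AE) (auto elim: eventually_mono)

lemma Lp_norm_scale_le:
  assumes [measurable]: "f \<in> borel_measurable borel" and "1 \<le> p" and "Lp_norm p f \<le> ennreal c" "c \<ge> 0"
  shows "Lp_norm p (\<lambda>x. a * f x) \<le> ennreal (norm a * c)"
proof (cases "p = \<infinity>")
  case True
  have "AE x in lborel. norm (f x) \<le> c" using assms True Lp_norm_infinity_le_iff[of f c] by simp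
  hence "AE x in lborel. norm (a * f x) \<le> norm a * c"
    by eventually_elim (simp add: norm_mult mult_left_mono)
  thus ?thesis using True assms Lp_norm_infinity_le_iff[of "\<lambda>x. a * f x" "norm a * c"] by simp
next
  case False
  define P where "P = enn2real p"
  have "powr_integral P f \<le> ennreal (c powr P)"
    using Lp_norm_finite_le_iff[OF \<open>1 \<le> p\<close> False, of c f] assms by (simp add: P_def)
  hence "ennreal (norm a powr P) * powr_integral P f \<le> ennreal (norm a powr P) * ennreal (c powr P)"
    by (rule mult_left_mono) simp
  also have "ennreal (norm a powr P) * ennreal (c powr P) = ennreal ((norm a * c) powr P)"
    using assms by (simp add: powr_mult ennreal_mult)
  also have "ennreal (norm a powr P) * powr_integral P f = powr_integral P (\<lambda>x. a * f x)"
    by (subst nn_integral_cmult[symmetric]) (auto simp: norm_mult powr_mult ennreal_mult)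
  finally show ?thesis
    using Lp_norm_finite_le_iff[OF \<open>1 \<le> p\<close> False, of "norm a * c" "\<lambda>x. a * f x"] assms by (simp add: P_def)
qed

lemma Lp_norm_bounded_mult:
  assumes [measurable]: "f \<in> borel_measurable borel" "g \<in> borel_measurable borel"
    and f: "Lp_norm \<infinity> f \<le> ennreal A" and c: "1 \<le> c" and g: "Lp_norm c g \<le> ennreal B" and AB: "A > 0" "B > 0"
  shows "Lp_norm c (\<lambda>x. f x * g x) \<le> ennreal (A * B)"
proof -
  have "AE x in lborel. norm (f x) \<le> A" using f AB Lp_norm_infinity_le_iff[of f A] by simp
  hence "AE x in lborel. norm (f x * g x) \<le> norm (of_real A * g x)"
    by eventually_elim (use AB in \<open>simp add: norm_mult mult_right_mono\<close>)
  hence "Lp_norm c (\<lambda>x. f x * g x) \<le> Lp_norm c (\<lambda>x. of_real A * g x)"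
    by (intro Lp_norm_mono_AE c) auto
  also have "\<dots> \<le> ennreal (A * B)"
    using Lp_norm_scale_le[of g c B "of_real A"] g AB c by simp
  finally show ?thesis .
qed

text \<open>If one exponent is infinite the other two coincide, by injectivity of the reciprocal.
  Otherwise Young's inequality with weights R/P and R/Q, which add up to 1, is applied pointwise to
  the normalised functions f/A and g/B; the normalisation is why A and B are positive.\<close>

lemma Lp_norm_hoelder_pos:
  assumes [measurable]: "f \<in> borel_measurable borel" "g \<in> borel_measurable borel"
    and a: "1 \<le> a" and b: "1 \<le> b" and c: "1 \<le> c" and abc: "recip c = recip a + recip b"
    and f: "Lp_norm a f \<le> ennreal A" and g: "Lp_norm b g \<le> ennreal B" and AB: "A > 0" "B > 0"
  shows "Lp_norm c (\<lambda>x. f x * g x) \<le> ennreal (A * B)"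
proof -
  consider "a = \<infinity>" | "b = \<infinity>" | "a \<noteq> \<infinity>" "b \<noteq> \<infinity>" by blast
  thus ?thesis
  proof cases
    case 1
    hence "recip c = recip b" using abc by simp
    hence cb: "c = b" by (rule recip_inj[OF c b])
    show ?thesis
      by (rule Lp_norm_bounded_mult[OF assms(1,2) f[unfolded 1] c g[folded cb] AB])
  next
    case 2
    hence "recip c = recip a" using abc by simp
    hence ca: "c = a" by (rule recip_inj[OF c a])
    show ?thesis
      using Lp_norm_bounded_mult[OF assms(2,1) g[unfolded 2] c f[folded ca] AB(2,1)]
      by (simp only: mult.commute)
  next
    case 3
    have c': "c \<noteq> \<infinity>" using abc exponent_finite(4)[OF a 3(1)] recip_bounds[OF b] by auto
    define P Q R where "P = enn2real a" and "Q = enn2real b" and "R = enn2real c"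
    have PQR: "P \<ge> 1" "Q \<ge> 1" "R \<ge> 1" "1 / R = 1 / P + 1 / Q"
      using exponent_finite[OF a 3(1)] exponent_finite[OF b 3(2)] exponent_finite[OF c c'] abc
      by (auto simp: P_def Q_def R_def)
    have sum1: "R / P + R / Q = 1"
    proof -
      have "R / P + R / Q = R * (1 / P + 1 / Q)" by (simp add: distrib_left)
      also have "\<dots> = 1" unfolding PQR(4)[symmetric] using PQR(3) by simp
      finally show ?thesis .
    qed
    have If: "powr_integral P f \<le> ennreal (A powr P)"
      using Lp_norm_finite_le_iff[OF a 3(1), of A f] f AB by (simp add: P_def)
    have Ig: "powr_integral Q g \<le> ennreal (B powr Q)"
      using Lp_norm_finite_le_iff[OF b 3(2), of B g] g AB by (simp add: Q_def)
    define K where "K = (A * B) powr R"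
    \<comment> \<open>The weights of Young's inequality with the normalisation undone: after
      integration the two terms contribute K R/P and K R/Q.\<close>
    define cA cB where "cA = K * (R / P * A powr (-P))" and "cB = K * (R / Q * B powr (-Q))"
    have cAB: "cA \<ge> 0" "cB \<ge> 0" using PQR by (auto simp: cA_def cB_def K_def)
    have pt: "norm (f x * g x) powr R \<le> cA * norm (f x) powr P + cB * norm (g x) powr Q" for x
    proof (cases "f x = 0 \<or> g x = 0")
      case True
      thus ?thesis using cAB by auto
    next
      case False
      define u v where "u = norm (f x) / A" and "v = norm (g x) / B"
      have uv: "u > 0" "v > 0" using False AB by (auto simp: u_def v_def)
      have "(u powr P) powr (R / P) * (v powr Q) powr (R / Q) \<le> R / P * u powr P + R / Q * v powr Q"
        using PQR uv sum1 by (intro Youngs_inequality_0) auto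
      hence "(u * v) powr R \<le> R / P * u powr P + R / Q * v powr Q"
        using PQR uv by (simp add: powr_powr powr_mult)
      hence "K * (u * v) powr R \<le> K * (R / P * u powr P + R / Q * v powr Q)"
        by (rule mult_left_mono) (simp add: K_def)
      moreover have "norm (f x * g x) powr R = K * (u * v) powr R"
        using AB uv unfolding K_def by (simp add: u_def v_def norm_mult flip: powr_mult)
      moreover have "u powr P = A powr (-P) * norm (f x) powr P" "v powr Q = B powr (-Q) * norm (g x) powr Q"
        using AB by (simp_all add: u_def v_def powr_divide powr_minus field_simps)
      ultimately show ?thesis by (simp add: cA_def cB_def algebra_simps)
    qed
    have "powr_integral R (\<lambda>x. f x * g x) \<le>
      (\<integral>\<^sup>+x. (ennreal (cA) * ennreal (norm (f x) powr P) + ennreal (cB) * ennreal (norm (g x) powr Q)) \<partial>lborel)"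
    proof (rule nn_integral_mono)
      fix x
      have "ennreal (norm (f x * g x) powr R) \<le> ennreal (cA * norm (f x) powr P + cB * norm (g x) powr Q)"
        by (rule ennreal_leI[OF pt])
      also have "\<dots> = ennreal (cA) * ennreal (norm (f x) powr P) + ennreal (cB) * ennreal (norm (g x) powr Q)"
        using cAB by (simp add: ennreal_mult)
      finally show "ennreal (norm (f x * g x) powr R) \<le> ennreal (cA) * ennreal (norm (f x) powr P) + ennreal (cB) * ennreal (norm (g x) powr Q)" .
    qed
    also have "\<dots> = ennreal (cA) * powr_integral P f + ennreal (cB) * powr_integral Q g"
      by (subst nn_integral_add) (simp_all add: nn_integral_cmult)
    also have "\<dots> \<le> ennreal (cA) * ennreal (A powr P) + ennreal (cB) * ennreal (B powr Q)"
      by (intro add_mono mult_left_mono If Ig) auto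
    also have "\<dots> = ennreal (cA * A powr P + cB * B powr Q)"
      using cAB by (simp add: ennreal_mult)
    also have "cA * A powr P + cB * B powr Q = K * (R / P + R / Q)"
    proof -
      have "A powr (-P) * A powr P = 1" "B powr (-Q) * B powr Q = 1" using AB by (simp_all flip: powr_add)
      thus ?thesis by (simp only: cA_def cB_def mult.assoc distrib_left mult_1_right)
    qed
    also have "\<dots> = (A * B) powr R" by (simp add: sum1 K_def)
    finally have I: "powr_integral R (\<lambda>x. f x * g x) \<le> ennreal ((A * B) powr R)" .
    have "0 \<le> A * B" using AB by simp
    from iffD2[OF Lp_norm_finite_le_iff[OF c c' this] I[unfolded R_def]] show ?thesis .
  qed
qed

text \<open>Extends estimates proved for strictly positive bounds to the bound 0, where
  normalisation by the bound is impossible.\<close>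

lemma ennreal_le_if_le_all_greater:
  fixes x :: ennreal and a b :: real
  assumes "\<And>e. e > 0 \<Longrightarrow> x \<le> ennreal (a * (b + e))" "a > 0"
  shows "x \<le> ennreal (a * b)"
proof (rule ennreal_le_epsilon)
  fix e :: real assume e: "e > 0"
  have "x \<le> ennreal (a * (b + e / a))" using assms e by simp
  also have "a * (b + e / a) = a * b + e" using assms by (simp add: field_simps)
  also have "ennreal (a * b + e) \<le> ennreal (a * b) + ennreal e" using e
    by (cases "a * b \<ge> 0") (auto simp: ennreal_neg intro!: ennreal_leI)
  finally show "x \<le> ennreal (a * b) + ennreal e" .
qed

text \<open>As A > 0, an infinite norm of \<open>g\<close> makes the right-hand side infinite. A
  finite one, possibly 0, is approached from above by positive bounds.\<close>

lemma Lp_norm_hoelder: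
  assumes "f \<in> borel_measurable borel" "g \<in> borel_measurable borel"
    and "1 \<le> a" "1 \<le> b" "1 \<le> c" "recip c = recip a + recip b"
    and "Lp_norm a f \<le> ennreal A" "A > 0"
  shows "Lp_norm c (\<lambda>x. f x * g x) \<le> ennreal A * Lp_norm b g"
proof (cases "Lp_norm b g")
  case (real B)
  have "Lp_norm c (\<lambda>x. f x * g x) \<le> ennreal (A * B)"
  proof (rule ennreal_le_if_le_all_greater)
    fix e :: real assume e: "e > 0"
    show "Lp_norm c (\<lambda>x. f x * g x) \<le> ennreal (A * (B + e))"
      using assms real e by (intro Lp_norm_hoelder_pos[where a=a and b=b]) (auto intro!: ennreal_leI)
  qed (use assms in auto)
  thus ?thesis using real assms by (simp add: ennreal_mult)
qed (use assms in \<open>simp add: ennreal_mult_top\<close>)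

text \<open>In place of Minkowski's inequality: |f + g| is at most twice the larger of |f| and |g|,
  whose P-th power is at most the sum of the P-th powers. The factor 2 is absorbed in
  constants.\<close>

lemma Lp_norm_add_le:
  assumes [measurable]: "f \<in> borel_measurable borel" "g \<in> borel_measurable borel" and p: "1 \<le> p"
  shows "Lp_norm p (\<lambda>x. f x + g x) \<le> 2 * (Lp_norm p f + Lp_norm p g)"
proof (cases "Lp_norm p f"; cases "Lp_norm p g")
  fix a b assume a: "0 \<le> a" "Lp_norm p f = ennreal a" and b: "0 \<le> b" "Lp_norm p g = ennreal b"
  have "Lp_norm p (\<lambda>x. f x + g x) \<le> ennreal (2 * (a + b))"
  proof (cases "p = \<infinity>")
    case True
    have "AE x in lborel. norm (f x) \<le> a" "AE x in lborel. norm (g x) \<le> b"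
      using a b True Lp_norm_infinity_le_iff[of f a] Lp_norm_infinity_le_iff[of g b] by auto
    hence "AE x in lborel. norm (f x + g x) \<le> 2 * (a + b)"
    proof eventually_elim
      case (elim x)
      thus ?case using a(1) b(1) norm_triangle_ineq[of "f x" "g x"] by argo
    qed
    thus ?thesis using True a b Lp_norm_infinity_le_iff[of "\<lambda>x. f x + g x" "2 * (a + b)"] by simp
  next
    case False
    define P where "P = enn2real p"
    have P: "P \<ge> 1" using exponent_finite[OF p False] by (simp add: P_def)
    have If: "powr_integral P f \<le> ennreal (a powr P)"
      using Lp_norm_finite_le_iff[OF p False, of a f] a by (simp add: P_def)
    have Ig: "powr_integral P g \<le> ennreal (b powr P)"
      using Lp_norm_finite_le_iff[OF p False, of b g] b by (simp add: P_def)
    have pt: "norm (f x + g x) powr P \<le> 2 powr P * (norm (f x) powr P + norm (g x) powr P)" for x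
    proof -
      define M where "M = max (norm (f x)) (norm (g x))"
      have "norm (f x + g x) \<le> 2 * M"
        using norm_triangle_ineq[of "f x" "g x"] by (simp add: M_def)
      hence "norm (f x + g x) powr P \<le> (2 * M) powr P" using P by (intro powr_mono2) auto
      also have "\<dots> = 2 powr P * M powr P" by (simp add: powr_mult M_def)
      also have "M powr P \<le> norm (f x) powr P + norm (g x) powr P"
        by (auto simp: M_def max_def)
      finally show ?thesis by simp
    qed
    have "powr_integral P (\<lambda>x. f x + g x) \<le>
      (\<integral>\<^sup>+x. ennreal (2 powr P) * (ennreal (norm (f x) powr P) + ennreal (norm (g x) powr P)) \<partial>lborel)"
      using pt by (intro nn_integral_mono) (auto simp: ennreal_mult[symmetric] ennreal_plus[symmetric] simp del: ennreal_plus intro!: ennreal_leI)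
    also have "\<dots> = ennreal (2 powr P) * (powr_integral P f + powr_integral P g)"
      by (subst nn_integral_cmult) (auto simp: nn_integral_add)
    also have "\<dots> \<le> ennreal (2 powr P) * (ennreal (a powr P) + ennreal (b powr P))"
      by (intro mult_left_mono add_mono If Ig) auto
    also have "\<dots> = ennreal (2 powr P * (a powr P + b powr P))"
      by (simp add: ennreal_mult[symmetric] ennreal_plus[symmetric] del: ennreal_plus)
    also have "\<dots> \<le> ennreal ((2 * (a + b)) powr P)"
    proof (rule ennreal_leI)
      \<comment> \<open>Superadditivity of the P-th power on the nonnegative reals, from P \<ge> 1;
        it returns from the sum of the powers to the power of the sum.\<close>
      have "a powr P + b powr P \<le> (a + b) powr P"
      proof (cases "a + b = 0")
        case True
        hence "a = 0" "b = 0" using a(1) b(1) by linarith+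
        thus ?thesis by simp
      next
        case False
        hence s: "a + b > 0" using a b by simp
        have "a powr P = a powr 1 * a powr (P - 1)" by (simp only: powr_add[symmetric]) simp
        also have "\<dots> \<le> a * (a + b) powr (P - 1)"
          using a b P by (simp add: mult_left_mono powr_mono2)
        finally have 1: "a powr P \<le> a * (a + b) powr (P - 1)" .
        have "b powr P = b powr 1 * b powr (P - 1)" by (simp only: powr_add[symmetric]) simp
        also have "\<dots> \<le> b * (a + b) powr (P - 1)"
          using a b P by (simp add: mult_left_mono powr_mono2)
        finally have 2: "b powr P \<le> b * (a + b) powr (P - 1)" .
        have "(a + b) powr P = (a + b) powr 1 * (a + b) powr (P - 1)" by (simp only: powr_add[symmetric]) simp
        thus ?thesis using 1 2 s by (simp add: distrib_right)
      qed
      thus "2 powr P * (a powr P + b powr P) \<le> (2 * (a + b)) powr P"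
        using a(1) b(1) by (subst powr_mult) auto
    qed
    finally show ?thesis
      using Lp_norm_finite_le_iff[OF p False, of "2 * (a + b)" "\<lambda>x. f x + g x"] a b by (simp add: P_def)
  qed
  thus ?thesis using a b by (simp add: ennreal_mult distrib_left)
qed (auto simp: ennreal_mult_top)

lemma Lp_norm_zero: "1 \<le> p \<Longrightarrow> Lp_norm p (\<lambda>x. 0) = 0"
  using Lp_norm_infinity_le_iff[of "\<lambda>x. 0" 0] Lp_norm_finite_le_iff[of p 0 "\<lambda>x. 0"]
  by (cases "p = \<infinity>") auto

lemma Lp_norm_sum_le:
  assumes "finite S" "\<And>i. i \<in> S \<Longrightarrow> f i \<in> borel_measurable borel" and p: "1 \<le> p"
  shows "Lp_norm p (\<lambda>x. \<Sum>i\<in>S. f i x) \<le> 2 ^ card S * (\<Sum>i\<in>S. Lp_norm p (f i))"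
  using assms(1,2)
proof (induction S rule: finite_induct)
  case empty
  thus ?case using Lp_norm_zero[OF p] by simp
next
  case (insert i S)
  have "Lp_norm p (\<lambda>x. f i x + (\<Sum>i\<in>S. f i x)) \<le> 2 * (Lp_norm p (f i) + Lp_norm p (\<lambda>x. \<Sum>i\<in>S. f i x))"
    using insert.prems by (intro Lp_norm_add_le p) auto
  also have "\<dots> \<le> 2 * (2 ^ card S * Lp_norm p (f i) + 2 ^ card S * (\<Sum>i\<in>S. Lp_norm p (f i)))"
  proof (intro mult_left_mono add_mono insert.IH)
    have "1 * Lp_norm p (f i) \<le> 2 ^ card S * Lp_norm p (f i)"
      by (intro mult_right_mono one_le_power) auto
    thus "Lp_norm p (f i) \<le> 2 ^ card S * Lp_norm p (f i)" by simp
  qed (use insert.prems in auto)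
  finally show ?case using insert.hyps by (simp add: distrib_left mult.assoc)
qed

section \<open>The Hausdorff--Young inequality\<close>

lemma represents_cong:
  assumes "represents f T" "\<And>\<phi>. \<phi> \<in> schwartz \<Longrightarrow> T \<phi> = T' \<phi>"
  shows "represents f T'"
  using assms unfolding represents_def by auto

lemma represents_fourier_scale:
  assumes h: "is_fourier f h"
  shows "is_fourier (\<lambda>x. c * f x) (\<lambda>x. c * h x)"
proof -
  have [measurable]: "h \<in> borel_measurable borel" by (rule represents_measurable[OF h])
  have "integrable lborel (\<lambda>x. c * h x * \<phi> x)" if "\<phi> \<in> schwartz" for \<phi>
    using integrable_mult_right[OF represents_integrable[OF h that], of c] by (simp add: mult.assoc)
  moreover have "(LINT x|lborel. c * f x * fourier \<phi> x) = (LINT x|lborel. c * h x * \<phi> x)" if "\<phi> \<in> schwartz" for \<phi>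
    using represents_eq[OF h that] by (simp add: mult.assoc distr_fourier_def regular_def)
  ultimately show ?thesis by (simp add: represents_def distr_fourier_def regular_def)
qed

lemma Lp_norm_le_scaledD:
  assumes [measurable]: "h \<in> borel_measurable borel" and p: "1 \<le> p" and A: "A > 0" and C: "C \<ge> 0"
    and "Lp_norm p (\<lambda>x. of_real (1 / A) * h x) \<le> ennreal C"
  shows "Lp_norm p h \<le> ennreal (C * A)"
proof -
  have "Lp_norm p (\<lambda>x. of_real A * (of_real (1 / A) * h x)) \<le> ennreal (norm (of_real A :: complex) * C)"
    by (rule Lp_norm_scale_le) (use assms in auto)
  thus ?thesis using A by (simp add: mult.commute)
qed

text \<open>The interpolated constant has p' - 2 in its denominator and is unbounded as p tends to
  2, so both endpoints are treated separately. In between, scaling reduces the estimate to functions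
  of norm at most 1.\<close>

lemma hausdorff_young:
  fixes p p' :: ennreal
  assumes p: "1 \<le> p" "p \<le> 2" and p': "1 \<le> p'" and pp': "recip p + recip p' = 1"
  shows "\<exists>C>0. \<forall>f :: real^'n \<Rightarrow> complex. \<forall>A\<ge>0. f \<in> borel_measurable borel \<and> Lp_norm p f \<le> ennreal A \<longrightarrow>
    (\<exists>h. is_fourier f h \<and> Lp_norm p' h \<le> ennreal (C * A))"
proof -
  define P where "P = enn2real p"
  have pfin: "p \<noteq> \<infinity>" using p by (auto simp: top_unique)
  have P: "p = ennreal P" "1 \<le> P" "recip p = 1 / P" using exponent_finite[OF p(1) pfin] by (auto simp: P_def)
  have P2: "P \<le> 2" using p(2) P(2) by (subst (asm) P(1)) (simp flip: ennreal_numeral)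
  have iff: "Lp_norm p f \<le> ennreal A \<longleftrightarrow> (powr_integral P f) \<le> ennreal (A powr P)"
    if "A \<ge> 0" for f :: "real^'n \<Rightarrow> complex" and A
    using Lp_norm_finite_le_iff[OF p(1) pfin that, of f] by (simp add: P_def)
  consider "P = 1" | "P = 2" | "1 < P" "P < 2" using P(2) P2 by linarith
  thus ?thesis
  proof cases
    case 1
    have "recip p' = 0" using pp' P 1 by simp
    hence p'i: "p' = \<infinity>" using recip_eq_0_iff[OF p'] by simp
    show ?thesis
    proof (intro exI[of _ 1] conjI allI impI)
      fix f :: "real^'n \<Rightarrow> complex" and A :: real
      assume A: "0 \<le> A" and f: "f \<in> borel_measurable borel \<and> Lp_norm p f \<le> ennreal A"
      hence [measurable]: "f \<in> borel_measurable borel" by simp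
      have n: "(\<integral>\<^sup>+x. ennreal (norm (f x)) \<partial>lborel) \<le> ennreal A"
        using f iff[OF A, of f] 1 A by simp
      hence i: "integrable lborel f"
        by (auto simp: integrable_iff_bounded intro: le_less_trans)
      have "ennreal (LINT x|lborel. norm (f x)) \<le> ennreal A"
        using n nn_integral_eq_integral[of lborel "\<lambda>x. norm (f x)"] i by simp
      hence "(LINT x|lborel. norm (f x)) \<le> A" using A by simp
      hence "norm (fourier f \<xi>) \<le> A" for \<xi> using norm_fourier_le[OF i, of \<xi>] by linarith
      hence "Lp_norm p' (fourier f) \<le> ennreal A"
        unfolding p'i by (subst Lp_norm_infinity_le_iff) (use A in auto)
      thus "\<exists>h. is_fourier f h \<and> Lp_norm p' h \<le> ennreal (1 * A)"
        using represents_fourier_L1[OF i] by auto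
    qed simp
  next
    case 2
    have p2: "p = 2" using P(1) 2 by simp
    have p'2: "p' = 2" using pp' P 2 by (intro recip_inj p') (auto simp: one_le_numeral)
    define C where "C = sqrt ((2 * pi) ^ CARD('n))"
    have C: "C > 0" "C\<^sup>2 = (2 * pi) ^ CARD('n)" by (auto simp: C_def)
    show ?thesis
    proof (intro exI[of _ C] conjI allI impI)
      fix f :: "real^'n \<Rightarrow> complex" and A :: real
      assume A: "0 \<le> A" and f: "f \<in> borel_measurable borel \<and> Lp_norm p f \<le> ennreal A"
      hence [measurable]: "f \<in> borel_measurable borel" by simp
      have sq: "norm z powr 2 = (norm z)\<^sup>2" for z :: complex by (cases "z = 0") auto
      have A2: "a powr 2 = a\<^sup>2" if "a \<ge> 0" for a :: real using that by (cases "a = 0") auto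
      have n: "sq_integral f \<le> ennreal (A\<^sup>2)"
        using f iff[OF A, of f] 2 A by (simp add: sq A2)
      obtain h where h: "is_fourier f h"
        "sq_integral h \<le> ennreal ((2 * pi) ^ CARD('n)) * sq_integral f"
        using represents_fourier_L2[of f] le_less_trans[OF n] by auto
      note h(2)
      also have "ennreal ((2 * pi) ^ CARD('n)) * sq_integral f \<le> ennreal ((2 * pi) ^ CARD('n)) * ennreal (A\<^sup>2)"
        by (intro mult_left_mono n) simp
      also have "\<dots> = ennreal ((C * A)\<^sup>2)"
        unfolding C(2)[symmetric] by (simp add: power_mult_distrib ennreal_mult)
      finally have "Lp_norm p h \<le> ennreal (C * A)"
        using C A by (subst iff) (auto simp: sq A2 2)
      thus "\<exists>h. is_fourier f h \<and> Lp_norm p' h \<le> ennreal (C * A)"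
        using h(1) p2 p'2 by auto
    qed (rule C)
  next
    case 3
    define Q where "Q = P / (P - 1)"
    have Q: "Q > 2" "1 / Q = 1 - 1 / P" using 3 unfolding Q_def by (auto simp: field_simps)
    have p'fin: "p' \<noteq> \<infinity>" using pp' P 3 by auto
    have "1 / enn2real p' = 1 / Q"
      using exponent_finite(3)[OF p' p'fin] pp' P(3) Q(2) by simp
    hence Qp': "enn2real p' = Q"
      by (simp only: divide_inverse mult_1_left inverse_eq_iff_eq)
    define K where "K = 4 * (2 * pi) ^ CARD('n) * Q * 2 powr (Q - 2) / (Q - 2)"
    have K: "K > 0" using Q by (simp add: K_def)
    define C where "C = K powr (1 / Q)"
    have C: "C > 0" "C powr Q = K" using K Q(1) by (auto simp: C_def powr_powr)
    show ?thesis
    proof (intro exI[of _ C] conjI allI impI)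
      fix f :: "real^'n \<Rightarrow> complex" and A :: real
      assume A: "0 \<le> A" and f: "f \<in> borel_measurable borel \<and> Lp_norm p f \<le> ennreal A"
      hence [measurable]: "f \<in> borel_measurable borel" by simp
      have n: "powr_integral P f \<le> ennreal (A powr P)"
        using f iff[OF A, of f] by simp
      \<comment> \<open>Only the existence of the transform is taken from the splitting, so any
        height will do; here it is 1.\<close>
      obtain h where h: "is_fourier f h"
        using represents_fourier_truncation[of f P 1 "A powr P"] n P(2) P2 by auto
      have [measurable]: "h \<in> borel_measurable borel" by (rule represents_measurable[OF h])
      \<comment> \<open>Division by the bound requires it to be positive. The case A = 0 is
        recovered by letting B decrease to A.\<close>
      have bound: "Lp_norm p' h \<le> ennreal (C * B)" if B: "B > 0" "A \<le> B" for B
      proof (rule Lp_norm_le_scaledD)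
        have "Lp_norm p (\<lambda>x. of_real (1 / B) * f x) \<le> ennreal (norm (of_real (1 / B) :: complex) * B)"
          using order_trans[OF conjunct2[OF f] ennreal_leI[OF B(2)]] B
          by (intro Lp_norm_scale_le p) auto
        also have "norm (of_real (1 / B) :: complex) * B = 1" using B by (simp only: norm_of_real) simp
        finally have "Lp_norm p (\<lambda>x. of_real (1 / B) * f x) \<le> ennreal 1" .
        hence "powr_integral P (\<lambda>x. of_real (1 / B) * f x) \<le> 1"
          by (subst (asm) iff) auto
        hence "powr_integral Q (\<lambda>\<xi>. of_real (1 / B) * h \<xi>) \<le> ennreal K"
          unfolding K_def by (intro hausdorff_young_normalized[OF _ 3 _ represents_fourier_scale[OF h] Q_def]) auto
        thus "Lp_norm p' (\<lambda>x. of_real (1 / B) * h x) \<le> ennreal C"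
          using C Lp_norm_finite_le_iff[OF p' p'fin, of C "\<lambda>x. of_real (1 / B) * h x"] by (simp add: Qp')
      qed (use B C p' in auto)
      have "Lp_norm p' h \<le> ennreal (C * A)"
        by (rule ennreal_le_if_le_all_greater) (use C A bound in auto)
      thus "\<exists>h. is_fourier f h \<and> Lp_norm p' h \<le> ennreal (C * A)"
        using h by auto
    qed (rule C)
  qed
qed

text \<open>The inverse transform of \<open>g\<close> is the transform of the reflection of
  \<open>g\<close> divided by (2\<pi>)^n, and reflection preserves the norm.\<close>

lemma hausdorff_young_inverse:
  fixes p p' :: ennreal
  assumes p: "1 \<le> p" "p \<le> 2" and p': "1 \<le> p'" and pp': "recip p + recip p' = 1"
  shows "\<exists>C>0. \<forall>g :: real^'n \<Rightarrow> complex. \<forall>A\<ge>0. g \<in> borel_measurable borel \<and> Lp_norm p g \<le> ennreal A \<longrightarrow>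
    distr_norm p' (distr_inv_fourier (regular g)) \<le> ennreal (C * A)"
proof -
  obtain C where C: "C > 0" and HY: "\<And>f :: real^'n \<Rightarrow> complex. \<And>A. A \<ge> 0 \<Longrightarrow> f \<in> borel_measurable borel \<Longrightarrow> Lp_norm p f \<le> ennreal A \<Longrightarrow>
    \<exists>h. is_fourier f h \<and> Lp_norm p' h \<le> ennreal (C * A)"
    using hausdorff_young[OF assms, where 'n='n] by blast
  have pfin: "p \<noteq> \<infinity>" using p by (auto simp: top_unique)
  define c where "c = 1 / (2 * pi) ^ CARD('n)"
  have c: "c > 0" by (simp add: c_def)
  show ?thesis
  proof (intro exI[of _ "C * c"] conjI allI impI)
    show "C * c > 0" using C c by simp
    fix g :: "real^'n \<Rightarrow> complex" and A :: real
    assume A: "0 \<le> A" and g: "g \<in> borel_measurable borel \<and> Lp_norm p g \<le> ennreal A"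
    hence [measurable]: "g \<in> borel_measurable borel" by simp
    define f where "f x = of_real c * g (- x)" for x
    have [measurable]: "f \<in> borel_measurable borel" unfolding f_def by measurable
    have "Lp_norm p (\<lambda>x. g (- x)) \<le> ennreal A"
      using g nn_integral_lborel_affine_euclidean[of "\<lambda>x. ennreal (norm (g x) powr enn2real p)" "-1" 0]
        Lp_norm_finite_le_iff[OF p(1) pfin A, of g] Lp_norm_finite_le_iff[OF p(1) pfin A, of "\<lambda>x. g (- x)"]
      by simp
    hence "Lp_norm p f \<le> ennreal (norm (of_real c :: complex) * A)"
      unfolding f_def using A by (intro Lp_norm_scale_le p) auto
    hence "Lp_norm p f \<le> ennreal (c * A)" using c by simp
    then obtain h where h: "is_fourier f h" "Lp_norm p' h \<le> ennreal (C * (c * A))"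
      using HY[of "c * A" f] c A by auto
    have "represents h (distr_inv_fourier (regular g))"
    proof (rule represents_cong[OF h(1)])
      fix \<phi> :: "real^'n \<Rightarrow> complex" assume \<phi>: "\<phi> \<in> schwartz"
      have [measurable]: "\<phi> \<in> borel_measurable borel" by (rule schwartz_measurable[OF \<phi>])
      have "(LINT x|lborel. f x * fourier \<phi> x) = (LINT x|lborel. f (0 + (-1) *\<^sub>R x) * fourier \<phi> (0 + (-1) *\<^sub>R x))"
        by (subst lborel_integral_affine_euclidean[of _ "-1" 0]) auto
      also have "\<dots> = (LINT x|lborel. g x * inv_fourier \<phi> x)"
        by (simp add: f_def inv_fourier_eq c_def mult_ac)
      finally show "distr_fourier (regular f) \<phi> = distr_inv_fourier (regular g) \<phi>"
        by (simp add: distr_fourier_def distr_inv_fourier_def regular_def)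
    qed
    hence "distr_norm p' (distr_inv_fourier (regular g)) \<le> Lp_norm p' h"
      unfolding distr_norm_def by (intro INF_lower) simp
    also note h(2)
    finally show "distr_norm p' (distr_inv_fourier (regular g)) \<le> ennreal (C * c * A)" by (simp add: mult.assoc)
  qed
qed

section \<open>Derivatives and the chosen Fourier transform\<close>

definition deriv_symbol :: "'n::finite list \<Rightarrow> real^'n \<Rightarrow> complex" where
  "deriv_symbol is \<xi> = (\<Prod>j\<leftarrow>is. \<i> * of_real (\<xi> $ j))"

lemma deriv_symbol_Nil [simp]: "deriv_symbol [] \<xi> = 1"
  and deriv_symbol_Cons: "deriv_symbol (i # is) \<xi> = \<i> * of_real (\<xi> $ i) * deriv_symbol is \<xi>"
  by (simp_all add: deriv_symbol_def)

lemma deriv_symbol_measurable [measurable]: "deriv_symbol is \<in> borel_measurable borel"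
  by (induction "is") (simp_all add: deriv_symbol_Cons[abs_def])

lemma norm_deriv_symbol_le: "norm (deriv_symbol is \<xi>) \<le> norm \<xi> ^ length is"
  by (induction "is") (auto simp: deriv_symbol_Cons norm_mult component_le_norm_cart intro!: mult_mono)

lemma norm_deriv_symbol_replicate: "norm (deriv_symbol (replicate k i) \<xi>) = \<bar>\<xi> $ i\<bar> ^ k"
  by (induction k) (auto simp: deriv_symbol_Cons norm_mult)

lemma represents_fourier_fun:
  fixes u :: "real^'n \<Rightarrow> complex"
  assumes p: "1 \<le> p" "p \<le> 2" and u: "u \<in> Lp_space p"
  shows "is_fourier u (fourier_fun u)"
proof -
  obtain p' where p': "1 \<le> p'" "recip p' = 1 - recip p"
    using exponent_of_recip[of "1 - recip p"] recip_bounds[OF p(1)] by auto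
  obtain A where "Lp_norm p u = ennreal A" "A \<ge> 0"
    using u by (cases "Lp_norm p u") (auto simp: Lp_space_def)
  hence "\<exists>h. is_fourier u h"
    using hausdorff_young[OF p p'(1), where 'n='n] p'(2) u by (force simp: Lp_space_def)
  thus ?thesis unfolding fourier_fun_def by (rule someI_ex)
qed

text \<open>Hausdorff-Young bounds some representing function; uniqueness almost everywhere
  transfers the bound to the chosen one.\<close>

lemma fourier_fun_norm_le:
  fixes p p' :: ennreal
  assumes p: "1 \<le> p" "p \<le> 2" and p': "1 \<le> p'" and pp': "recip p + recip p' = 1"
  shows "\<exists>C>0. \<forall>u :: real^'n \<Rightarrow> complex. u \<in> Lp_space p \<longrightarrow> Lp_norm p' (fourier_fun u) \<le> ennreal C * Lp_norm p u"
proof -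
  obtain C where C: "C > 0" and HY: "\<And>f :: real^'n \<Rightarrow> complex. \<And>A. A \<ge> 0 \<Longrightarrow> f \<in> borel_measurable borel \<Longrightarrow> Lp_norm p f \<le> ennreal A \<Longrightarrow>
    \<exists>h. is_fourier f h \<and> Lp_norm p' h \<le> ennreal (C * A)"
    using hausdorff_young[OF assms, where 'n='n] by blast
  show ?thesis
  proof (intro exI[of _ C] conjI allI impI C)
    fix u :: "real^'n \<Rightarrow> complex" assume u: "u \<in> Lp_space p"
    obtain A where A: "Lp_norm p u = ennreal A" "A \<ge> 0"
      using u by (cases "Lp_norm p u") (auto simp: Lp_space_def)
    obtain h where h: "is_fourier u h" "Lp_norm p' h \<le> ennreal (C * A)"
      using HY[of A u] A u by (auto simp: Lp_space_def)
    note f = represents_fourier_fun[OF p u]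
    have "Lp_norm p' (fourier_fun u) = Lp_norm p' h"
      by (intro Lp_norm_cong_AE represents_unique[OF f h(1)] p' represents_measurable[OF f] represents_measurable[OF h(1)])
    thus "Lp_norm p' (fourier_fun u) \<le> ennreal C * Lp_norm p u"
      using h(2) A C by (simp add: ennreal_mult)
  qed
qed

text \<open>The symbol is a polynomial, so it can be absorbed into the test function, which remains
  a Schwartz function. The sign from moving the derivatives onto the test function cancels against
  the one from differentiating its transform.\<close>

lemma represents_fourier_deriv:
  fixes u f g :: "real^'n \<Rightarrow> complex"
  assumes g: "is_fourier u g"
    and f: "represents f (distr_iter_deriv is (regular u))"
  shows "is_fourier f (\<lambda>\<xi>. deriv_symbol is \<xi> * g \<xi>)"
proof -
  have [measurable]: "g \<in> borel_measurable borel" by (rule represents_measurable[OF g])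
  have "integrable lborel (\<lambda>\<xi>. deriv_symbol is \<xi> * g \<xi> * \<phi> \<xi>)"
    and "distr_fourier (regular f) \<phi> = regular (\<lambda>\<xi>. deriv_symbol is \<xi> * g \<xi>) \<phi>" if \<phi>: "\<phi> \<in> schwartz" for \<phi> :: "real^'n \<Rightarrow> complex"
  proof -
    define \<psi> where "\<psi> x = deriv_symbol is x * \<phi> x" for x
    have \<psi>: "\<psi> \<in> schwartz" unfolding \<psi>_def deriv_symbol_def by (rule schwartz_monomial_mult[OF \<phi>])
    have eq: "(\<lambda>\<xi>. deriv_symbol is \<xi> * g \<xi> * \<phi> \<xi>) = (\<lambda>\<xi>. g \<xi> * \<psi> \<xi>)" by (simp add: \<psi>_def mult_ac)
    show "integrable lborel (\<lambda>\<xi>. deriv_symbol is \<xi> * g \<xi> * \<phi> \<xi>)"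
      unfolding eq by (rule represents_integrable[OF g \<psi>])
    have it: "iter_deriv (rev is) (fourier \<phi>) = (\<lambda>\<xi>. (-1) ^ length is * fourier \<psi> \<xi>)"
    proof -
      have "(\<Prod>j\<leftarrow>rev is. - \<i> * of_real (x $ j)) = (-1) ^ length is * deriv_symbol is x" for x :: "real^'n"
      proof -
        have "(\<Prod>j\<leftarrow>rev is. - \<i> * of_real (x $ j)) = (\<Prod>j\<leftarrow>is. - (\<i> * of_real (x $ j)))"
          unfolding rev_map[symmetric] prod_list_rev by simp
        thus ?thesis unfolding prod_list_map_uminus deriv_symbol_def .
      qed
      hence "iter_deriv (rev is) (fourier \<phi>) = fourier (\<lambda>x. (-1) ^ length is * \<psi> x)"
        unfolding iter_deriv_fourier[OF \<phi>] by (simp add: \<psi>_def mult_ac)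
      also have "\<dots> = (\<lambda>\<xi>. (-1) ^ length is * fourier \<psi> \<xi>)"
        unfolding fourier_def by (subst integral_mult_right_zero[symmetric]) (simp add: mult_ac)
      finally show ?thesis .
    qed
    have "distr_fourier (regular f) \<phi> = distr_iter_deriv is (regular u) (fourier \<phi>)"
      using represents_eq[OF f schwartz_fourier[OF \<phi>]] by (simp add: distr_fourier_def regular_def)
    also have "\<dots> = (-1) ^ length is * regular u (iter_deriv (rev is) (fourier \<phi>))"
      by (rule distr_iter_deriv_eq)
    also have "\<dots> = (-1) ^ length is * ((-1) ^ length is * regular u (fourier \<psi>))"
      unfolding it regular_def by (subst integral_mult_right_zero[symmetric]) (simp add: mult_ac)
    also have "\<dots> = distr_fourier (regular u) \<psi>"
      by (simp add: distr_fourier_def mult.assoc[symmetric] power_mult_distrib[symmetric])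
    also have "\<dots> = regular (\<lambda>\<xi>. deriv_symbol is \<xi> * g \<xi>) \<phi>"
      using represents_eq[OF g \<psi>] by (simp add: regular_def eq)
    finally show "distr_fourier (regular f) \<phi> = regular (\<lambda>\<xi>. deriv_symbol is \<xi> * g \<xi>) \<phi>" .
  qed
  thus ?thesis by (simp add: represents_def)
qed

lemma fourier_fun_deriv_norm_le:
  fixes p r r' :: ennreal
  assumes p: "1 \<le> p" "p \<le> 2" and r: "1 \<le> r" "r \<le> 2" and r': "1 \<le> r'" and rr': "recip r + recip r' = 1"
  shows "\<exists>C>0. \<forall>(u :: real^'n \<Rightarrow> complex) is. u \<in> Lp_space p \<longrightarrow>
    Lp_norm r' (\<lambda>\<xi>. deriv_symbol is \<xi> * fourier_fun u \<xi>) \<le> ennreal C * distr_norm r (distr_iter_deriv is (regular u))"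
proof -
  obtain C where C: "C > 0" and HY: "\<And>f :: real^'n \<Rightarrow> complex. \<And>A. A \<ge> 0 \<Longrightarrow> f \<in> borel_measurable borel \<Longrightarrow> Lp_norm r f \<le> ennreal A \<Longrightarrow>
    \<exists>h. is_fourier f h \<and> Lp_norm r' h \<le> ennreal (C * A)"
    using hausdorff_young[OF r r' rr', where 'n='n] by blast
  show ?thesis
  proof (intro exI[of _ C] conjI allI impI C)
    fix u :: "real^'n \<Rightarrow> complex" and "is" :: "'n list"
    assume u: "u \<in> Lp_space p"
    note g = represents_fourier_fun[OF p u]
    define N where "N = Lp_norm r' (\<lambda>\<xi>. deriv_symbol is \<xi> * fourier_fun u \<xi>)"
    have CC: "ennreal C * (ennreal (1 / C) * x) = x" for x
      using C by (simp add: mult.assoc[symmetric] ennreal_mult[symmetric])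
    have CC': "ennreal (1 / C) * (ennreal C * x) = x" for x
      using C by (simp add: mult.assoc[symmetric] ennreal_mult[symmetric])
    \<comment> \<open>The right-hand side is an infimum, hence a lower bound for every representing
      function is required, and the constant is moved to the left. If no function represents the
      derivative, the infimum is infinite.\<close>
    have "ennreal (1 / C) * N \<le> distr_norm r (distr_iter_deriv is (regular u))"
      unfolding distr_norm_def
    proof (rule INF_greatest)
      fix f assume "f \<in> {f. represents f (distr_iter_deriv is (regular u))}"
      hence f: "represents f (distr_iter_deriv is (regular u))" by simp
      show "ennreal (1 / C) * N \<le> Lp_norm r f"
      proof (cases "Lp_norm r f")
        case (real A)
        obtain h where h: "is_fourier f h" "Lp_norm r' h \<le> ennreal (C * A)"
          using HY[of A f] real represents_measurable[OF f] by auto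
        note d = represents_fourier_deriv[OF g f]
        have "N = Lp_norm r' h" unfolding N_def
          by (intro Lp_norm_cong_AE represents_unique[OF d h(1)] r' represents_measurable[OF d] represents_measurable[OF h(1)])
        hence "N \<le> ennreal C * Lp_norm r f" using h(2) real C by (simp add: ennreal_mult)
        hence "ennreal (1 / C) * N \<le> ennreal (1 / C) * (ennreal C * Lp_norm r f)" by (intro mult_left_mono) auto
        thus ?thesis by (simp only: CC')
      qed simp
    qed
    hence "ennreal C * (ennreal (1 / C) * N) \<le> ennreal C * distr_norm r (distr_iter_deriv is (regular u))"
      by (intro mult_left_mono) auto
    thus "Lp_norm r' (\<lambda>\<xi>. deriv_symbol is \<xi> * fourier_fun u \<xi>) \<le> ennreal C * distr_norm r (distr_iter_deriv is (regular u))"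
      by (simp only: CC N_def)
  qed
qed

text \<open>\<open>G\<close> may be arbitrary, since only scalars are taken out of the integral. The
  sign (-1)^j of the distributional derivative cancels against the reflection in
  \<open>inv_fourier_eq\<close>.\<close>

lemma distr_iter_deriv_inv_fourier:
  fixes \<phi> :: "real^'n \<Rightarrow> complex"
  assumes \<phi>: "\<phi> \<in> schwartz"
  shows "distr_iter_deriv is (distr_inv_fourier (regular G)) \<phi> =
    distr_inv_fourier (regular (\<lambda>\<xi>. deriv_symbol is \<xi> * G \<xi>)) \<phi>"
proof -
  have "inv_fourier (iter_deriv (rev is) \<phi>) \<xi> = (-1) ^ length is * (deriv_symbol is \<xi> * inv_fourier \<phi> \<xi>)" for \<xi>
  proof -
    have "(\<Prod>j\<leftarrow>rev is. \<i> * of_real ((- \<xi>) $ j)) = (\<Prod>j\<leftarrow>is. - (\<i> * of_real (\<xi> $ j)))"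
      unfolding rev_map[symmetric] prod_list_rev by simp
    thus ?thesis
      unfolding prod_list_map_uminus deriv_symbol_def[symmetric] inv_fourier_eq fourier_iter_deriv[OF \<phi>]
      by (simp add: mult_ac)
  qed
  hence "distr_iter_deriv is (distr_inv_fourier (regular G)) \<phi> =
    (-1) ^ length is * (LINT \<xi>|lborel. (-1) ^ length is * (deriv_symbol is \<xi> * G \<xi> * inv_fourier \<phi> \<xi>))"
    by (simp add: distr_iter_deriv_eq distr_inv_fourier_def regular_def mult_ac)
  also have "\<dots> = (LINT \<xi>|lborel. deriv_symbol is \<xi> * G \<xi> * inv_fourier \<phi> \<xi>)"
    unfolding integral_mult_right_zero by (simp add: mult.assoc[symmetric] power_mult_distrib[symmetric])
  finally show ?thesis by (simp add: distr_inv_fourier_def regular_def)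
qed

lemma distr_norm_cong:
  assumes "\<And>\<phi>. \<phi> \<in> schwartz \<Longrightarrow> T \<phi> = T' \<phi>"
  shows "distr_norm q T = distr_norm q T'"
proof -
  have "represents f T \<longleftrightarrow> represents f T'" for f
    using represents_cong[of f T T'] represents_cong[of f T' T] assms by auto
  thus ?thesis by (simp add: distr_norm_def)
qed

section \<open>Decay of the semigroup\<close>

lemma Lp_norm_of_real_norm: "Lp_norm p (\<lambda>x. of_real (norm (f x))) = Lp_norm p f"
  by (simp add: Lp_norm_def)

text \<open>The a-th power of a Gaussian is again a Gaussian, whose integral scales like T^(-n/2);
  the a-th root produces the heat decay.\<close>

lemma Lp_norm_gaussian_le:
  assumes a: "1 \<le> a" and \<kappa>: "\<kappa> > 0"
  shows "\<exists>C>0. \<forall>T>0. Lp_norm a (\<lambda>\<xi> :: real^'n. of_real (exp (- (\<kappa> * T * (norm \<xi>)\<^sup>2 / 2))))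
    \<le> ennreal (C * T powr (- (real CARD('n) / 2) * recip a))"
proof (cases "a = \<infinity>")
  case True
  show ?thesis
  proof (intro exI[of _ 1] conjI allI impI)
    fix T :: real assume T: "T > 0"
    have "Lp_norm \<infinity> (\<lambda>\<xi> :: real^'n. of_real (exp (- (\<kappa> * T * (norm \<xi>)\<^sup>2 / 2)))) \<le> ennreal 1"
      using \<kappa> T by (subst Lp_norm_infinity_le_iff) (auto intro!: AE_I2)
    thus "Lp_norm a (\<lambda>\<xi> :: real^'n. of_real (exp (- (\<kappa> * T * (norm \<xi>)\<^sup>2 / 2)))) \<le> ennreal (1 * T powr (- (real CARD('n) / 2) * recip a))"
      using T True by simp
  qed simp
next
  case False
  define A where "A = enn2real a"
  have A: "A \<ge> 1" "recip a = 1 / A" using exponent_finite[OF a False] by (auto simp: A_def)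
  define n2 where "n2 = real CARD('n) / 2"
  define C where "C = (2 * pi / (A * \<kappa>)) powr (n2 / A)"
  have C: "C > 0" using A \<kappa> by (simp add: C_def)
  show ?thesis
  proof (intro exI[of _ C] conjI allI impI C)
    fix T :: real assume T: "T > 0"
    have aT: "A * \<kappa> * T > 0" using A \<kappa> T by simp
    have "powr_integral A (\<lambda>\<xi>. complex_of_real (exp (- (\<kappa> * T * (norm (\<xi> :: real^'n))\<^sup>2 / 2)))) =
      (\<integral>\<^sup>+\<xi>. ennreal (exp (- (A * \<kappa> * T * (norm (\<xi> :: real^'n))\<^sup>2 / 2))) \<partial>lborel)"
      by (intro nn_integral_cong) (simp add: powr_def mult_ac)
    also have "\<dots> = ennreal (sqrt (2 * pi / (A * \<kappa> * T)) ^ CARD('n))"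
      using integral_gaussian[OF aT, where 'a="real^'n"] nn_integral_eq_integral[OF integrable_gaussian[OF aT, where 'a="real^'n"]]
      by simp
    also have "sqrt (2 * pi / (A * \<kappa> * T)) ^ CARD('n) = (2 * pi / (A * \<kappa> * T)) powr n2"
    proof -
      have "2 * pi / (A * \<kappa> * T) > 0" using aT by simp
      hence "sqrt (2 * pi / (A * \<kappa> * T)) ^ CARD('n) = ((2 * pi / (A * \<kappa> * T)) powr (1 / 2)) powr real CARD('n)"
        by (simp add: powr_half_sqrt powr_realpow)
      thus ?thesis by (simp add: powr_powr n2_def)
    qed
    also have "\<dots> = (C * T powr (- n2 * recip a)) powr A"
    proof -
      have "(C * T powr (- n2 * recip a)) powr A = (2 * pi / (A * \<kappa>)) powr n2 * T powr (- n2)"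
        using A \<kappa> T by (simp add: C_def powr_mult powr_powr)
      also have "\<dots> = (2 * pi / (A * \<kappa>) * inverse T) powr n2"
        using A \<kappa> T by (subst powr_mult) (auto simp: powr_minus inverse_powr)
      finally show ?thesis by (simp add: field_simps)
    qed
    finally show "Lp_norm a (\<lambda>\<xi> :: real^'n. of_real (exp (- (\<kappa> * T * (norm \<xi>)\<^sup>2 / 2)))) \<le> ennreal (C * T powr (- (real CARD('n) / 2) * recip a))"
      using C by (subst Lp_norm_finite_le_iff[OF a False]) (auto simp: A_def n2_def)
  qed
qed

lemma Lp_norm_power_tail:
  assumes b: "1 \<le> b" and e: "(recip b = 0 \<and> e \<ge> 0) \<or> e > real CARD('n) * recip b"
  shows "\<exists>C>0. Lp_norm b (\<lambda>\<xi> :: real^'n. of_real (if norm \<xi> > 1 then norm \<xi> powr (- e) else 0)) \<le> ennreal C"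
proof (cases "b = \<infinity>")
  case True
  hence e0: "e \<ge> 0" using e by auto
  have "norm (complex_of_real (if norm \<xi> > 1 then norm \<xi> powr (- e) else 0)) \<le> 1" for \<xi> :: "real^'n"
    using powr_mono[of "-e" 0 "norm \<xi>"] e0 by (auto split: if_splits)
  hence "Lp_norm \<infinity> (\<lambda>\<xi> :: real^'n. of_real (if norm \<xi> > 1 then norm \<xi> powr (- e) else 0)) \<le> ennreal 1"
    by (intro iffD2[OF Lp_norm_infinity_le_iff] AE_I2) simp_all
  thus ?thesis using True by (intro exI[of _ 1]) auto
next
  case False
  define B where "B = enn2real b"
  have B: "B \<ge> 1" "recip b = 1 / B" using exponent_finite[OF b False] by (auto simp: B_def)
  have eB: "e * B > real CARD('n)" using e B by (simp add: field_simps)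
  hence eB0: "e * B > 0" by (smt (verit) of_nat_0_le_iff)
  define J where "J = (LINT \<xi>|(lborel :: (real^'n) measure). 2 powr (e * B) * (1 + norm \<xi>) powr (- (e * B)))"
  have i: "integrable lborel (\<lambda>\<xi> :: real^'n. 2 powr (e * B) * (1 + norm \<xi>) powr (- (e * B)))"
    using eB by (intro integrable_mult_right integrable_powr_decay) simp
  have J: "J \<ge> 0" unfolding J_def by (intro Bochner_Integration.integral_nonneg) auto
  \<comment> \<open>Adding 1 makes the constant positive without checking that \<open>J\<close>
    is.\<close>
  define C where "C = (J + 1) powr (1 / B)"
  have C: "C > 0" "C powr B = J + 1" using J B by (auto simp: C_def powr_powr)
  have "powr_integral B (\<lambda>\<xi>. complex_of_real (if norm (\<xi> :: real^'n) > 1 then norm \<xi> powr (- e) else 0))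
    \<le> (\<integral>\<^sup>+\<xi>. ennreal (2 powr (e * B) * (1 + norm (\<xi> :: real^'n)) powr (- (e * B))) \<partial>lborel)"
  proof (intro nn_integral_mono ennreal_leI)
    fix \<xi> :: "real^'n"
    show "norm (complex_of_real (if norm \<xi> > 1 then norm \<xi> powr (- e) else 0)) powr B \<le> 2 powr (e * B) * (1 + norm \<xi>) powr (- (e * B))"
    proof (cases "norm \<xi> > 1")
      case True
      have "norm \<xi> powr (- (e * B)) \<le> ((1 + norm \<xi>) / 2) powr (- (e * B))"
        using True eB0 by (intro powr_mono2') auto
      also have "\<dots> = 2 powr (e * B) * (1 + norm \<xi>) powr (- (e * B))"
        using True by (subst powr_divide) (auto simp: powr_minus field_simps)
      finally show ?thesis using True by (simp add: powr_powr)
    qed simp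
  qed
  also have "\<dots> = ennreal J" unfolding J_def by (rule nn_integral_eq_integral[OF i]) simp
  also have "\<dots> \<le> ennreal (C powr B)" unfolding C(2) by (intro ennreal_leI) simp
  finally have "Lp_norm b (\<lambda>\<xi> :: real^'n. of_real (if norm \<xi> > 1 then norm \<xi> powr (- e) else 0)) \<le> ennreal C"
    using C by (subst Lp_norm_finite_le_iff[OF b False]) (auto simp: B_def)
  thus ?thesis using C by blast
qed

text \<open>In the variable z = sqrt(T) y, the power is bounded by z^k \<le> k! e^z and the
  exponential by z \<le> \<kappa> z^2/2 + 1/(2\<kappa>). Half of the Gaussian pays for the power;
  the other half is kept for Hoelder's inequality.\<close>

lemma power_gaussian_le:
  fixes y \<kappa> T :: real
  assumes \<kappa>: "\<kappa> > 0" and T: "T > 0" and y: "y \<ge> 0"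
  shows "y ^ k * exp (- (\<kappa> * y\<^sup>2 * T)) \<le> fact k * exp (1 / (2 * \<kappa>)) * T powr (- real k / 2) * exp (- (\<kappa> * T * y\<^sup>2 / 2))"
proof -
  define z where "z = sqrt T * y"
  have z: "z \<ge> 0" "z\<^sup>2 = T * y\<^sup>2" using T y by (auto simp: z_def power_mult_distrib)
  have "0 \<le> (\<kappa> * z - 1)\<^sup>2 / (2 * \<kappa>)" using \<kappa> by simp
  also have "\<dots> = \<kappa> * z\<^sup>2 / 2 - z + 1 / (2 * \<kappa>)"
    using \<kappa> by (simp add: power2_diff field_simps power2_eq_square)
  finally have le: "z - \<kappa> * z\<^sup>2 \<le> 1 / (2 * \<kappa>) - \<kappa> * z\<^sup>2 / 2" by argo
  have "z ^ k * exp (- (\<kappa> * z\<^sup>2)) \<le> fact k * exp z * exp (- (\<kappa> * z\<^sup>2))"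
    by (intro mult_right_mono power_le_fact_exp z) simp
  also have "\<dots> = fact k * exp (z - \<kappa> * z\<^sup>2)" by (simp add: exp_diff exp_minus field_simps)
  also have "\<dots> \<le> fact k * exp (1 / (2 * \<kappa>) - \<kappa> * z\<^sup>2 / 2)" using le by simp
  also have "\<dots> = fact k * exp (1 / (2 * \<kappa>)) * exp (- (\<kappa> * z\<^sup>2 / 2))"
    by (simp only: diff_conv_add_uminus exp_add mult.assoc)
  finally have 1: "z ^ k * exp (- (\<kappa> * z\<^sup>2)) \<le> fact k * exp (1 / (2 * \<kappa>)) * exp (- (\<kappa> * z\<^sup>2 / 2))" .
  have zk: "y ^ k = T powr (- real k / 2) * z ^ k"
  proof -
    have "T powr (- real k / 2) * sqrt T ^ k = T powr (- real k / 2) * (T powr (1 / 2)) powr real k"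
      using T by (simp add: powr_half_sqrt powr_realpow)
    also have "\<dots> = 1" using T by (simp add: powr_powr flip: powr_add)
    finally show ?thesis by (simp add: z_def power_mult_distrib)
  qed
  have "y ^ k * exp (- (\<kappa> * y\<^sup>2 * T)) = T powr (- real k / 2) * (z ^ k * exp (- (\<kappa> * z\<^sup>2)))"
    by (simp add: zk z(2) mult_ac)
  also have "\<dots> \<le> T powr (- real k / 2) * (fact k * exp (1 / (2 * \<kappa>)) * exp (- (\<kappa> * z\<^sup>2 / 2)))"
    by (intro mult_left_mono 1) simp
  finally show ?thesis by (simp add: z(2) mult_ac)
qed

text \<open>The norm is at most n times the largest coordinate. This controls |\<xi>|^M by the
  symbols of the pure derivatives of order M, one for each direction.\<close>

lemma norm_power_le_sum_coord:
  fixes \<xi> :: "real^'n"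
  shows "norm \<xi> ^ M \<le> real CARD('n) ^ M * (\<Sum>i\<in>UNIV. \<bar>\<xi> $ i\<bar> ^ M)"
proof -
  have "Max (range (\<lambda>j. \<bar>\<xi> $ j\<bar>)) \<in> range (\<lambda>j. \<bar>\<xi> $ j\<bar>)" by (intro Max_in) auto
  then obtain i where "Max (range (\<lambda>j. \<bar>\<xi> $ j\<bar>)) = \<bar>\<xi> $ i\<bar>" by blast
  hence i: "\<bar>\<xi> $ j\<bar> \<le> \<bar>\<xi> $ i\<bar>" for j
    using Max_ge[of "range (\<lambda>j. \<bar>\<xi> $ j\<bar>)" "\<bar>\<xi> $ j\<bar>"] by simp
  have "norm \<xi> \<le> (\<Sum>j\<in>UNIV. \<bar>\<xi> $ j\<bar>)" by (rule norm_le_l1_cart)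
  also have "\<dots> \<le> (\<Sum>j\<in>(UNIV :: 'n set). \<bar>\<xi> $ i\<bar>)" by (intro sum_mono i)
  also have "\<dots> = real CARD('n) * \<bar>\<xi> $ i\<bar>" by simp
  finally have "norm \<xi> ^ M \<le> (real CARD('n) * \<bar>\<xi> $ i\<bar>) ^ M" by (intro power_mono) auto
  also have "\<dots> = real CARD('n) ^ M * \<bar>\<xi> $ i\<bar> ^ M" by (rule power_mult_distrib)
  also have "\<bar>\<xi> $ i\<bar> ^ M \<le> (\<Sum>i\<in>UNIV. \<bar>\<xi> $ i\<bar> ^ M)"
    by (rule member_le_sum) auto
  finally show ?thesis by (simp add: mult_left_mono)
qed

lemma finite_lists_of_length: "finite {is :: 'n::finite list. length is = k}"
  using finite_lists_length_eq[of "UNIV :: 'n set" k] by simp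

text \<open>\<open>D\<close> is the decay rate at high frequencies, paid for with \<open>l\<close> derivatives; the remaining
  \<open>N - l\<close> derivatives make the weight in Hoelder's inequality integrable at infinity.\<close>

lemma semigroup_P_decay:
  fixes m :: "real^'n \<Rightarrow> real" and D :: "real \<Rightarrow> real"
  assumes [measurable]: "m \<in> borel_measurable borel"
    and p: "1 \<le> p" "p \<le> 2" and r: "1 \<le> r" "r \<le> 2" and q: "2 \<le> q"
    and \<kappa>: "\<kappa> > 0" and low: "\<And>\<xi>. norm \<xi> \<le> 1 \<Longrightarrow> \<kappa> * (norm \<xi>)\<^sup>2 \<le> (norm \<xi>)\<^sup>2 / m \<xi> powr s"
    and D: "\<And>t. t \<ge> 0 \<Longrightarrow> D t > 0"
    and high: "\<And>t \<xi>. t \<ge> 0 \<Longrightarrow> norm \<xi> > 1 \<Longrightarrow> exp (- ((norm \<xi>)\<^sup>2 / m \<xi> powr s) * t) \<le> D t * norm \<xi> powr l"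
    and N: "(recip r = recip q \<and> real N \<ge> l) \<or> real N > l + real CARD('n) * (recip r - recip q)"
  shows "\<exists>C>0. \<forall>u \<in> Lp_space p. \<forall>t\<ge>0.
    grad_norm q k (semigroup_P m s t u) \<le>
      ennreal (C * (1 + t) powr (- (real CARD('n) / 2) * (recip p - recip q) - real k / 2)) * Lp_norm p u
      + ennreal (C * D t) * grad_norm r (k + N) (regular u)"
proof -
  define n where "n = real CARD('n)"
  have n: "n \<ge> 1" unfolding n_def by (simp add: Suc_leI)
  have q1: "1 \<le> q" using q order_trans[of 1 "2::ennreal" q] by (simp add: one_le_numeral)
  have pq: "recip q \<le> 1 / 2" "1 / 2 \<le> recip p" "1 / 2 \<le> recip r"
    using recip_antimono[OF _ q] recip_antimono[OF p] recip_antimono[OF r] by (auto simp: one_le_numeral)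
  note bnds = recip_bounds[OF p(1)] recip_bounds[OF r(1)] recip_bounds[OF q1]
  obtain q' where q': "1 \<le> q'" "recip q' = 1 - recip q" using exponent_of_recip[of "1 - recip q"] bnds by auto
  obtain p' where p': "1 \<le> p'" "recip p' = 1 - recip p" using exponent_of_recip[of "1 - recip p"] bnds by auto
  obtain r' where r': "1 \<le> r'" "recip r' = 1 - recip r" using exponent_of_recip[of "1 - recip r"] bnds by auto
  \<comment> \<open>With these reciprocals, 1/a + 1/p' = 1/b + 1/r' = 1/q', as Hoelder's inequality
    requires at low and at high frequencies.\<close>
  obtain a where a: "1 \<le> a" "recip a = recip p - recip q" using exponent_of_recip[of "recip p - recip q"] bnds pq by auto
  obtain b where b: "1 \<le> b" "recip b = recip r - recip q" using exponent_of_recip[of "recip r - recip q"] bnds pq by auto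
  have q'2: "q' \<le> 2"
  proof (rule ccontr)
    assume "\<not> q' \<le> 2"
    hence "2 \<le> q'" by simp
    hence "recip q' \<le> 1 / 2" using recip_antimono[of 2 q'] by (simp add: one_le_numeral)
    hence "recip q' = recip 2" using q' pq by simp
    hence "q' = 2" by (intro recip_inj q') (simp_all add: one_le_numeral)
    thus False using \<open>\<not> q' \<le> 2\<close> by simp
  qed
  obtain Cq where Cq: "Cq > 0" and HYq: "\<And>g :: real^'n \<Rightarrow> complex. \<And>A. A \<ge> 0 \<Longrightarrow> g \<in> borel_measurable borel \<Longrightarrow> Lp_norm q' g \<le> ennreal A \<Longrightarrow>
      distr_norm q (distr_inv_fourier (regular g)) \<le> ennreal (Cq * A)"
    using hausdorff_young_inverse[OF q'(1) q'2 q1, where 'n='n] q'(2) by auto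
  obtain Cp where Cp: "Cp > 0" and HYp: "\<And>u :: real^'n \<Rightarrow> complex. u \<in> Lp_space p \<Longrightarrow> Lp_norm p' (fourier_fun u) \<le> ennreal Cp * Lp_norm p u"
    using fourier_fun_norm_le[OF p p'(1), where 'n='n] p'(2) by auto
  obtain Cr where Cr: "Cr > 0" and HYr: "\<And>(u :: real^'n \<Rightarrow> complex) is. u \<in> Lp_space p \<Longrightarrow>
      Lp_norm r' (\<lambda>\<xi>. deriv_symbol is \<xi> * fourier_fun u \<xi>) \<le> ennreal Cr * distr_norm r (distr_iter_deriv is (regular u))"
    using fourier_fun_deriv_norm_le[OF p r r'(1), where 'n='n] r'(2) by auto
  obtain Cg where Cg: "Cg > 0" and gauss: "\<And>T. T > 0 \<Longrightarrow> Lp_norm a (\<lambda>\<xi> :: real^'n. of_real (exp (- (\<kappa> * T * (norm \<xi>)\<^sup>2 / 2)))) \<le> ennreal (Cg * T powr (- (n / 2) * recip a))"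
    using Lp_norm_gaussian_le[OF a(1) \<kappa>, where 'n='n] unfolding n_def by blast
  define e where "e = real N - l"
  define \<tau> :: "real^'n \<Rightarrow> real" where "\<tau> \<xi> = (if norm \<xi> > 1 then norm \<xi> powr (- e) else 0)" for \<xi>
  have [measurable]: "\<tau> \<in> borel_measurable borel" unfolding \<tau>_def by measurable
  have "(recip b = 0 \<and> e \<ge> 0) \<or> e > real CARD('n) * recip b" using N unfolding b(2) e_def by auto
  then obtain Ct where Ct: "Ct > 0" and tail: "Lp_norm b (\<lambda>\<xi>. of_real (\<tau> \<xi>)) \<le> ennreal Ct"
    using Lp_norm_power_tail[OF b(1), where 'n='n] unfolding \<tau>_def by blast
  define M where "M = k + N"
  define c0 where "c0 = fact k * exp (1 / (2 * \<kappa>)) * exp \<kappa>"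
  have c0: "c0 > 0" by (simp add: c0_def)
  \<comment> \<open>The number of derivatives of order k times the constant of the inverse
    transform; the successor keeps \<open>W\<close> evidently positive.\<close>
  define W where "W = real (Suc (card {is :: 'n list. length is = k})) * Cq"
  have W: "W > 0" using Cq by (simp add: W_def)
  \<comment> \<open>The first factor 2 in \<open>c1\<close> and \<open>c2\<close> comes from adding
    the low and the high part, \<open>2 ^ CARD('n)\<close> from the triangle inequality over the
    directions, and the single factor \<open>n\<close> from summing n equal bounds.\<close>
  define c1 where "c1 = 2 * (c0 * Cg) * Cp"
  define c2 where "c2 = 2 * 2 ^ CARD('n) * (n * (n ^ M * Ct * Cr))"
  have c12: "c1 > 0" "c2 > 0" using c0 Cg Cp Ct Cr n by (auto simp: c1_def c2_def)
  define C where "C = W * c1 + W * c2"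
  have C: "C > 0" "W * c1 \<le> C" "W * c2 \<le> C" using W c12 by (auto simp: C_def add_pos_pos)
  show ?thesis
  proof (intro exI[of _ C] conjI ballI allI impI C(1))
    fix u :: "real^'n \<Rightarrow> complex" and t :: real
    assume u: "u \<in> Lp_space p" and t: "t \<ge> 0"
    define T where "T = 1 + t"
    have T: "T > 0" using t by (simp add: T_def)
    define v where "v = fourier_fun u"
    have [measurable]: "v \<in> borel_measurable borel"
      unfolding v_def by (rule represents_measurable[OF represents_fourier_fun[OF p u]])
    define U where "U = Lp_norm p u"
    define G where "G = grad_norm r M (regular u)"
    define \<sigma> where "\<sigma> \<xi> = exp (- ((norm \<xi>)\<^sup>2 / m \<xi> powr s) * t)" for \<xi>
    have [measurable]: "\<sigma> \<in> borel_measurable borel" unfolding \<sigma>_def by measurable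
    define E where "E = T powr (- (n / 2) * (recip p - recip q) - real k / 2)"
    define L :: "real^'n \<Rightarrow> real" where "L \<xi> = c0 * T powr (- real k / 2) * exp (- (\<kappa> * T * (norm \<xi>)\<^sup>2 / 2))" for \<xi>
    define H where "H \<xi> = n ^ M * D t * \<tau> \<xi>" for \<xi>
    have [measurable]: "L \<in> borel_measurable borel" "H \<in> borel_measurable borel" unfolding L_def H_def by measurable
    define F0 where "F0 \<xi> = of_real (L \<xi>) * v \<xi>" for \<xi>
    define F where "F i \<xi> = of_real (H \<xi>) * (deriv_symbol (replicate M i) \<xi> * v \<xi>)" for i \<xi>
    have [measurable]: "F0 \<in> borel_measurable borel" "F i \<in> borel_measurable borel" for i
      unfolding F0_def F_def by measurable
    have Dt: "D t > 0" by (rule D[OF t])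
    \<comment> \<open>\<open>F0\<close> dominates on the unit ball and the sum of the
      \<open>F i\<close> outside. Each \<open>F i\<close> carries the symbol of a pure derivative of
      order M, so its norm is controlled by the data.\<close>
    have pointwise: "norm \<xi> ^ k * \<sigma> \<xi> * norm (v \<xi>) \<le> norm (F0 \<xi>) + (\<Sum>i\<in>UNIV. norm (F i \<xi>))" for \<xi>
    proof (cases "norm \<xi> \<le> 1")
      case True
      have "norm \<xi> ^ k * \<sigma> \<xi> \<le> L \<xi>"
      proof -
        \<comment> \<open>Replacing \<open>t\<close> by \<open>1 + t\<close> costs the factor
          exp(\<kappa> |\<xi>|^2), at most exp \<kappa> on the unit ball. It gives decay in 1 + t,
          without a singularity at t = 0.\<close>
        have "\<sigma> \<xi> \<le> exp \<kappa> * exp (- (\<kappa> * (norm \<xi>)\<^sup>2 * T))"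
        proof -
          have "\<kappa> * (norm \<xi>)\<^sup>2 * t \<le> (norm \<xi>)\<^sup>2 / m \<xi> powr s * t" using low[OF True] t by (intro mult_right_mono)
          moreover have "\<kappa> * (norm \<xi>)\<^sup>2 \<le> \<kappa>" using True \<kappa> by (simp add: power_le_one mult_left_le)
          ultimately have "- ((norm \<xi>)\<^sup>2 / m \<xi> powr s) * t \<le> \<kappa> + - (\<kappa> * (norm \<xi>)\<^sup>2 * T)"
            unfolding T_def by (simp add: algebra_simps)
          thus ?thesis unfolding \<sigma>_def exp_add[symmetric] by simp
        qed
        hence "norm \<xi> ^ k * \<sigma> \<xi> \<le> norm \<xi> ^ k * (exp \<kappa> * exp (- (\<kappa> * (norm \<xi>)\<^sup>2 * T)))"
          by (intro mult_left_mono) auto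
        also have "\<dots> = exp \<kappa> * (norm \<xi> ^ k * exp (- (\<kappa> * (norm \<xi>)\<^sup>2 * T)))" by simp
        also have "\<dots> \<le> exp \<kappa> * (fact k * exp (1 / (2 * \<kappa>)) * T powr (- real k / 2) * exp (- (\<kappa> * T * (norm \<xi>)\<^sup>2 / 2)))"
          by (intro mult_left_mono power_gaussian_le \<kappa> T) auto
        finally show ?thesis by (simp add: L_def c0_def mult_ac)
      qed
      hence "norm \<xi> ^ k * \<sigma> \<xi> * norm (v \<xi>) \<le> L \<xi> * norm (v \<xi>)" by (intro mult_right_mono) auto
      also have "\<dots> = norm (F0 \<xi>)" using c0 by (simp add: F0_def norm_mult L_def)
      also have "\<dots> \<le> norm (F0 \<xi>) + (\<Sum>i\<in>UNIV. norm (F i \<xi>))" by (simp add: sum_nonneg)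
      finally show ?thesis .
    next
      case False
      hence x: "norm \<xi> > 1" by simp
      have "norm \<xi> ^ k * \<sigma> \<xi> \<le> norm \<xi> ^ k * (D t * norm \<xi> powr l)"
        unfolding \<sigma>_def by (intro mult_left_mono high t x) auto
      \<comment> \<open>Here |\<xi>|^(k+l) is written as |\<xi>|^(l-N) |\<xi>|^(k+N): the first
        factor is the weight in L^b, the second belongs to the data.\<close>
      also have "\<dots> = D t * \<tau> \<xi> * norm \<xi> ^ M"
      proof -
        have "norm \<xi> ^ M = norm \<xi> ^ k * norm \<xi> powr real N" 
          using x powr_realpow[of "norm \<xi>" N] order.strict_trans[OF zero_less_one x]
          by (simp only: M_def power_add)
        moreover have "norm \<xi> powr l = norm \<xi> powr (- e) * norm \<xi> powr real N" by (simp add: e_def flip: powr_add)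
        ultimately show ?thesis using x by (simp add: \<tau>_def)
      qed
      also have "\<dots> \<le> D t * \<tau> \<xi> * (n ^ M * (\<Sum>i\<in>UNIV. \<bar>\<xi> $ i\<bar> ^ M))"
        unfolding n_def using Dt by (intro mult_left_mono norm_power_le_sum_coord) (auto simp: \<tau>_def)
      also have "\<dots> = H \<xi> * (\<Sum>i\<in>UNIV. \<bar>\<xi> $ i\<bar> ^ M)" by (simp add: H_def)
      finally have "norm \<xi> ^ k * \<sigma> \<xi> * norm (v \<xi>) \<le> H \<xi> * (\<Sum>i\<in>UNIV. \<bar>\<xi> $ i\<bar> ^ M) * norm (v \<xi>)"
        by (intro mult_right_mono) auto
      also have "\<dots> = (\<Sum>i\<in>UNIV. norm (F i \<xi>))"
      proof -
        have "H \<xi> \<ge> 0" using Dt n by (simp add: H_def \<tau>_def)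
        hence "norm (F i \<xi>) = H \<xi> * \<bar>\<xi> $ i\<bar> ^ M * norm (v \<xi>)" for i
          by (simp add: F_def norm_mult norm_deriv_symbol_replicate)
        thus ?thesis by (simp only: sum_distrib_left sum_distrib_right)
      qed
      also have "\<dots> \<le> norm (F0 \<xi>) + (\<Sum>i\<in>UNIV. norm (F i \<xi>))" by simp
      finally show ?thesis .
    qed
    have F0le: "Lp_norm q' F0 \<le> ennreal (c0 * Cg * E * Cp) * U"
    proof -
      have "Lp_norm a (\<lambda>\<xi> :: real^'n. of_real (c0 * T powr (- real k / 2)) * of_real (exp (- (\<kappa> * T * (norm \<xi>)\<^sup>2 / 2)))) \<le>
        ennreal (norm (of_real (c0 * T powr (- real k / 2)) :: complex) * (Cg * T powr (- (n / 2) * recip a)))"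
        by (rule Lp_norm_scale_le) (use gauss[OF T] a Cg in auto)
      also have "norm (of_real (c0 * T powr (- real k / 2)) :: complex) * (Cg * T powr (- (n / 2) * recip a)) = c0 * Cg * E"
        unfolding norm_of_real E_def a(2) diff_conv_add_uminus[of _ "real k / 2"] powr_add
        using c0 by (simp add: abs_mult)
      also have "(\<lambda>\<xi> :: real^'n. of_real (c0 * T powr (- real k / 2)) * complex_of_real (exp (- (\<kappa> * T * (norm \<xi>)\<^sup>2 / 2)))) = (\<lambda>\<xi>. of_real (L \<xi>))"
        by (simp add: L_def)
      finally have "Lp_norm q' F0 \<le> ennreal (c0 * Cg * E) * Lp_norm p' v"
        unfolding F0_def using c0 Cg T q' p' a
        by (intro Lp_norm_hoelder[where a=a and b=p']) (auto simp: E_def)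
      also have "\<dots> \<le> ennreal (c0 * Cg * E) * (ennreal Cp * U)"
        unfolding v_def U_def by (intro mult_left_mono HYp u) simp
      also have "\<dots> = ennreal (c0 * Cg * E * Cp) * U"
        using c0 Cg Cp by (simp add: mult.assoc[symmetric] ennreal_mult[symmetric] E_def)
      finally show ?thesis .
    qed
    have Fle: "Lp_norm q' (F i) \<le> ennreal (n ^ M * Ct * Cr * D t) * G" for i
    proof -
      have "Lp_norm b (\<lambda>\<xi> :: real^'n. of_real (n ^ M * D t) * of_real (\<tau> \<xi>)) \<le> ennreal (norm (of_real (n ^ M * D t) :: complex) * Ct)"
        by (rule Lp_norm_scale_le) (use tail b Ct in auto)
      also have "norm (of_real (n ^ M * D t) :: complex) * Ct = n ^ M * D t * Ct"
        unfolding norm_of_real using n Dt by simp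
      also have "(\<lambda>\<xi> :: real^'n. of_real (n ^ M * D t) * complex_of_real (\<tau> \<xi>)) = (\<lambda>\<xi>. of_real (H \<xi>))"
        by (simp add: H_def)
      finally have "Lp_norm q' (F i) \<le> ennreal (n ^ M * D t * Ct) * Lp_norm r' (\<lambda>\<xi>. deriv_symbol (replicate M i) \<xi> * v \<xi>)"
        unfolding F_def using n Dt Ct q' r' b
        by (intro Lp_norm_hoelder[where a=b and b=r']) auto
      also have "\<dots> \<le> ennreal (n ^ M * D t * Ct) * (ennreal Cr * distr_norm r (distr_iter_deriv (replicate M i) (regular u)))"
        unfolding v_def by (intro mult_left_mono HYr u) simp
      also have "\<dots> = ennreal (n ^ M * Ct * Cr * D t) * distr_norm r (distr_iter_deriv (replicate M i) (regular u))"
      proof -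
        have "ennreal (n ^ M * Ct * Cr * D t) = ennreal (n ^ M * D t * Ct) * ennreal Cr"
          using n Dt Ct Cr by (subst ennreal_mult[symmetric]) (auto simp: mult_ac)
        thus ?thesis by (simp only: mult.assoc)
      qed
      also have "\<dots> \<le> ennreal (n ^ M * Ct * Cr * D t) * G"
        unfolding G_def grad_norm_def
        by (intro mult_left_mono member_le_sum finite_lists_of_length) auto
      finally show ?thesis .
    qed
    define X where "X = ennreal (c1 * E) * U + ennreal (c2 * D t) * G"
    have main: "Lp_norm q' (\<lambda>\<xi>. deriv_symbol is \<xi> * (of_real (\<sigma> \<xi>) * v \<xi>)) \<le> X" if "is": "length is = k" for "is"
    proof -
      have "Lp_norm q' (\<lambda>\<xi>. deriv_symbol is \<xi> * (of_real (\<sigma> \<xi>) * v \<xi>)) \<le>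
        Lp_norm q' (\<lambda>\<xi>. complex_of_real (norm (F0 \<xi>)) + (\<Sum>i\<in>UNIV. complex_of_real (norm (F i \<xi>))))"
      proof (intro Lp_norm_mono_AE q' AE_I2)
        fix \<xi>
        have "norm (deriv_symbol is \<xi> * (of_real (\<sigma> \<xi>) * v \<xi>)) \<le> norm \<xi> ^ k * \<sigma> \<xi> * norm (v \<xi>)"
          using norm_deriv_symbol_le[of "is" \<xi>] "is" by (auto simp: norm_mult \<sigma>_def mult.assoc intro!: mult_right_mono)
        also note pointwise[of \<xi>]
        also have "norm (F0 \<xi>) + (\<Sum>i\<in>UNIV. norm (F i \<xi>)) = norm (complex_of_real (norm (F0 \<xi>)) + (\<Sum>i\<in>UNIV. complex_of_real (norm (F i \<xi>))))"
          by (simp add: sum_nonneg flip: of_real_sum of_real_add)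
        finally show "norm (deriv_symbol is \<xi> * (of_real (\<sigma> \<xi>) * v \<xi>)) \<le> norm (complex_of_real (norm (F0 \<xi>)) + (\<Sum>i\<in>UNIV. complex_of_real (norm (F i \<xi>))))" .
      qed measurable
      also have "\<dots> \<le> 2 * (Lp_norm q' (\<lambda>\<xi>. complex_of_real (norm (F0 \<xi>))) + Lp_norm q' (\<lambda>\<xi>. \<Sum>i\<in>UNIV. complex_of_real (norm (F i \<xi>))))"
        by (intro Lp_norm_add_le q') measurable
      also have "\<dots> \<le> 2 * (Lp_norm q' (\<lambda>\<xi>. complex_of_real (norm (F0 \<xi>))) + 2 ^ CARD('n) * (\<Sum>i\<in>UNIV. Lp_norm q' (\<lambda>\<xi>. complex_of_real (norm (F i \<xi>)))))"
        by (intro mult_left_mono add_left_mono Lp_norm_sum_le q') auto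
      also have "\<dots> \<le> 2 * (ennreal (c0 * Cg * E * Cp) * U + 2 ^ CARD('n) * (\<Sum>i\<in>(UNIV :: 'n set). ennreal (n ^ M * Ct * Cr * D t) * G))"
        unfolding Lp_norm_of_real_norm by (intro mult_left_mono add_mono sum_mono F0le Fle) auto
      also have "\<dots> = X"
      proof -
        have A: "2 * (ennreal (c0 * Cg * E * Cp) * U) = ennreal (c1 * E) * U"
        proof -
          have "ennreal (c1 * E) = 2 * ennreal (c0 * Cg * E * Cp)"
            unfolding c1_def using c0 Cg Cp by (subst ennreal_numeral[symmetric], subst ennreal_mult[symmetric]) (auto simp: E_def mult_ac)
          thus ?thesis by (simp only: mult.assoc)
        qed
        have B: "2 * (2 ^ CARD('n) * (\<Sum>i\<in>(UNIV :: 'n set). ennreal (n ^ M * Ct * Cr * D t) * G)) = ennreal (c2 * D t) * G"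
        proof -
          have "ennreal (c2 * D t) = ennreal (2 * 2 ^ CARD('n) * n) * ennreal (n ^ M * Ct * Cr * D t)"
            unfolding c2_def using n Ct Cr Dt by (subst ennreal_mult[symmetric]) (auto simp: mult_ac)
          moreover have "ennreal (2 * 2 ^ CARD('n) * n) = 2 * (2 ^ CARD('n) * of_nat CARD('n))"
            unfolding n_def by (simp add: ennreal_mult ennreal_of_nat_eq_real_of_nat ennreal_power[symmetric] mult.assoc)
          ultimately show ?thesis by (simp only: sum_constant mult.assoc)
        qed
        show ?thesis unfolding X_def distrib_left A B ..
      qed
      finally show ?thesis .
    qed
    have each: "distr_norm q (distr_iter_deriv is (semigroup_P m s t u)) \<le> ennreal Cq * X" if "is": "length is = k" for "is"
    \<comment> \<open>The inverse Hausdorff-Young bound takes a real number, so an infinite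
      right-hand side is a separate, trivial case.\<close>
    proof (cases X)
      case (real x)
      define g where "g \<xi> = deriv_symbol is \<xi> * (of_real (\<sigma> \<xi>) * v \<xi>)" for \<xi>
      have [measurable]: "g \<in> borel_measurable borel" unfolding g_def by measurable
      have "distr_norm q (distr_iter_deriv is (semigroup_P m s t u)) = distr_norm q (distr_inv_fourier (regular g))"
        unfolding semigroup_P_def g_def \<sigma>_def v_def by (intro distr_norm_cong distr_iter_deriv_inv_fourier)
      also have "\<dots> \<le> ennreal (Cq * x)"
        using main[OF "is"] real unfolding g_def[symmetric] by (intro HYq) auto
      finally show ?thesis using real Cq by (simp add: ennreal_mult)
    qed (use Cq in \<open>simp add: ennreal_mult_top\<close>)
    have "grad_norm q k (semigroup_P m s t u) \<le> (\<Sum>is\<in>{is :: 'n list. length is = k}. ennreal Cq * X)"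
      unfolding grad_norm_def by (intro sum_mono each) simp
    also have "\<dots> = of_nat (card {is :: 'n list. length is = k}) * (ennreal Cq * X)" by simp
    also have "\<dots> \<le> of_nat (Suc (card {is :: 'n list. length is = k})) * (ennreal Cq * X)"
      by (intro mult_right_mono) auto
    also have "\<dots> = ennreal W * X"
      unfolding W_def using Cq by (simp add: ennreal_mult ennreal_of_nat_eq_real_of_nat mult.assoc del: of_nat_Suc)
    also have "\<dots> = ennreal (W * c1 * E) * U + ennreal (W * c2 * D t) * G"
      unfolding X_def distrib_left mult.assoc[symmetric]
      using W c12 Dt by (simp add: ennreal_mult[symmetric] E_def mult.assoc)
    also have "\<dots> \<le> ennreal (C * E) * U + ennreal (C * D t) * G"
      using C Dt by (intro add_mono mult_right_mono ennreal_leI) (auto simp: E_def)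
    finally show "grad_norm q k (semigroup_P m s t u) \<le>
      ennreal (C * (1 + t) powr (- (real CARD('n) / 2) * (recip p - recip q) - real k / 2)) * Lp_norm p u
      + ennreal (C * D t) * grad_norm r (k + N) (regular u)"
      unfolding E_def T_def U_def G_def M_def n_def .
  qed
qed

text \<open>The two alternatives are those under which |\<xi>|^(l-N) has a finite norm outside the
  unit ball. Floor plus one is strictly larger than its argument; in the exceptional case the
  reciprocals agree and the bracket equals \<open>l\<close>.\<close>

lemma star_bracket_gt:
  assumes "1 \<le> r" "r \<le> 2" "2 \<le> q" "l \<ge> 0"
  shows "(recip r = recip q \<and> real (star_bracket d l r q) \<ge> l) \<or>
    real (star_bracket d l r q) > l + real d * (recip r - recip q)"
proof (cases "l \<in> \<int> \<and> r = 2 \<and> q = 2")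
  case True
  then obtain z where z: "l = of_int z" by (auto elim: Ints_cases)
  thus ?thesis using True assms(4) by (simp add: star_bracket_def)
next
  case False
  have "recip q \<le> recip r" using assms by (intro recip_antimono) auto
  hence "0 \<le> l + real d * (recip r - recip q)" using assms(4) by simp
  hence "real (nat \<lfloor>l + real d * (recip r - recip q)\<rfloor>) + 1 > l + real d * (recip r - recip q)"
    by linarith
  thus ?thesis using False by (auto simp: star_bracket_def)
qed

section \<open>Size of the symbol and the decay estimate\<close>

lemma powr_symbol_le:
  fixes m :: "real^'n \<Rightarrow> real"
  assumes m0: "0 < m0"
    and lower: "\<And>\<xi>. m0 * (1 + (norm \<xi>)\<^sup>2) \<le> m \<xi>" and upper: "\<And>\<xi>. m \<xi> \<le> m1 * (1 + (norm \<xi>)\<^sup>2)"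
  shows "\<exists>K>0. \<forall>\<xi>. m \<xi> powr s \<le> K * max 1 (norm \<xi>) powr (2 * s)"
proof (intro exI conjI allI)
  \<comment> \<open>The first factor covers both signs of \<open>s\<close>: the upper bound on
    \<open>m\<close> is used for s \<ge> 0, the lower one for s < 0. The factor
    \<open>2 powr \<bar>s\<bar>\<close> pays for comparing 1 + |\<xi>|^2 with the square of max(1,
    |\<xi>|). This maximum makes the bound constant on the unit ball and a pure power
    outside.\<close>
  define K where "K = (m0 powr s + m1 powr s) * 2 powr \<bar>s\<bar>"
  have m1: "m0 \<le> m1" using lower[of 0] upper[of 0] by simp
  show "K > 0" using m0 by (simp add: K_def add_pos_nonneg)
  fix \<xi> :: "real^'n"
  define R where "R = 1 + (norm \<xi>)\<^sup>2"
  define \<rho> where "\<rho> = max 1 (norm \<xi>)"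
  have R: "R \<ge> 1" by (simp add: R_def)
  have \<rho>: "\<rho> \<ge> 1" by (simp add: \<rho>_def)
  have R\<rho>: "\<rho>\<^sup>2 \<le> R" "R \<le> 2 * \<rho>\<^sup>2"
    by (auto simp: R_def \<rho>_def max_def power_le_one not_le one_le_power)
  have mpos: "m \<xi> > 0" using less_le_trans[OF mult_pos_pos lower[of \<xi>]] m0 R unfolding R_def by auto
  have m0R: "0 < m0 * R" using m0 R by simp
  have lower': "m0 * R \<le> m \<xi>" and upper': "m \<xi> \<le> m1 * R" using lower upper by (auto simp: R_def)
  have 1: "m \<xi> powr s \<le> (m0 powr s + m1 powr s) * R powr s"
  proof (cases "s \<ge> 0")
    case True
    have "m \<xi> powr s \<le> (m1 * R) powr s" using upper' mpos True by (intro powr_mono2) auto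
    also have "\<dots> = m1 powr s * R powr s" using m0 m1 R by (simp add: powr_mult)
    also have "\<dots> \<le> (m0 powr s + m1 powr s) * R powr s" by (intro mult_right_mono) auto
    finally show ?thesis .
  next
    case False
    have "m \<xi> powr s \<le> (m0 * R) powr s" using lower' m0R False by (intro powr_mono2') auto
    also have "\<dots> = m0 powr s * R powr s" using m0 R by (simp add: powr_mult)
    also have "\<dots> \<le> (m0 powr s + m1 powr s) * R powr s" by (intro mult_right_mono) auto
    finally show ?thesis .
  qed
  have 2: "R powr s \<le> 2 powr \<bar>s\<bar> * \<rho> powr (2 * s)"
  proof (cases "s \<ge> 0")
    case True
    have "R powr s \<le> (2 * \<rho>\<^sup>2) powr s" using R R\<rho> True by (intro powr_mono2) auto
    thus ?thesis using \<rho> True by (simp add: powr_mult powr_powr flip: powr_numeral)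
  next
    case False
    have "R powr s \<le> (\<rho>\<^sup>2) powr s" using \<rho> R\<rho> False by (intro powr_mono2') auto
    also have "\<dots> = \<rho> powr (2 * s)" using \<rho> by (simp add: powr_powr flip: powr_numeral)
    also have "\<dots> \<le> 2 powr \<bar>s\<bar> * \<rho> powr (2 * s)"
      using ge_one_powr_ge_zero[of 2 "\<bar>s\<bar>"] mult_right_mono[of 1 "2 powr \<bar>s\<bar>" "\<rho> powr (2 * s)"] by simp
    finally show ?thesis .
  qed
  have "m \<xi> powr s \<le> (m0 powr s + m1 powr s) * (2 powr \<bar>s\<bar> * \<rho> powr (2 * s))"
    using order_trans[OF 1 mult_left_mono[OF 2]] by simp
  thus "m \<xi> powr s \<le> K * max 1 (norm \<xi>) powr (2 * s)" by (simp add: K_def \<rho>_def mult.assoc)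
qed

text \<open>Converts exponential into polynomial decay: the exponent is rounded up to a natural
  number N, and (1 + z)^N = K^N ((1 + z)/K)^N is at most K^N N! e^((1+z)/K).\<close>

lemma powr_le_const_exp:
  fixes K A :: real
  assumes K: "K > 0"
  shows "\<exists>C>0. \<forall>z\<ge>0. (1 + z) powr A \<le> C * exp (z / K)"
proof (intro exI conjI allI impI)
  define N where "N = nat \<lceil>A\<rceil>"
  define C where "C = K ^ N * fact N * exp (1 / K)"
  show "C > 0" using K by (simp add: C_def)
  fix z :: real assume z: "z \<ge> 0"
  have "(1 + z) powr A \<le> (1 + z) powr real N"
    using z by (intro powr_mono) (auto simp: N_def real_nat_ceiling_ge)
  also have "\<dots> = (1 + z) ^ N" using z by (intro powr_realpow) simp
  also have "\<dots> = K ^ N * ((1 + z) / K) ^ N" using K by (simp add: power_divide)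
  also have "\<dots> \<le> K ^ N * (fact N * exp ((1 + z) / K))"
    using K z by (intro mult_left_mono power_le_fact_exp) auto
  also have "\<dots> = C * exp (z / K)" by (simp add: C_def add_divide_distrib exp_add)
  finally show "(1 + z) powr A \<le> C * exp (z / K)" .
qed

theorem lemma2p1:
  fixes m :: "real^'n \<Rightarrow> real" and m0 m1 s :: real
  assumes m_cont: "continuous_on UNIV m"
    and m_pos: "\<And>\<xi>. m \<xi> > 0"
    and m0_pos: "0 < m0" and m0_le_m1: "m0 \<le> m1"
    and m_lower: "\<And>\<xi>. m0 * (1 + (norm \<xi>)\<^sup>2) \<le> m \<xi>"
    and m_upper: "\<And>\<xi>. m \<xi> \<le> m1 * (1 + (norm \<xi>)\<^sup>2)"
  shows
    "(s \<le> 1 \<longrightarrow>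
       (\<exists>lam>0. \<forall>(k::nat) (p::ennreal) (r::ennreal) (q::ennreal).
          1 \<le> p \<and> p \<le> 2 \<and> 1 \<le> r \<and> r \<le> 2 \<and> 2 \<le> q \<longrightarrow>
          (\<exists>C>0. \<forall>u0 :: real^'n \<Rightarrow> complex.
             u0 \<in> Lp_space p \<and>
             grad_norm r (k + star_bracket CARD('n) 0 r q) (regular u0) < \<infinity> \<longrightarrow>
             (\<forall>t\<ge>0.
                grad_norm q k (semigroup_P m s t u0)
                \<le> ennreal (C * (1 + t) powr (- (real CARD('n) / 2) * (recip p - recip q) - real k / 2))
                    * Lp_norm p u0
                  + ennreal (C * exp (- lam * t))
                    * grad_norm r (k + star_bracket CARD('n) 0 r q) (regular u0)))))
     \<and>
     (s > 1 \<longrightarrow>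
       (\<forall>(k::nat) (p::ennreal) (r::ennreal) (q::ennreal) (l::real).
          1 \<le> p \<and> p \<le> 2 \<and> 1 \<le> r \<and> r \<le> 2 \<and> 2 \<le> q \<and> 0 \<le> l \<longrightarrow>
          (\<exists>C>0. \<forall>u0 :: real^'n \<Rightarrow> complex.
             u0 \<in> Lp_space p \<and>
             grad_norm r (k + star_bracket CARD('n) l r q) (regular u0) < \<infinity> \<longrightarrow>
             (\<forall>t\<ge>0.
                grad_norm q k (semigroup_P m s t u0)
                \<le> ennreal (C * (1 + t) powr (- (real CARD('n) / 2) * (recip p - recip q) - real k / 2))
                    * Lp_norm p u0
                  + ennreal (C * (1 + t) powr (- (l / (2 * (s - 1)))))
                    * grad_norm r (k + star_bracket CARD('n) l r q) (regular u0)))))"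
proof -
  have m_meas: "m \<in> borel_measurable borel" by (rule borel_measurable_continuous_onI[OF m_cont])
  obtain K where K: "K > 0" "\<And>\<xi>. m \<xi> powr s \<le> K * max 1 (norm \<xi>) powr (2 * s)"
    using powr_symbol_le[OF m0_pos m_lower m_upper, of s] by blast
  have low: "1 / K * (norm \<xi>)\<^sup>2 \<le> (norm \<xi>)\<^sup>2 / m \<xi> powr s" if "norm \<xi> \<le> 1" for \<xi>
  proof -
    have "m \<xi> powr s \<le> K" using K(2)[of \<xi>] that by (simp add: max_absorb1)
    hence "(norm \<xi>)\<^sup>2 / K \<le> (norm \<xi>)\<^sup>2 / m \<xi> powr s"
      using m_pos[of \<xi>] K(1) by (intro divide_left_mono mult_pos_pos) auto
    thus ?thesis by simp
  qed
  \<comment> \<open>The damping rate at frequency \<xi>. It is bounded below for s \<le> 1, but this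
    lower bound degenerates as |\<xi>| grows for s > 1, where decay must therefore be bought with
    derivatives of the data.\<close>
  have symbol: "norm \<xi> powr (2 - 2 * s) / K \<le> (norm \<xi>)\<^sup>2 / m \<xi> powr s" if x: "norm \<xi> > 1" for \<xi>
  proof -
    have "(norm \<xi>)\<^sup>2 = norm \<xi> powr (2 - 2 * s) * norm \<xi> powr (2 * s)"
      using x by (simp flip: powr_add powr_numeral)
    hence "norm \<xi> powr (2 - 2 * s) / K = (norm \<xi>)\<^sup>2 / (K * norm \<xi> powr (2 * s))"
      using x K(1) by (simp add: field_simps)
    also have "\<dots> \<le> (norm \<xi>)\<^sup>2 / m \<xi> powr s"
      using K(2)[of \<xi>] x m_pos[of \<xi>] K(1)
      by (intro divide_left_mono mult_pos_pos) (auto simp: max_def split: if_splits)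
    finally show ?thesis .
  qed
  show ?thesis
  proof (intro conjI impI, goal_cases)
    case s: 1
    have high: "exp (- ((norm \<xi>)\<^sup>2 / m \<xi> powr s) * t) \<le> exp (- (1 / K) * t) * norm \<xi> powr 0"
      if "t \<ge> 0" "norm \<xi> > 1" for t \<xi>
    proof -
      have "1 / K \<le> norm \<xi> powr (2 - 2 * s) / K"
        using s that K(1) ge_one_powr_ge_zero[of "norm \<xi>" "2 - 2 * s"] by (intro divide_right_mono) auto
      also note symbol[OF that(2)]
      finally have "1 / K * t \<le> (norm \<xi>)\<^sup>2 / m \<xi> powr s * t" using that(1) by (rule mult_right_mono)
      moreover have "\<xi> \<noteq> 0" using that by auto
      ultimately show ?thesis by simp
    qed
    show ?case
    \<comment> \<open>The rate comes from the symbol alone and is independent of k, p, r and q, as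
      the order of the quantifiers demands.\<close>
    proof (rule exI[of _ "1 / K"], intro conjI allI impI, goal_cases)
      case 1
      show ?case using K by simp
    next
      case (2 k p r q)
      hence h: "1 \<le> p" "p \<le> 2" "1 \<le> r" "r \<le> 2" "2 \<le> q" by auto
      show ?case
        using semigroup_P_decay[where \<kappa>="1 / K" and l=0 and D="\<lambda>t. exp (- (1 / K) * t)" and k=k,
            OF m_meas h _ low _ high star_bracket_gt[of r q 0 "CARD('n)"]] K(1) h by auto
    qed
  next
    case s: 2
    show ?case
    proof (intro allI impI, goal_cases)
      case (1 k p r q l)
      hence h: "1 \<le> p" "p \<le> 2" "1 \<le> r" "r \<le> 2" "2 \<le> q" and l: "0 \<le> l" by auto
      define A where "A = l / (2 * (s - 1))"
      have A: "A \<ge> 0" "2 * (s - 1) * A = l" using s l by (auto simp: A_def)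
      obtain B where B: "B > 0" "\<And>z. z \<ge> 0 \<Longrightarrow> (1 + z) powr A \<le> B * exp (z / K)"
        using powr_le_const_exp[OF K(1), of A] by blast
      have high: "exp (- ((norm \<xi>)\<^sup>2 / m \<xi> powr s) * t) \<le> B * (1 + t) powr (- A) * norm \<xi> powr l"
        if t: "t \<ge> 0" and x: "norm \<xi> > 1" for t \<xi>
      proof -
        \<comment> \<open>The exponential is at most exp(-t/(yK)), hence at most B (1 + t/y)^(-A).
          Since y \<ge> 1, one has 1 + t/y \<ge> (1 + t)/y, so time and frequency separate; A is
          chosen such that y^A = |\<xi>|^l.\<close>
        define y where "y = norm \<xi> powr (2 * (s - 1))"
        have y: "y \<ge> 1" using x s by (simp add: y_def ge_one_powr_ge_zero)
        have yA: "y powr A = norm \<xi> powr l" unfolding y_def powr_powr A(2) ..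
        have iy: "norm \<xi> powr (2 - 2 * s) = 1 / y"
          unfolding y_def using x by (simp add: powr_minus[symmetric] divide_inverse algebra_simps)
        have "1 / y / K * t \<le> (norm \<xi>)\<^sup>2 / m \<xi> powr s * t"
          using symbol[OF x] t unfolding iy by (rule mult_right_mono)
        hence "exp (- ((norm \<xi>)\<^sup>2 / m \<xi> powr s) * t) \<le> exp (- (t / y / K))" by (simp add: mult.commute)
        also have "\<dots> \<le> B * (1 + t / y) powr (- A)"
        proof -
          have ty: "t / y \<ge> 0" using t y by simp
          hence "(1 + t / y) powr A > 0" by simp
          thus ?thesis using B(2)[OF ty] by (simp add: exp_minus powr_minus field_simps)
        qed
        also have "\<dots> \<le> B * ((1 + t) / y) powr (- A)"
        proof (intro mult_left_mono powr_mono2')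
          show "(1 + t) / y \<le> 1 + t / y" using y by (simp add: add_divide_distrib)
        qed (use A B y t in auto)
        also have "\<dots> = B * (1 + t) powr (- A) * norm \<xi> powr l"
          using y t by (simp add: powr_divide powr_minus yA[symmetric] field_simps)
        finally show ?thesis .
      qed
      have pos: "0 < B * (1 + t) powr (- A)" if "t \<ge> 0" for t using B that by simp
      obtain C where C: "C > 0" and est: "\<And>u t. u \<in> Lp_space p \<Longrightarrow> t \<ge> 0 \<Longrightarrow>
        grad_norm q k (semigroup_P m s t u) \<le>
          ennreal (C * (1 + t) powr (- (real CARD('n) / 2) * (recip p - recip q) - real k / 2)) * Lp_norm p u
          + ennreal (C * (B * (1 + t) powr (- A))) * grad_norm r (k + star_bracket CARD('n) l r q) (regular u)"
        using semigroup_P_decay[where \<kappa>="1 / K" and l=l and k=k,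
            OF m_meas h _ low pos high star_bracket_gt[of r q l "CARD('n)"]] K(1) h l by auto
      show ?case
      \<comment> \<open>One constant has to serve both terms, although \<open>B\<close> enters only
        the second.\<close>
      proof (rule exI[of _ "C * (1 + B)"], intro conjI allI impI, goal_cases)
        case 1
        show ?case using C B by simp
      next
        case (2 u0 t)
        have le: "C * x \<le> C * (1 + B) * x" "C * (B * x) \<le> C * (1 + B) * x" if "x \<ge> 0" for x
          using C B that by (auto simp: algebra_simps)
        note est[OF conjunct1[OF 2(1)] 2(2)]
        also have "ennreal (C * (1 + t) powr (- (real CARD('n) / 2) * (recip p - recip q) - real k / 2)) * Lp_norm p u0
            + ennreal (C * (B * (1 + t) powr (- A))) * grad_norm r (k + star_bracket CARD('n) l r q) (regular u0)
          \<le> ennreal (C * (1 + B) * (1 + t) powr (- (real CARD('n) / 2) * (recip p - recip q) - real k / 2)) * Lp_norm p u0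
            + ennreal (C * (1 + B) * (1 + t) powr (- A)) * grad_norm r (k + star_bracket CARD('n) l r q) (regular u0)"
          by (intro add_mono mult_right_mono ennreal_leI le) auto
        finally show ?case
          unfolding A_def .
      qed
    qed
  qed
qed

end
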